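(* Consider the railway track initial value problem $$\dot{\bm{x}}(t)=\mathcal{A}\bm{x}(t)+\mathcal{F}(\bm{x}(t))+\mathcal{B}\bm{u}(t),\quad t>0,\qquad \bm{x}(0)=\bm{x}_0,$$ with the spaces and operators defined in the context, and let $c_l,c_u,c_h,\omega,\epsilon_3>0$ be Lyapunov constants as defined in the context. If $\bm{x}_0\in D(\mathcal{A})$ and $\bm{u}\in C^1(\mathbb{R}^+;\mathbb{U})$, then the unique classical solution $\bm{x}(t)$ exists for all $t\ge 0$ and satisfies, for all $t\geq 0$, $$\|\bm{x}(t)\|^2\le e^{-\omega t}\left(\frac{c_u}{c_l}\|\bm{x}_0\|^2+\frac{c_h}{c_l}\|\bm{x}_0\|^4\right)+\frac{\epsilon_3}{c_l\,\omega}\left(1-e^{-\omega t}\right)\max_{s\in[0,t]}\|\bm{u}(s)\|_{\mathbb{U}}^2 .$$ Moreover, if there are positive constants $u_0$ and $\delta$ such that $\|\bm{u}(t)\|_{\mathbb{U}}\le u_0e^{-\delta t}$ for all $t\ge 0$, then $\|\bm{x}(t)\|$ decays exponentially to zero, i.e. there are constants $M,\eta>0$ such that $\|\bm{x}(t)\|\le Me^{-\eta t}$ for all $t\ge 0$.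
   Context: The constants $E, I, \rho, a, \ell, k, \alpha, \mu$ are positive and $C_d\ge 0$. All function spaces are real; the subscript $\xi$ denotes differentiation with respect to $\xi\in[0,\ell]$; $\mathbb{R}^+=[0,\infty)$. The state space is $\mathbb{X}=\big(H^2(0,\ell)\cap H^1_0(0,\ell)\big)\times L^2(0,\ell)$ with norm $\|(w,v)\|^2=\int_0^{\ell} EI\, w_{\xi\xi}^2+k w^2+\rho a\, v^2\, d\xi$. The input space is $\mathbb{U}=L^2(0,\ell)$. Let $\mathcal{A}_0 w=w_{\xi\xi\xi\xi}$ with $D(\mathcal{A}_0)=\{w\in H^4(0,\ell): w(0)=w(\ell)=0,\ w_{\xi\xi}(0)=w_{\xi\xi}(\ell)=0\}$. The linear operator $\mathcal{A}$ is $$\mathcal{A}(w,v)=\Big(v,\,-\tfrac{1}{\rho a}\mathcal{A}_0(EI w+C_d v)-\tfrac{1}{\rho a}(\mu v+k w)\Big),$$ $$D(\mathcal{A})=\{(w,v)\in\mathbb{X}: v\in H^2(0,\ell)\cap H^1_0(0,\ell),\ EI w+C_d v\in D(\mathcal{A}_0)\};$$ it generates a strongly continuous semigroup on $\mathbb{X}$. Further, $\mathcal{B}\bm{u}=(0,\tfrac{1}{\rho a}\bm{u})$ for $\bm{u}\in\mathbb{U}$, and $\mathcal{F}(w,v)=(0,-\tfrac{\alpha}{\rho a}w^3)$ for $(w,v)\in\mathbb{X}$. Classical solution: a function $\bm{x}:[0,T)\to\mathbb{X}$ ($0<T\le\infty$) is a classical solution on $[0,T)$ if it is continuous on $[0,T)$,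 continuously differentiable on $(0,T)$, $\bm{x}(t)\in D(\mathcal{A})$ for $0<t<T$, and the initial value problem is satisfied. On a closed interval $[0,T]$ the same is required up to and including $t=T$. Lyapunov constants: fix $c$ with $0<c<\sqrt{\rho k a}$ and $$c<\min\left\{\frac{4\rho a EI}{C_d},\ \frac{4\rho a k\mu}{\mu^2+4\rho a k},\ \frac{4\rho a k\mu}{1+4\rho a k}\right\}$$ ($1/C_d=\infty$ if $C_d=0$), and let $$V(\bm{x})=\int_0^{\ell} EI\, (w_{\xi\xi})^2+k w^2+\frac{\alpha}{2} w^4+\rho a\, v^2+2c\, w v \; d\xi,\qquad \bm{x}=(w,v)\in\mathbb{X}.$$ The positive constants $c_l,c_u,c_h$ are such that $c_l\|\bm{x}\|^2\le V(\bm{x})\le c_u\|\bm{x}\|^2+c_h\|\bm{x}\|^4$ for all $\bm{x}\in\mathbb{X}$. The positive constants $\epsilon_3,\omega$ are such that, for every $T>0$, $\bm{x}_0\in D(\mathcal{A})$ and $\bm{u}\in C^1([0,T];\mathbb{U})$ for which a classical solution $\bm{x}(t)$ exists on $[0,T]$, the function $V(\bm{x}(t))$ is differentiable and $\frac{d}{dt}V(\bm{x}(t))\le \epsilon_3\|\bm{u}(t)\|_{\mathbb{U}}^2-\omega V(\bm{x}(t))$ for all $t\in[0,T]$. (Such constants exist for every such $c$.) *)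

theory Defs
  imports "HOL-Analysis.Analysis" "HOL-Library.Function_Algebras"
begin

text \<open>Pointwise real vector space structure on functions. Elements of \<open>L\<^sup>2(0,l)\<close> are represented by
  functions \<open>real \<Rightarrow> real\<close>; all notions below depend only on the class modulo equality almost
  everywhere on \<open>(0,l)\<close>. Norms are therefore explicit functionals, and the topology used on these
  functions is never the product topology of the function type.\<close>

instantiation "fun" :: (type, real_vector) real_vector
begin

definition scaleR_fun :: "real \<Rightarrow> ('a \<Rightarrow> 'b) \<Rightarrow> 'a \<Rightarrow> 'b" where
  "scaleR_fun r f = (\<lambda>x. r *\<^sub>R f x)"

instance
  by standard (auto simp: scaleR_fun_def plus_fun_def algebra_simps)

end

section \<open>Sobolev spaces on \<open>(0,l)\<close>\<close>

abbreviation leb :: "real \<Rightarrow> real measure" where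
  "leb l \<equiv> lebesgue_on {0<..<l}"

definition L2 :: "real \<Rightarrow> (real \<Rightarrow> real) set" where
  "L2 l = {f \<in> borel_measurable (leb l). integrable (leb l) (\<lambda>x. (f x)\<^sup>2)}"

definition L2norm :: "real \<Rightarrow> (real \<Rightarrow> real) \<Rightarrow> real" where
  "L2norm l f = sqrt (LINT x|leb l. (f x)\<^sup>2)"

definition eq_ae :: "real \<Rightarrow> (real \<Rightarrow> real) \<Rightarrow> (real \<Rightarrow> real) \<Rightarrow> bool" where
  "eq_ae l f g \<longleftrightarrow> (AE x in leb l. f x = g x)"

text \<open>\<open>C\<^sup>1\<close> functions with compact support in the open interval \<open>(0,l)\<close>.\<close>

definition C1c :: "real \<Rightarrow> (real \<Rightarrow> real) set" where
  "C1c l = {\<phi>. \<phi> C1_differentiable_on UNIV \<and> closure {x. \<phi> x \<noteq> 0} \<subseteq> {0<..<l}}"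

text \<open>Weak derivatives with \<open>C\<^sup>1\<close> test functions and the recursive definition of \<open>H\<^sup>m\<close>, as in
  Brezis, Functional Analysis, Sobolev Spaces and PDE, Chapter 8.\<close>

definition weak_deriv :: "real \<Rightarrow> (real \<Rightarrow> real) \<Rightarrow> (real \<Rightarrow> real) \<Rightarrow> bool" where
  "weak_deriv l f g \<longleftrightarrow> f \<in> L2 l \<and> g \<in> L2 l \<and>
     (\<forall>\<phi>\<in>C1c l. (LINT x|leb l. f x * deriv \<phi> x) = - (LINT x|leb l. g x * \<phi> x))"

text \<open>The weak derivative is unique up to null sets; \<open>wd\<close> picks a representative. It is meaningful
  only on functions that have a weak derivative.\<close>

definition wd :: "real \<Rightarrow> (real \<Rightarrow> real) \<Rightarrow> (real \<Rightarrow> real)" where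
  "wd l f = (SOME g. weak_deriv l f g)"

primrec Hsob :: "nat \<Rightarrow> real \<Rightarrow> (real \<Rightarrow> real) set" where
  "Hsob 0 l = L2 l"
| "Hsob (Suc m) l = {f. \<exists>g\<in>Hsob m l. weak_deriv l f g}"

definition H1norm :: "real \<Rightarrow> (real \<Rightarrow> real) \<Rightarrow> real" where
  "H1norm l f = sqrt (LINT x|leb l. (f x)\<^sup>2 + (wd l f x)\<^sup>2)"

definition H10 :: "real \<Rightarrow> (real \<Rightarrow> real) set" where
  "H10 l = {f \<in> Hsob 1 l. \<forall>e>0. \<exists>\<phi>\<in>C1c l. H1norm l (f - \<phi>) < e}"

text \<open>Boundary values are those of the continuous representative on \<open>[0,l]\<close>.\<close>

definition vanishes_at_ends :: "real \<Rightarrow> (real \<Rightarrow> real) \<Rightarrow> bool" where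
  "vanishes_at_ends l f \<longleftrightarrow>
     (\<exists>g. continuous_on {0..l} g \<and> eq_ae l f g \<and> g 0 = 0 \<and> g l = 0)"

section \<open>Calculus with values in a function space with (semi)norm \<open>N\<close> and carrier \<open>C\<close>\<close>

definition norm_continuous_on ::
  "('v::real_vector \<Rightarrow> real) \<Rightarrow> real set \<Rightarrow> (real \<Rightarrow> 'v) \<Rightarrow> bool" where
  "norm_continuous_on N S x \<longleftrightarrow> (\<forall>t\<in>S. ((\<lambda>s. N (x s - x t)) \<longlongrightarrow> 0) (at t within S))"

definition has_norm_derivative ::
  "('v::real_vector \<Rightarrow> real) \<Rightarrow> real set \<Rightarrow> (real \<Rightarrow> 'v) \<Rightarrow> 'v \<Rightarrow> real \<Rightarrow> bool" where
  "has_norm_derivative N S x d t \<longleftrightarrow>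
     ((\<lambda>s. N ((1 / (s - t)) *\<^sub>R (x s - x t) - d)) \<longlongrightarrow> 0) (at t within S)"

definition C1_with ::
  "'v set \<Rightarrow> ('v::real_vector \<Rightarrow> real) \<Rightarrow> real set \<Rightarrow> (real \<Rightarrow> 'v) \<Rightarrow> (real \<Rightarrow> 'v) \<Rightarrow> bool" where
  "C1_with C N S x x' \<longleftrightarrow> (\<forall>t\<in>S. x t \<in> C \<and> x' t \<in> C \<and> has_norm_derivative N S x (x' t) t)
     \<and> norm_continuous_on N S x'"

section \<open>The railway track model\<close>

text \<open>The fields are \<open>E\<close>, \<open>I\<close>, \<open>\<rho>\<close>, \<open>a\<close>, \<open>\<ell>\<close>, \<open>k\<close>, \<open>\<alpha>\<close>, \<open>\<mu>\<close>, \<open>C\<^sub>d\<close>, in this order.\<close>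

record track =
  tE :: real
  tI :: real
  trho :: real
  ta :: real
  tlen :: real
  tk :: real
  talpha :: real
  tmu :: real
  tCd :: real

type_synonym state = "(real \<Rightarrow> real) \<times> (real \<Rightarrow> real)"

definition track_params :: "track \<Rightarrow> bool" where
  "track_params p \<longleftrightarrow> 0 < tE p \<and> 0 < tI p \<and> 0 < trho p \<and> 0 < ta p \<and> 0 < tlen p \<and>
     0 < tk p \<and> 0 < talpha p \<and> 0 < tmu p \<and> 0 \<le> tCd p"

definition XX :: "track \<Rightarrow> state set" where
  "XX p = (Hsob 2 (tlen p) \<inter> H10 (tlen p)) \<times> L2 (tlen p)"

definition Xnorm :: "track \<Rightarrow> state \<Rightarrow> real" where
  "Xnorm p = (\<lambda>(w, v). sqrt (LINT x|leb (tlen p).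
     tE p * tI p * (wd (tlen p) (wd (tlen p) w) x)\<^sup>2 + tk p * (w x)\<^sup>2 + trho p * ta p * (v x)\<^sup>2))"

definition Xeq :: "track \<Rightarrow> state \<Rightarrow> state \<Rightarrow> bool" where
  "Xeq p x y \<longleftrightarrow> eq_ae (tlen p) (fst x) (fst y) \<and> eq_ae (tlen p) (snd x) (snd y)"

definition A0 :: "track \<Rightarrow> (real \<Rightarrow> real) \<Rightarrow> (real \<Rightarrow> real)" where
  "A0 p w = (wd (tlen p) ^^ 4) w"

definition domA0 :: "track \<Rightarrow> (real \<Rightarrow> real) set" where
  "domA0 p = {w \<in> Hsob 4 (tlen p). vanishes_at_ends (tlen p) w \<and>
     vanishes_at_ends (tlen p) (wd (tlen p) (wd (tlen p) w))}"

definition opA :: "track \<Rightarrow> state \<Rightarrow> state" where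
  "opA p = (\<lambda>(w, v). (v,
     - ((1 / (trho p * ta p)) *\<^sub>R A0 p ((tE p * tI p) *\<^sub>R w + tCd p *\<^sub>R v))
     - (1 / (trho p * ta p)) *\<^sub>R (tmu p *\<^sub>R v + tk p *\<^sub>R w)))"

definition domA :: "track \<Rightarrow> state set" where
  "domA p = {(w, v). (w, v) \<in> XX p \<and> v \<in> Hsob 2 (tlen p) \<inter> H10 (tlen p) \<and>
     (tE p * tI p) *\<^sub>R w + tCd p *\<^sub>R v \<in> domA0 p}"

definition opB :: "track \<Rightarrow> (real \<Rightarrow> real) \<Rightarrow> state" where
  "opB p u = (0, (1 / (trho p * ta p)) *\<^sub>R u)"

definition opF :: "track \<Rightarrow> state \<Rightarrow> state" where
  "opF p = (\<lambda>(w, v). (0, \<lambda>x. - (talpha p / (trho p * ta p)) * (w x) ^ 3))"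

text \<open>Classical solution on a time interval \<open>J\<close> with left endpoint \<open>0 \<in> J\<close>. For \<open>J = [0,T]\<close> the
  derivative at \<open>T\<close> is one-sided.\<close>

definition classical_solution ::
  "track \<Rightarrow> (real \<Rightarrow> real \<Rightarrow> real) \<Rightarrow> state \<Rightarrow> real set \<Rightarrow> (real \<Rightarrow> state) \<Rightarrow> bool" where
  "classical_solution p u x0 J x \<longleftrightarrow>
     (\<forall>t\<in>J. x t \<in> XX p) \<and> norm_continuous_on (Xnorm p) J x \<and> Xeq p (x 0) x0 \<and>
     (\<exists>x'. C1_with (XX p) (Xnorm p) (J - {0}) x x' \<and>
       (\<forall>t\<in>J - {0}. x t \<in> domA p \<and> Xeq p (x' t) (opA p (x t) + opF p (x t) + opB p (u t))))"

definition C1_input :: "track \<Rightarrow> real set \<Rightarrow> (real \<Rightarrow> real \<Rightarrow> real) \<Rightarrow> bool" where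
  "C1_input p J u \<longleftrightarrow> (\<exists>u'. C1_with (L2 (tlen p)) (L2norm (tlen p)) J u u')"

definition lyap :: "track \<Rightarrow> real \<Rightarrow> state \<Rightarrow> real" where
  "lyap p c = (\<lambda>(w, v). LINT x|leb (tlen p).
     tE p * tI p * (wd (tlen p) (wd (tlen p) w) x)\<^sup>2 + tk p * (w x)\<^sup>2 + talpha p / 2 * (w x) ^ 4
     + trho p * ta p * (v x)\<^sup>2 + 2 * c * w x * v x)"

text \<open>For \<open>C\<^sub>d = 0\<close> the first bound of the minimum is infinite.\<close>

definition admissible_c :: "track \<Rightarrow> real \<Rightarrow> bool" where
  "admissible_c p c \<longleftrightarrow> 0 < c \<and> c < sqrt (trho p * tk p * ta p) \<and>
     (tCd p \<noteq> 0 \<longrightarrow> c < 4 * trho p * ta p * (tE p * tI p) / tCd p) \<and>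
     c < 4 * trho p * ta p * tk p * tmu p / ((tmu p)\<^sup>2 + 4 * trho p * ta p * tk p) \<and>
     c < 4 * trho p * ta p * tk p * tmu p / (1 + 4 * trho p * ta p * tk p)"

definition lyap_bounds :: "track \<Rightarrow> real \<Rightarrow> real \<Rightarrow> real \<Rightarrow> real \<Rightarrow> bool" where
  "lyap_bounds p c cl cu ch \<longleftrightarrow> 0 < cl \<and> 0 < cu \<and> 0 < ch \<and>
     (\<forall>x\<in>XX p. cl * (Xnorm p x)\<^sup>2 \<le> lyap p c x \<and>
        lyap p c x \<le> cu * (Xnorm p x)\<^sup>2 + ch * (Xnorm p x) ^ 4)"

definition lyap_decay :: "track \<Rightarrow> real \<Rightarrow> real \<Rightarrow> real \<Rightarrow> bool" where
  "lyap_decay p c eps3 om \<longleftrightarrow> 0 < eps3 \<and> 0 < om \<and>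
     (\<forall>T>0. \<forall>x0\<in>domA p. \<forall>u x. C1_input p {0..T} u \<longrightarrow> classical_solution p u x0 {0..T} x \<longrightarrow>
        (\<forall>t\<in>{0..T}. \<exists>D. ((\<lambda>s. lyap p c (x s)) has_real_derivative D) (at t within {0..T}) \<and>
           D \<le> eps3 * (L2norm (tlen p) (u t))\<^sup>2 - om * lyap p c (x t)))"

end

theory Submission
  imports Defs
begin

text \<open>In the sine basis of \<open>L\<^sup>2(0,l)\<close> the operator splits into two-dimensional blocks: with
  \<open>W\<^sub>n = \<sigma>\<^sub>n w\<^sub>n\<close>, \<open>\<sigma>\<^sub>n\<^sup>2 = (EI \<lambda>\<^sub>n + k) / (\<rho> a)\<close> and \<open>d\<^sub>n = (C\<^sub>d \<lambda>\<^sub>n + \<mu>) / (\<rho> a)\<close>,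
  where \<open>\<lambda>\<^sub>n\<close> are the eigenvalues of \<open>\<A>\<^sub>0\<close>, it becomes the dissipative system
  \<open>W\<^sub>n' = \<sigma>\<^sub>n v\<^sub>n\<close>, \<open>v\<^sub>n' = - \<sigma>\<^sub>n W\<^sub>n - d\<^sub>n v\<^sub>n + g\<^sub>n\<close> in \<open>\<ell>\<^sup>2 \<times> \<ell>\<^sup>2\<close>, and the norm of the state
  space is \<open>\<surd>(\<rho> a)\<close> times the norm there. Linear equations are solved by truncation to
  finitely many modes. For the nonlinear one the derivative \<open>z\<close> of the solution is the unknown:
  \<open>x' = z\<close>, \<open>z' = A z + b' + F'(x) z\<close> only requires weak solutions, and a weak solution
  \<open>(x, z)\<close> makes \<open>x\<close> a classical one. The coefficient \<open>F'(x)\<close> is cut off at a large radius; the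
  Lyapunov inequality shows that the solution never reaches it, and yields the decay estimates by
  Gronwall's argument.\<close>

section \<open>The Hilbert space of square-summable sequences\<close>

text \<open>Taking \<open>z = x'\<close> as unknown spares a regularity proof for mild solutions:
  \<open>x\<close>, an integral of \<open>z\<close>, is continuously differentiable by construction.
  The original equation returns as a conservation law: the residual
  \<open>z - A x - b - F(x)\<close> has derivative zero in every truncation, and it vanishes at time
  0 if \<open>z\<close> starts at \<open>A x0 + b(0) + F(x0)\<close>. This start value is where
  \<open>x0\<close> in the domain enters; the smoothness of the input enters through
  \<open>b'\<close>. Two obstacles shape the rest. The Lyapunov inequality is assumed for classical
  solutions on closed intervals only, so no bound is available before a solution of the equation
  without cutoff is at hand; a first-exit argument breaks this circle. And states are raw functions
  with derivatives picked by a choice operator, so every hypothesis has to be carried to sequences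
  and back. Membership in the Sobolev spaces then becomes summability. In particular the domain
  condition on \<open>EI w + C_d v\<close>, which does not give four derivatives to \<open>w\<close>
  or \<open>v\<close> separately, can be read off from the coordinates of \<open>z\<close>.\<close>

typedef ell2 = "{a :: nat \<Rightarrow> real. summable (\<lambda>n. (a n)\<^sup>2)}"
  morphisms ell2_nth Abs_ell2
  by (rule exI[of _ "\<lambda>_. 0"]) simp

setup_lifting type_definition_ell2

lemma summable_mult_of_squares:
  fixes a b :: "nat \<Rightarrow> real"
  assumes "summable (\<lambda>n. (a n)\<^sup>2)" "summable (\<lambda>n. (b n)\<^sup>2)"
  shows "summable (\<lambda>n. a n * b n)"
proof (rule summable_comparison_test'[of "\<lambda>n. (a n)\<^sup>2 + (b n)\<^sup>2" 0])
  show "summable (\<lambda>n. (a n)\<^sup>2 + (b n)\<^sup>2)"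
    using assms by (rule summable_add)
  fix n
  have "2 * (\<bar>a n\<bar> * \<bar>b n\<bar>) \<le> (a n)\<^sup>2 + (b n)\<^sup>2"
    using sum_squares_bound[of "\<bar>a n\<bar>" "\<bar>b n\<bar>"] by simp
  moreover have "0 \<le> \<bar>a n\<bar> * \<bar>b n\<bar>" by simp
  ultimately have "\<bar>a n\<bar> * \<bar>b n\<bar> \<le> (a n)\<^sup>2 + (b n)\<^sup>2" by linarith
  then show "norm (a n * b n) \<le> (a n)\<^sup>2 + (b n)\<^sup>2"
    by (simp add: abs_mult)
qed

lemma summable_add_squares:
  fixes a b :: "nat \<Rightarrow> real"
  assumes "summable (\<lambda>n. (a n)\<^sup>2)" "summable (\<lambda>n. (b n)\<^sup>2)"
  shows "summable (\<lambda>n. (a n + b n)\<^sup>2)"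
proof -
  have "summable (\<lambda>n. (a n)\<^sup>2 + (b n)\<^sup>2 + 2 * (a n * b n))"
    by (intro summable_add assms summable_mult summable_mult_of_squares)
  then show ?thesis by (simp add: power2_sum algebra_simps)
qed

instantiation ell2 :: real_vector
begin

lift_definition zero_ell2 :: ell2 is "\<lambda>_. 0" by simp
lift_definition plus_ell2 :: "ell2 \<Rightarrow> ell2 \<Rightarrow> ell2" is "\<lambda>a b n. a n + b n"
  by (rule summable_add_squares)
lift_definition uminus_ell2 :: "ell2 \<Rightarrow> ell2" is "\<lambda>a n. - a n" by simp
lift_definition scaleR_ell2 :: "real \<Rightarrow> ell2 \<Rightarrow> ell2" is "\<lambda>r a n. r * a n"
  by (simp add: power_mult_distrib summable_mult)
definition minus_ell2 :: "ell2 \<Rightarrow> ell2 \<Rightarrow> ell2" where "minus_ell2 a b = a + - b"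

instance
  by standard (simp_all add: minus_ell2_def, (transfer, simp add: algebra_simps)+)

end

lemma ell2_nth_zero [simp]: "ell2_nth 0 n = 0"
  by transfer simp

lemma ell2_nth_add [simp]: "ell2_nth (a + b) n = ell2_nth a n + ell2_nth b n"
  by transfer simp

lemma ell2_nth_uminus [simp]: "ell2_nth (- a) n = - ell2_nth a n"
  by transfer simp

lemma ell2_nth_diff [simp]: "ell2_nth (a - b) n = ell2_nth a n - ell2_nth b n"
  unfolding minus_ell2_def ell2_nth_add ell2_nth_uminus by simp

lemma ell2_nth_scaleR [simp]: "ell2_nth (r *\<^sub>R a) n = r * ell2_nth a n"
  by transfer simp

lemma ell2_eqI: "(\<And>n. ell2_nth a n = ell2_nth b n) \<Longrightarrow> a = b"
  by (simp add: ell2_nth_inject[symmetric] fun_eq_iff)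

lemma summable_ell2 [simp]: "summable (\<lambda>n. (ell2_nth a n)\<^sup>2)"
  using ell2_nth[of a] by simp

lemma summable_ell2_mult [simp]: "summable (\<lambda>n. ell2_nth a n * ell2_nth b n)"
  by (intro summable_mult_of_squares) auto

instantiation ell2 :: real_inner
begin

definition inner_ell2 :: "ell2 \<Rightarrow> ell2 \<Rightarrow> real" where
  "inner_ell2 a b = (\<Sum>n. ell2_nth a n * ell2_nth b n)"
definition norm_ell2 :: "ell2 \<Rightarrow> real" where "norm_ell2 a = sqrt (inner a a)"
definition sgn_ell2 :: "ell2 \<Rightarrow> ell2" where "sgn_ell2 a = a /\<^sub>R norm a"
definition dist_ell2 :: "ell2 \<Rightarrow> ell2 \<Rightarrow> real" where "dist_ell2 a b = norm (a - b)"
definition uniformity_ell2 :: "(ell2 \<times> ell2) filter" where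
  "uniformity_ell2 = (INF e\<in>{0 <..}. principal {(x, y). dist x y < e})"
definition open_ell2 :: "ell2 set \<Rightarrow> bool" where
  "open_ell2 U = (\<forall>x\<in>U. eventually (\<lambda>(x', y). x' = x \<longrightarrow> y \<in> U) uniformity)"

instance
proof
  fix a b c :: ell2 and r :: real
  show "inner a b = inner b a"
    by (simp add: inner_ell2_def mult.commute)
  show "inner (a + b) c = inner a c + inner b c"
    using suminf_add[OF summable_ell2_mult[of a c] summable_ell2_mult[of b c]]
    by (simp add: inner_ell2_def distrib_right)
  show "inner (r *\<^sub>R a) b = r * inner a b"
    using suminf_mult[OF summable_ell2_mult[of a b], of r]
    by (simp add: inner_ell2_def mult.assoc)
  show "0 \<le> inner a a"
    unfolding inner_ell2_def by (rule suminf_nonneg) simp_all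
  show "(inner a a = 0) = (a = 0)"
  proof
    assume "inner a a = 0"
    then have "(\<Sum>n. (ell2_nth a n)\<^sup>2) = 0"
      by (simp add: inner_ell2_def power2_eq_square)
    then have "ell2_nth a n = 0" for n
      using suminf_eq_zero_iff[of "\<lambda>n. (ell2_nth a n)\<^sup>2"] by simp
    then show "a = 0" by (intro ell2_eqI) simp
  qed (simp add: inner_ell2_def)
qed (rule dist_ell2_def sgn_ell2_def uniformity_ell2_def norm_ell2_def open_ell2_def)+

end

lemma norm_ell2_squared: "(norm (a::ell2))\<^sup>2 = (\<Sum>n. (ell2_nth a n)\<^sup>2)"
  unfolding power2_norm_eq_inner inner_ell2_def by (simp add: power2_eq_square)

lemma sum_squares_le_norm_ell2: "finite I \<Longrightarrow> (\<Sum>n\<in>I. (ell2_nth a n)\<^sup>2) \<le> (norm a)\<^sup>2"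
  unfolding norm_ell2_squared by (rule sum_le_suminf) auto

lemma abs_ell2_nth_le: "\<bar>ell2_nth a n\<bar> \<le> norm a"
  by (rule abs_le_square_iff[THEN iffD2, of _ "norm a", simplified])
    (use sum_squares_le_norm_ell2[of "{n}" a] in simp)

lemma bounded_linear_ell2_nth: "bounded_linear (\<lambda>a. ell2_nth a n)"
  by (rule bounded_linear_intro[of _ 1]) (auto simp: abs_ell2_nth_le)

lemma ell2_summableI_bounded:
  fixes a :: "nat \<Rightarrow> real"
  assumes "\<And>N. (\<Sum>n<N. (a n)\<^sup>2) \<le> B"
  shows "summable (\<lambda>n. (a n)\<^sup>2)"
  using assms by (intro summableI_nonneg_bounded) auto

lemma norm_ell2_leI:
  assumes "\<And>N. (\<Sum>n<N. (ell2_nth a n)\<^sup>2) \<le> B\<^sup>2" "0 \<le> B"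
  shows "norm a \<le> B"
proof -
  have "(norm a)\<^sup>2 \<le> B\<^sup>2"
    unfolding norm_ell2_squared using assms by (intro suminf_le_const) auto
  then show ?thesis using \<open>0 \<le> B\<close> by (rule power2_le_imp_le)
qed

instance ell2 :: banach
proof
  fix X :: "nat \<Rightarrow> ell2"
  assume X: "Cauchy X"
  have "Cauchy (\<lambda>k. ell2_nth (X k) n)" for n
    by (rule bounded_linear.Cauchy[OF bounded_linear_ell2_nth X])
  then have "convergent (\<lambda>k. ell2_nth (X k) n)" for n
    by (simp add: real_Cauchy_convergent)
  then obtain a where a: "\<And>n. (\<lambda>k. ell2_nth (X k) n) \<longlonglongrightarrow> a n"
    unfolding convergent_def by metis
  \<comment> \<open>Bounds on finite partial sums survive the coordinatewise limit, which is not yet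
    known to be square-summable; hence the quantifier over \<open>N\<close> instead of a
    norm.\<close>
  have tail: "\<exists>K. \<forall>k\<ge>K. \<forall>N. (\<Sum>n<N. (ell2_nth (X k) n - a n)\<^sup>2) \<le> e\<^sup>2" if "e > 0" for e
  proof -
    obtain K where K: "\<And>j k. j \<ge> K \<Longrightarrow> k \<ge> K \<Longrightarrow> norm (X j - X k) < e"
      using X \<open>e > 0\<close> unfolding Cauchy_iff by meson
    have "(\<Sum>n<N. (ell2_nth (X k) n - a n)\<^sup>2) \<le> e\<^sup>2" if "k \<ge> K" for k N
    proof (rule LIMSEQ_le_const2)
      show "(\<lambda>j. \<Sum>n<N. (ell2_nth (X k) n - ell2_nth (X j) n)\<^sup>2)
          \<longlonglongrightarrow> (\<Sum>n<N. (ell2_nth (X k) n - a n)\<^sup>2)"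
        by (intro tendsto_intros a)
      have "(\<Sum>n<N. (ell2_nth (X k) n - ell2_nth (X j) n)\<^sup>2) \<le> e\<^sup>2" if "j \<ge> K" for j
      proof -
        have "(\<Sum>n<N. (ell2_nth (X k) n - ell2_nth (X j) n)\<^sup>2) \<le> (norm (X k - X j))\<^sup>2"
          using sum_squares_le_norm_ell2[of "{..<N}" "X k - X j"] by simp
        also have "\<dots> \<le> e\<^sup>2"
          using K[OF \<open>k \<ge> K\<close> that] by (intro power_mono) auto
        finally show ?thesis .
      qed
      then show "\<exists>M. \<forall>j\<ge>M. (\<Sum>n<N. (ell2_nth (X k) n - ell2_nth (X j) n)\<^sup>2) \<le> e\<^sup>2"
        by blast
    qed
    then show ?thesis by blast
  qed
  obtain K1 where "\<And>N. (\<Sum>n<N. (ell2_nth (X K1) n - a n)\<^sup>2) \<le> 1"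
    using tail[of 1] by auto
  then have "summable (\<lambda>n. (ell2_nth (X K1) n - a n)\<^sup>2)"
    by (rule ell2_summableI_bounded)
  then have "summable (\<lambda>n. ((- 1) * (ell2_nth (X K1) n - a n))\<^sup>2)"
    unfolding power_mult_distrib by (intro summable_mult)
  from summable_add_squares[OF this summable_ell2[of "X K1"]]
  have nth: "ell2_nth (Abs_ell2 a) = a"
    by (intro Abs_ell2_inverse) simp
  have "X \<longlonglongrightarrow> Abs_ell2 a"
  proof (rule LIMSEQ_I)
    fix r :: real assume "0 < r"
    then obtain K where K: "\<And>k N. k \<ge> K \<Longrightarrow> (\<Sum>n<N. (ell2_nth (X k) n - a n)\<^sup>2) \<le> (r/2)\<^sup>2"
      using tail[of "r/2"] by auto
    have "norm (X k - Abs_ell2 a) < r" if "k \<ge> K" for k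
    proof -
      have "norm (X k - Abs_ell2 a) \<le> r/2"
        by (rule norm_ell2_leI) (use K[OF that] \<open>0 < r\<close> in \<open>auto simp: nth\<close>)
      then show ?thesis using \<open>0 < r\<close> by simp
    qed
    then show "\<exists>no. \<forall>k\<ge>no. norm (X k - Abs_ell2 a) < r" by blast
  qed
  then show "convergent X" by (rule convergentI)
qed

section \<open>Ordinary differential equations in Banach spaces\<close>

text \<open>Banach's fixed point theorem in Bielecki's weighted sup norm: for large
  \<open>\<kappa>\<close> the weight \<open>exp (\<kappa> * t)\<close> makes Volterra operators
  contract on all of \<open>{0..T}\<close>, so no interval has to be subdivided. The metric space is
  replaced by a set \<open>S\<close> of total functions that are compared on \<open>{0..T}\<close>
  only.\<close>

lemma weighted_contraction_fixpoint:
  fixes L :: "(real \<Rightarrow> 'a::banach) \<Rightarrow> real \<Rightarrow> 'a"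
  assumes "0 \<le> \<kappa>"
    and cont: "\<And>z. z \<in> S \<Longrightarrow> continuous_on {0..T} z"
    and maps: "\<And>z. z \<in> S \<Longrightarrow> L z \<in> S"
    and start: "f0 \<in> S"
    and closed: "\<And>f z. (\<And>j. f j \<in> S) \<Longrightarrow> uniform_limit {0..T} f z sequentially \<Longrightarrow> z \<in> S"
    and contr: "\<And>z1 z2 D t. \<lbrakk>z1 \<in> S; z2 \<in> S; 0 \<le> D;
        \<And>t. t \<in> {0..T} \<Longrightarrow> norm (z1 t - z2 t) \<le> D * exp (\<kappa> * t); t \<in> {0..T}\<rbrakk>
        \<Longrightarrow> norm (L z1 t - L z2 t) \<le> D / 2 * exp (\<kappa> * t)"
  obtains z where "z \<in> S" "\<And>t. t \<in> {0..T} \<Longrightarrow> L z t = z t"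
proof -
  define f where "f j = (L ^^ j) f0" for j
  have fS: "f j \<in> S" for j
    unfolding f_def by (induction j) (auto intro: start maps)
  have fSuc: "f (Suc j) = L (f j)" for j
    by (simp add: f_def)
  have "compact ((\<lambda>t. f 1 t - f 0 t) ` {0..T})"
    by (intro compact_continuous_image continuous_intros cont fS) auto
  then have "bounded ((\<lambda>t. f 1 t - f 0 t) ` {0..T})" by (rule compact_imp_bounded)
  then obtain D0 where D0: "\<And>t. t \<in> {0..T} \<Longrightarrow> norm (f 1 t - f 0 t) \<le> D0"
    unfolding bounded_iff by blast
  define D where "D = max D0 0"
  have D: "0 \<le> D" "\<And>t. t \<in> {0..T} \<Longrightarrow> norm (f 1 t - f 0 t) \<le> D"
    using D0 by (fastforce simp: D_def)+
  have step: "norm (f (Suc j) t - f j t) \<le> D / 2 ^ j * exp (\<kappa> * t)" if "t \<in> {0..T}" for j t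
    using that
  proof (induction j arbitrary: t)
    case 0
    have "D * 1 \<le> D * exp (\<kappa> * t)"
      using 0 D(1) \<open>0 \<le> \<kappa>\<close> by (intro mult_left_mono) auto
    with D(2)[OF 0] show ?case by simp
  next
    case (Suc j)
    show ?case
      using contr[OF fS fS _ Suc.IH Suc.prems] D(1) by (simp add: fSuc)
  qed
  have step': "norm (f (Suc j) t - f j t) \<le> D * exp (\<kappa> * T) * (1/2) ^ j" if "t \<in> {0..T}" for j t
  proof -
    have "norm (f (Suc j) t - f j t) \<le> D / 2 ^ j * exp (\<kappa> * t)" by (rule step[OF that])
    also have "\<dots> \<le> D / 2 ^ j * exp (\<kappa> * T)"
      using that D(1) \<open>0 \<le> \<kappa>\<close> by (intro mult_left_mono) (auto intro: mult_left_mono)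
    finally show ?thesis by (simp add: power_one_over field_simps)
  qed
  \<comment> \<open>The limit is written as a telescoping series, so that the geometric decay of the
    increments gives uniform convergence by the M-test.\<close>
  define z where "z t = f 0 t + (\<Sum>i. f (Suc i) t - f i t)" for t
  have "uniform_limit {0..T} (\<lambda>n t. \<Sum>i<n. f (Suc i) t - f i t)
      (\<lambda>t. \<Sum>i. f (Suc i) t - f i t) sequentially"
    by (rule Weierstrass_m_test[OF step']) (auto intro: summable_mult summable_geometric)
  moreover have telescope: "f 0 t + (\<Sum>i<n. f (Suc i) t - f i t) = f n t" for n t
    using sum_lessThan_telescope[of "\<lambda>i. f i t" n] by simp
  ultimately have "uniform_limit {0..T} (\<lambda>n t. f 0 t + (\<Sum>i<n. f (Suc i) t - f i t)) z sequentially"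
    unfolding z_def by (intro uniform_limit_intros)
  then have lim: "uniform_limit {0..T} f z sequentially"
    by (simp add: telescope)
  then have zS: "z \<in> S" by (rule closed[OF fS])
  have "L z t = z t" if t: "t \<in> {0..T}" for t
  proof -
    have "(\<lambda>j. f (Suc j) t) \<longlonglongrightarrow> L z t"
    proof (rule LIMSEQ_I)
      fix r :: real assume "0 < r"
      define e where "e = r / exp (\<kappa> * t)"
      have "0 < e" using \<open>0 < r\<close> by (simp add: e_def)
      obtain J where J: "\<And>j s. j \<ge> J \<Longrightarrow> s \<in> {0..T} \<Longrightarrow> dist (f j s) (z s) < e"
        using uniform_limitD[OF lim \<open>0 < e\<close>] unfolding eventually_sequentially by blast
      have "norm (f (Suc j) t - L z t) < r" if "j \<ge> J" for j
      proof -
        have "norm (f j s - z s) \<le> e * exp (\<kappa> * s)" if "s \<in> {0..T}" for s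
        proof -
          have "norm (f j s - z s) \<le> e * 1"
            using J[OF \<open>j \<ge> J\<close> that] by (simp add: dist_norm)
          also have "\<dots> \<le> e * exp (\<kappa> * s)"
            using that \<open>0 < e\<close> \<open>0 \<le> \<kappa>\<close> by (intro mult_left_mono) auto
          finally show ?thesis .
        qed
        then have "norm (L (f j) t - L z t) \<le> e / 2 * exp (\<kappa> * t)"
          using \<open>0 < e\<close> by (intro contr fS zS t) auto
        also have "\<dots> = r / 2" by (simp add: e_def)
        also have "\<dots> < r" using \<open>0 < r\<close> by simp
        finally show ?thesis by (simp add: fSuc)
      qed
      then show "\<exists>no. \<forall>j\<ge>no. norm (f (Suc j) t - L z t) < r" by blast
    qed
    moreover have "(\<lambda>j. f (Suc j) t) \<longlonglongrightarrow> z t"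
      using tendsto_uniform_limitI[OF lim t] by (rule LIMSEQ_Suc)
    ultimately show ?thesis by (rule LIMSEQ_unique)
  qed
  with zS show ?thesis by (rule that)
qed

text \<open>Formally the norm of \<open>y\<close> grows at rate at most \<open>h\<close>, and
  \<open>\<eta>\<close> is an antiderivative of \<open>h\<close>. The norm is not differentiable at
  zero, so \<open>sqrt (y \<bullet> y + e\<^sup>2)\<close> is differentiated instead and
  \<open>e\<close> is sent to zero.\<close>

lemma norm_le_of_inner_derivative_le:
  fixes y :: "real \<Rightarrow> 'a::real_inner"
  assumes "a \<le> b" "continuous_on {a..b} y" "continuous_on {a..b} \<eta>"
    and y': "\<And>t. a < t \<Longrightarrow> t < b \<Longrightarrow> (y has_vector_derivative y' t) (at t)"
    and \<eta>': "\<And>t. a < t \<Longrightarrow> t < b \<Longrightarrow> (\<eta> has_real_derivative h t) (at t)"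
    and h: "\<And>t. a < t \<Longrightarrow> t < b \<Longrightarrow> y' t \<bullet> y t \<le> h t * norm (y t)"
      "\<And>t. a < t \<Longrightarrow> t < b \<Longrightarrow> 0 \<le> h t"
  shows "norm (y b) \<le> norm (y a) + \<eta> b - \<eta> a"
proof (cases "a = b")
  case False
  with \<open>a \<le> b\<close> have "a < b" by simp
  show ?thesis
  proof (rule field_le_epsilon)
    fix e :: real assume "0 < e"
    define \<psi> where "\<psi> t = sqrt (y t \<bullet> y t + e\<^sup>2) - \<eta> t" for t
    have pos: "0 < y t \<bullet> y t + e\<^sup>2" for t
      using \<open>0 < e\<close> by (intro add_nonneg_pos) auto
    have "\<psi> b \<le> \<psi> a"
    proof (rule DERIV_nonpos_imp_decreasing_open[OF \<open>a \<le> b\<close>])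
      fix t assume t: "a < t" "t < b"
      have "((\<lambda>t. y t \<bullet> y t) has_real_derivative (y t \<bullet> y' t + y' t \<bullet> y t)) (at t)"
        unfolding has_real_derivative_iff_has_vector_derivative
        by (rule bounded_bilinear.has_vector_derivative[OF bounded_bilinear_inner y'[OF t] y'[OF t]])
      then have "(\<psi> has_real_derivative
          (y t \<bullet> y' t + y' t \<bullet> y t) * (inverse (sqrt (y t \<bullet> y t + e\<^sup>2)) / 2) - h t) (at t)"
        unfolding \<psi>_def using pos[of t] \<eta>'[OF t]
        by (auto intro!: derivative_eq_intros)
      moreover have "(y t \<bullet> y' t + y' t \<bullet> y t) * (inverse (sqrt (y t \<bullet> y t + e\<^sup>2)) / 2) - h t \<le> 0"
      proof -
        have "(y t \<bullet> y' t + y' t \<bullet> y t) * (inverse (sqrt (y t \<bullet> y t + e\<^sup>2)) / 2)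
            = (y' t \<bullet> y t) / sqrt (y t \<bullet> y t + e\<^sup>2)"
          by (simp add: inner_commute field_simps)
        also have "\<dots> \<le> h t * norm (y t) / sqrt (y t \<bullet> y t + e\<^sup>2)"
          using h(1)[OF t] pos[of t] by (intro divide_right_mono) auto
        also have "\<dots> \<le> h t"
        proof -
          have "norm (y t) \<le> sqrt (y t \<bullet> y t + e\<^sup>2)"
            by (simp add: norm_eq_sqrt_inner)
          then have "h t * norm (y t) \<le> h t * sqrt (y t \<bullet> y t + e\<^sup>2)"
            using h(2)[OF t] by (intro mult_left_mono)
          then show ?thesis using pos[of t] by (simp add: divide_le_eq)
        qed
        finally show ?thesis by simp
      qed
      ultimately show "\<exists>D. (\<psi> has_real_derivative D) (at t) \<and> D \<le> 0" by blast
    next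
      show "continuous_on {a..b} \<psi>"
        unfolding \<psi>_def by (intro continuous_intros assms)
    qed
    moreover have "norm (y b) \<le> sqrt (y b \<bullet> y b + e\<^sup>2)"
      by (simp add: norm_eq_sqrt_inner)
    moreover have "sqrt (y a \<bullet> y a + e\<^sup>2) \<le> norm (y a) + e"
      using sqrt_add_le_add_sqrt[of "y a \<bullet> y a" "e\<^sup>2"] \<open>0 < e\<close>
      by (simp add: norm_eq_sqrt_inner)
    ultimately show "norm (y b) \<le> norm (y a) + \<eta> b - \<eta> a + e"
      by (simp add: \<psi>_def)
  qed
qed simp

text \<open>Integration gains the factor \<open>1 / \<kappa>\<close> in the weighted norm; this is
  the source of every contraction below.\<close>

lemma norm_integral_le_exp:
  fixes f :: "real \<Rightarrow> 'a::banach"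
  assumes "continuous_on {0..t} f" "0 < \<kappa>" "0 \<le> t"
    and "\<And>s. s \<in> {0..t} \<Longrightarrow> norm (f s) \<le> D * exp (\<kappa> * s)"
  shows "norm (integral {0..t} f) \<le> D / \<kappa> * (exp (\<kappa> * t) - 1)"
proof -
  have int: "((\<lambda>s. D * exp (\<kappa> * s)) has_integral (D / \<kappa> * exp (\<kappa> * t) - D / \<kappa> * exp (\<kappa> * 0))) {0..t}"
    using \<open>0 < \<kappa>\<close> \<open>0 \<le> t\<close>
    by (intro fundamental_theorem_of_calculus)
       (auto intro!: derivative_eq_intros simp: has_real_derivative_iff_has_vector_derivative[symmetric])
  have "norm (integral {0..t} f) \<le> integral {0..t} (\<lambda>s. D * exp (\<kappa> * s))"
    by (rule integral_norm_bound_integral[OF integrable_continuous_real[OF assms(1)]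
          has_integral_integrable[OF int] assms(4)])
  also have "\<dots> = D / \<kappa> * (exp (\<kappa> * t) - 1)"
    using integral_unique[OF int] by (simp add: algebra_simps)
  finally show ?thesis .
qed

lemma linear_ode_solution:
  fixes B :: "'a::banach \<Rightarrow> 'a"
  assumes "bounded_linear B" "continuous_on {0..T} g"
  obtains y where "continuous_on {0..T} y" "y 0 = y0"
    "\<And>t. 0 < t \<Longrightarrow> t < T \<Longrightarrow> (y has_vector_derivative B (y t) + g t) (at t)"
proof -
  interpret B: bounded_linear B by fact
  obtain K where K: "0 < K" "\<And>x. norm (B x) \<le> norm x * K"
    using B.pos_bounded by blast
  \<comment> \<open>Twice the operator bound, so that the gain \<open>K / \<kappa>\<close> is
    exactly the required one half.\<close>
  define \<kappa> where "\<kappa> = 2 * K"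
  have \<kappa>: "0 < \<kappa>" "K / \<kappa> = 1/2" using K(1) by (simp_all add: \<kappa>_def)
  define S where "S = {z :: real \<Rightarrow> 'a. continuous_on {0..T} z}"
  define L where "L z t = y0 + integral {0..t} (\<lambda>s. B (z s) + g s)" for z t
  have Bc: "continuous_on {0..t} (\<lambda>s. B (z s))" if "z \<in> S" "t \<in> {0..T}" for z t
    by (rule B.continuous_on, rule continuous_on_subset[of "{0..T}" z]) (use that in \<open>auto simp: S_def\<close>)
  have gc: "continuous_on {0..t} g" if "t \<in> {0..T}" for t
    using that assms(2) by (auto intro: continuous_on_subset)
  have int: "(\<lambda>s. B (z s) + g s) integrable_on {0..t}" if "z \<in> S" "t \<in> {0..T}" for z t
    by (intro integrable_continuous_real continuous_intros Bc gc that)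
  have Lcont: "continuous_on {0..T} (L z)" if "z \<in> S" for z
  proof (cases "0 \<le> T")
    case True
    then show ?thesis
      unfolding L_def by (intro continuous_intros indefinite_integral_continuous_1 int that) auto
  qed auto
  obtain y where y: "y \<in> S" "\<And>t. t \<in> {0..T} \<Longrightarrow> L y t = y t"
  proof (rule weighted_contraction_fixpoint[of \<kappa> S T L "\<lambda>_. 0"])
    show "(\<lambda>_. 0) \<in> S" by (simp add: S_def)
    show "continuous_on {0..T} z" if "z \<in> S" for z using that by (simp add: S_def)
    show "L z \<in> S" if "z \<in> S" for z using Lcont[OF that] by (simp add: S_def)
    show "z \<in> S" if "\<And>j. f j \<in> S" "uniform_limit {0..T} f z sequentially" for f z
      using that uniform_limit_theorem[OF _ that(2)] by (auto simp: S_def)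
    show "norm (L z1 t - L z2 t) \<le> D / 2 * exp (\<kappa> * t)"
      if "z1 \<in> S" "z2 \<in> S" "0 \<le> D" and t: "t \<in> {0..T}"
        and le: "\<And>t. t \<in> {0..T} \<Longrightarrow> norm (z1 t - z2 t) \<le> D * exp (\<kappa> * t)" for z1 z2 D t
    proof -
      have "L z1 t - L z2 t = integral {0..t} (\<lambda>s. (B (z1 s) + g s) - (B (z2 s) + g s))"
        unfolding L_def using integral_diff[OF int[OF that(1) t] int[OF that(2) t]] by simp
      also have "\<dots> = integral {0..t} (\<lambda>s. B (z1 s - z2 s))"
        by (simp add: B.diff)
      finally have "norm (L z1 t - L z2 t) = norm (integral {0..t} (\<lambda>s. B (z1 s - z2 s)))" by simp
      also have "\<dots> \<le> (D * K) / \<kappa> * (exp (\<kappa> * t) - 1)"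
      proof (rule norm_integral_le_exp)
        show "continuous_on {0..t} (\<lambda>s. B (z1 s - z2 s))"
          unfolding B.diff by (intro continuous_intros Bc that)
        fix s assume "s \<in> {0..t}"
        then have "norm (z1 s - z2 s) \<le> D * exp (\<kappa> * s)" using t by (intro le) auto
        then have "norm (z1 s - z2 s) * K \<le> D * exp (\<kappa> * s) * K"
          using K(1) by (intro mult_right_mono) auto
        then show "norm (B (z1 s - z2 s)) \<le> D * K * exp (\<kappa> * s)"
          using K(2)[of "z1 s - z2 s"] by (simp add: mult_ac)
      qed (use \<kappa> t in auto)
      also have "\<dots> = D / 2 * (exp (\<kappa> * t) - 1)" using \<kappa> K(1) by (simp add: \<kappa>_def)
      also have "\<dots> \<le> D / 2 * exp (\<kappa> * t)" using \<open>0 \<le> D\<close> by (intro mult_left_mono) auto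
      finally show ?thesis .
    qed
  qed (use \<kappa> in auto)
  \<comment> \<open>The solution returned is \<open>L y\<close>, which agrees with \<open>y\<close>
    only on \<open>{0..T}\<close>: it has the right value at 0 even if that interval is
    empty.\<close>
  show ?thesis
  proof
    show "continuous_on {0..T} (L y)" by (rule Lcont[OF y(1)])
    show "L y 0 = y0" by (simp add: L_def)
    fix t assume t: "0 < t" "t < T"
    have "continuous_on {0..T} (\<lambda>s. B (y s) + g s)"
      using t by (intro continuous_intros Bc gc y(1)) auto
    then have "(L y has_vector_derivative (0 + (B (y t) + g t))) (at t within {0..T})"
      unfolding L_def using t
      by (intro has_vector_derivative_add has_vector_derivative_const integral_has_vector_derivative) auto
    then show "(L y has_vector_derivative B (L y t) + g t) (at t)"
      using t y(2)[of t] by (simp add: at_within_interior[of t "{0..T}"])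
  qed
qed

text \<open>Contractions are equicontinuous, so pointwise convergence on a finite
  \<open>e/3\<close>-net of the compact image of \<open>g\<close> controls the whole image.\<close>

lemma uniform_limit_contractions:
  fixes P :: "nat \<Rightarrow> 'a::real_normed_vector \<Rightarrow> 'a" and g :: "real \<Rightarrow> 'a"
  assumes lin: "\<And>n. bounded_linear (P n)" and le: "\<And>n x. norm (P n x) \<le> norm x"
    and lim: "\<And>x. (\<lambda>n. P n x) \<longlonglongrightarrow> x"
    and g: "continuous_on S g" "compact S"
  shows "uniform_limit S (\<lambda>n t. P n (g t)) g sequentially"
proof (rule uniform_limitI)
  fix e :: real assume "0 < e"
  then have e3: "0 < e / 3" by simp
  have "compact (g ` S)" using g by (rule compact_continuous_image)
  then obtain k where k: "finite k" "g ` S \<subseteq> (\<Union>x\<in>k. ball x (e/3))"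
    using e3 unfolding compact_eq_totally_bounded by meson
  have "\<forall>x\<in>k. \<forall>\<^sub>F n in sequentially. dist (P n x) x < e/3"
    using tendstoD[OF lim e3] by blast
  then have "\<forall>\<^sub>F n in sequentially. \<forall>x\<in>k. dist (P n x) x < e/3"
    using k(1) by (simp add: eventually_ball_finite)
  then show "\<forall>\<^sub>F n in sequentially. \<forall>t\<in>S. dist (P n (g t)) (g t) < e"
  proof eventually_elim
    case (elim n)
    show ?case
    proof
      fix t assume "t \<in> S"
      then obtain x where x: "x \<in> k" "dist x (g t) < e/3" using k(2) by auto
      have "dist (P n (g t)) (P n x) = norm (P n (g t - x))"
        by (simp add: dist_norm linear_diff bounded_linear.linear[OF lin])
      also have "\<dots> \<le> dist x (g t)" using le by (metis dist_commute dist_norm)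
      finally show "dist (P n (g t)) (g t) < e"
        using elim x dist_triangle[of "P n (g t)" "g t" "P n x"] dist_triangle[of "P n x" "g t" x]
        by fastforce
    qed
  qed
qed

section \<open>Dissipative evolution equations\<close>

text \<open>\<open>A n\<close> stands for an unbounded operator restricted to the first
  \<open>n\<close> modes. The compatibility laws say that truncation commutes with the operator, so
  the full operator and its domain never have to be named.\<close>

locale dissipative_approximation =
  fixes P A :: "nat \<Rightarrow> 'a::{real_inner,banach} \<Rightarrow> 'a"
  assumes P: "bounded_linear (P n)" and A: "bounded_linear (A n)"
    and norm_P_le: "norm (P n x) \<le> norm x"
    and P_tendsto: "(\<lambda>n. P n x) \<longlonglongrightarrow> x"
    and P_P: "m \<le> n \<Longrightarrow> P m (P n x) = P m x"
    and P_A: "m \<le> n \<Longrightarrow> P m (A n x) = A m x"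
    and A_P: "m \<le> n \<Longrightarrow> A n (P m x) = A m x"
    and dissipative: "A n x \<bullet> x \<le> 0"
begin

lemma P_add: "P n (x + y) = P n x + P n y"
  and P_diff: "P n (x - y) = P n x - P n y"
  and A_diff: "A n (x - y) = A n x - A n y"
  and P_zero: "P n 0 = 0" and A_zero: "A n 0 = 0"
  by (simp_all add: linear_add linear_diff linear_0 bounded_linear.linear P A)

lemma P_eqI: "(\<And>n. P n x = P n y) \<Longrightarrow> x = y"
  using LIMSEQ_unique[OF P_tendsto[of x]] P_tendsto[of y] by simp

text \<open>The equation is required only after projection. Each \<open>A n\<close> is bounded, so
  this makes sense for \<open>z\<close> with values outside the domain of the full operator.\<close>

definition weak_solution :: "real \<Rightarrow> (real \<Rightarrow> 'a) \<Rightarrow> (real \<Rightarrow> 'a) \<Rightarrow> bool" where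
  "weak_solution T g z \<longleftrightarrow> continuous_on {0..T} z \<and>
     (\<forall>n t. 0 < t \<longrightarrow> t < T \<longrightarrow>
        ((\<lambda>s. P n (z s)) has_vector_derivative A n (z t) + P n (g t)) (at t))"

lemma weak_solution_zero: "weak_solution T (\<lambda>_. 0) (\<lambda>_. 0)"
  by (auto simp: weak_solution_def P_zero A_zero)

text \<open>The energy estimate holds for every projected difference with a bound independent of
  \<open>n\<close>, because dissipativity removes the contribution of \<open>A n\<close>; then
  \<open>n\<close> tends to infinity.\<close>

lemma weak_solution_diff_le:
  assumes z: "weak_solution T g1 z1" "weak_solution T g2 z2" and t: "0 \<le> t" "t \<le> T"
    and \<eta>: "continuous_on {0..t} \<eta>"
      "\<And>s. 0 < s \<Longrightarrow> s < t \<Longrightarrow> (\<eta> has_real_derivative h s) (at s)"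
      "\<And>s. 0 < s \<Longrightarrow> s < t \<Longrightarrow> norm (g1 s - g2 s) \<le> h s"
  shows "norm (z1 t - z2 t) \<le> norm (z1 0 - z2 0) + \<eta> t - \<eta> 0"
proof (rule LIMSEQ_le_const2)
  show "(\<lambda>n. norm (P n (z1 t - z2 t))) \<longlonglongrightarrow> norm (z1 t - z2 t)"
    by (intro tendsto_intros P_tendsto)
  have "norm (P n (z1 t - z2 t)) \<le> norm (z1 0 - z2 0) + \<eta> t - \<eta> 0" for n
  proof -
    let ?y = "\<lambda>s. P n (z1 s - z2 s)"
    have "norm (?y t) \<le> norm (?y 0) + \<eta> t - \<eta> 0"
    proof (rule norm_le_of_inner_derivative_le[OF t(1) _ \<eta>(1)])
      have "continuous_on {0..t} (\<lambda>s. z1 s - z2 s)"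
        using z t unfolding weak_solution_def
        by (intro continuous_on_diff) (auto intro: continuous_on_subset)
      then show "continuous_on {0..t} ?y"
        by (rule bounded_linear.continuous_on[OF P])
      fix s assume s: "0 < s" "s < t"
      show "(?y has_vector_derivative
          A n (z1 s - z2 s) + P n (g1 s - g2 s)) (at s)"
      proof -
        have "((\<lambda>s. P n (z1 s)) has_vector_derivative A n (z1 s) + P n (g1 s)) (at s)"
          "((\<lambda>s. P n (z2 s)) has_vector_derivative A n (z2 s) + P n (g2 s)) (at s)"
          using z s t unfolding weak_solution_def by auto
        from has_vector_derivative_diff[OF this] show ?thesis
          by (simp add: P_diff A_diff algebra_simps)
      qed
      show "0 \<le> h s" using \<eta>(3)[OF s] norm_ge_zero[of "g1 s - g2 s"] by linarith
      \<comment> \<open>Dissipativity pairs \<open>A n\<close> with its own argument, so the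
        argument is first replaced by its projection.\<close>
      have "A n (z1 s - z2 s) \<bullet> ?y s = A n (?y s) \<bullet> ?y s"
        by (simp add: A_P)
      also have "\<dots> \<le> 0" by (rule dissipative)
      finally have "(A n (z1 s - z2 s) + P n (g1 s - g2 s)) \<bullet> ?y s \<le> P n (g1 s - g2 s) \<bullet> ?y s"
        by (simp add: inner_add_left)
      also have "\<dots> \<le> norm (P n (g1 s - g2 s)) * norm (?y s)"
        by (rule norm_cauchy_schwarz)
      also have "\<dots> \<le> h s * norm (?y s)"
        using norm_P_le[of n "g1 s - g2 s"] \<eta>(3)[OF s] by (intro mult_right_mono) auto
      finally show "(A n (z1 s - z2 s) + P n (g1 s - g2 s)) \<bullet> ?y s \<le> h s * norm (?y s)" .
    qed (use \<eta>(2) in auto)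
    then show ?thesis
      using norm_P_le[of n "z1 0 - z2 0"] by linarith
  qed
  then show "\<exists>N. \<forall>n\<ge>N. norm (P n (z1 t - z2 t)) \<le> norm (z1 0 - z2 0) + \<eta> t - \<eta> 0"
    by blast
qed

lemma weak_solution_diff_le_exp:
  assumes z: "weak_solution T g1 z1" "weak_solution T g2 z2" "z1 0 = z2 0"
    and t: "t \<in> {0..T}" and "0 < \<kappa>"
    and le: "\<And>s. s \<in> {0..T} \<Longrightarrow> norm (g1 s - g2 s) \<le> D * exp (\<kappa> * s)"
  shows "norm (z1 t - z2 t) \<le> D / \<kappa> * (exp (\<kappa> * t) - 1)"
proof -
  have "norm (z1 t - z2 t) \<le> norm (z1 0 - z2 0) + D / \<kappa> * exp (\<kappa> * t) - D / \<kappa> * exp (\<kappa> * 0)"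
  proof (rule weak_solution_diff_le[OF z(1,2)])
    fix s assume "0 < s" "s < t"
    then show "norm (g1 s - g2 s) \<le> D * exp (\<kappa> * s)" using le t by auto
    show "((\<lambda>s. D / \<kappa> * exp (\<kappa> * s)) has_real_derivative D * exp (\<kappa> * s)) (at s)"
      using \<open>0 < \<kappa>\<close> by (auto intro!: derivative_eq_intros)
  qed (use t \<open>0 < \<kappa>\<close> in \<open>auto intro!: continuous_intros\<close>)
  also have "\<dots> = D / \<kappa> * (exp (\<kappa> * t) - 1)"
    by (simp add: z(3) algebra_simps)
  finally show ?thesis .
qed

text \<open>Galerkin's method. Finer approximations project onto coarser ones, and the difference of
  two is driven only by the modes of \<open>z0\<close> and \<open>g\<close> that lie between them;
  these are uniformly small, as \<open>g\<close> has compact image.\<close>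

lemma weak_solution_exists:
  assumes "0 \<le> T" and g: "continuous_on {0..T} g"
  obtains z where "weak_solution T g z" "z 0 = z0"
proof -
  have "\<exists>y. continuous_on {0..T} y \<and> y 0 = P n z0 \<and>
    (\<forall>t. 0 < t \<longrightarrow> t < T \<longrightarrow> (y has_vector_derivative A n (y t) + P n (g t)) (at t))" for n
    by (rule linear_ode_solution[OF A bounded_linear.continuous_on[OF P g], where ?y0.0 = "P n z0"]) blast
  then obtain y where y: "\<And>n. continuous_on {0..T} (y n)" "\<And>n. y n 0 = P n z0"
    "\<And>n t. 0 < t \<Longrightarrow> t < T \<Longrightarrow> (y n has_vector_derivative A n (y n t) + P n (g t)) (at t)"
    by metis
  \<comment> \<open>Both sides solve the same linear equation at level \<open>m\<close> with the
    same start, and dissipativity makes that solution unique.\<close>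
  have P_y: "P m (y n t) = y m t" if "m \<le> n" and t: "t \<in> {0..T}" for m n t
  proof -
    let ?d = "\<lambda>t. P m (y n t) - y m t"
    have Py': "((\<lambda>t. P m (y n t)) has_vector_derivative P m (A n (y n s) + P n (g s))) (at s)"
      if "0 < s" "s < T" for s
      by (rule bounded_linear.has_vector_derivative[OF P y(3)[OF that]])
    have "norm (?d t) \<le> norm (?d 0) + 0 - (0::real)"
    proof (rule norm_le_of_inner_derivative_le[where h = "\<lambda>_. 0" and \<eta> = "\<lambda>_. 0"])
      show "continuous_on {0..t} ?d"
        using t by (intro continuous_on_diff bounded_linear.continuous_on[OF P]
            continuous_on_subset[OF y(1)]) auto
      fix s assume s: "0 < s" "s < t"
      show "(?d has_vector_derivative
          P m (A n (y n s) + P n (g s)) - (A m (y m s) + P m (g s))) (at s)"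
        using s t by (intro has_vector_derivative_diff Py' y(3)) auto
      have "P m (A n (y n s) + P n (g s)) - (A m (y m s) + P m (g s)) = A m (?d s)"
        using \<open>m \<le> n\<close> by (simp add: P_add P_P P_A A_diff A_P)
      then show "(P m (A n (y n s) + P n (g s)) - (A m (y m s) + P m (g s))) \<bullet> ?d s \<le> 0 * norm (?d s)"
        using dissipative by simp
    qed (use t in auto)
    then show ?thesis using \<open>m \<le> n\<close> by (simp add: y(2) P_P)
  qed
  have diff: "norm (y n t - y m t) \<le> norm (P n z0 - P m z0) + e * T"
    if "m \<le> n" and t: "t \<in> {0..T}" and e: "\<And>s. s \<in> {0..T} \<Longrightarrow> norm (P n (g s) - P m (g s)) \<le> e"
    for m n t e
  proof -
    let ?d = "\<lambda>t. y n t - y m t"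
    have "0 \<le> e" using e[OF t] norm_ge_zero order_trans by blast
    have "norm (?d t) \<le> norm (?d 0) + e * t - e * 0"
    proof (rule norm_le_of_inner_derivative_le[where h = "\<lambda>_. e" and \<eta> = "\<lambda>s. e * s"])
      show "continuous_on {0..t} ?d"
        using t by (intro continuous_on_diff continuous_on_subset[OF y(1)]) auto
      fix s assume s: "0 < s" "s < t"
      show "(?d has_vector_derivative
          A n (y n s) + P n (g s) - (A m (y m s) + P m (g s))) (at s)"
        using s t by (intro has_vector_derivative_diff y(3)) auto
      \<comment> \<open>Since \<open>y m\<close> is fixed by \<open>P m\<close>, the coarse solution
        also evolves under the finer operator, and dissipativity of \<open>A n\<close> alone handles
        the difference.\<close>
      have "A m (y m s) = A n (P m (y m s))"
        using \<open>m \<le> n\<close> by (simp add: A_P)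
      also have "P m (y m s) = y m s" using P_y[of m m s] s t by simp
      finally have eq: "A n (y n s) + P n (g s) - (A m (y m s) + P m (g s))
          = A n (?d s) + (P n (g s) - P m (g s))"
        by (simp add: A_diff)
      have "(A n (y n s) + P n (g s) - (A m (y m s) + P m (g s))) \<bullet> ?d s
          \<le> (P n (g s) - P m (g s)) \<bullet> ?d s"
        unfolding eq inner_add_left using dissipative[of n "?d s"] by simp
      also have "\<dots> \<le> norm (P n (g s) - P m (g s)) * norm (?d s)"
        by (rule norm_cauchy_schwarz)
      also have "\<dots> \<le> e * norm (?d s)"
        using e s t by (intro mult_right_mono) auto
      finally show "(A n (y n s) + P n (g s) - (A m (y m s) + P m (g s))) \<bullet> ?d s \<le> e * norm (?d s)" .
      show "((\<lambda>s. e * s) has_real_derivative e) (at s)"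
        by (auto intro!: derivative_eq_intros)
    qed (use t \<open>0 \<le> e\<close> in \<open>auto intro!: continuous_intros\<close>)
    moreover have "e * t \<le> e * T" using t \<open>0 \<le> e\<close> by (intro mult_left_mono) auto
    ultimately show ?thesis by (simp add: y(2))
  qed
  have "uniform_limit {0..T} (\<lambda>n t. P n (g t)) g sequentially"
    by (rule uniform_limit_contractions[OF P norm_P_le P_tendsto g]) simp
  then have "uniformly_Cauchy_on {0..T} (\<lambda>n t. P n (g t))"
    using uniformly_convergentI uniformly_convergent_eq_Cauchy by blast
  have "Cauchy (\<lambda>n. P n z0)"
    using P_tendsto by (rule LIMSEQ_imp_Cauchy)
  have "uniformly_Cauchy_on {0..T} y"
  proof (rule uniformly_Cauchy_onI')
    fix e :: real assume "0 < e"
    \<comment> \<open>Half of \<open>e\<close> is reserved for the initial values;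
      \<open>T + 1\<close> keeps the divisor positive for \<open>T = 0\<close>.\<close>
    define e' where "e' = e / (2 * (T + 1))"
    have "0 < e'" using \<open>0 < e\<close> \<open>0 \<le> T\<close> by (simp add: e'_def)
    obtain M1 where M1: "\<And>m n s. m \<ge> M1 \<Longrightarrow> n \<ge> M1 \<Longrightarrow> s \<in> {0..T} \<Longrightarrow> dist (P m (g s)) (P n (g s)) < e'"
      using \<open>uniformly_Cauchy_on {0..T} (\<lambda>n t. P n (g t))\<close> \<open>0 < e'\<close>
      unfolding uniformly_Cauchy_on_def by meson
    obtain M2 where M2: "\<And>m n. m \<ge> M2 \<Longrightarrow> n \<ge> M2 \<Longrightarrow> dist (P m z0) (P n z0) < e / 2"
      using \<open>Cauchy (\<lambda>n. P n z0)\<close> \<open>0 < e\<close> unfolding Cauchy_def by (meson half_gt_zero)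
    have "dist (y m t) (y n t) < e" if "t \<in> {0..T}" "m \<ge> max M1 M2" "n > m" for t m n
    proof -
      have "norm (y n t - y m t) \<le> norm (P n z0 - P m z0) + e' * T"
        using that M1[of n m] by (intro diff) (auto simp: dist_norm intro: less_imp_le)
      also have "norm (P n z0 - P m z0) < e / 2"
        using M2[of n m] that by (simp add: dist_norm)
      also have "e' * T \<le> e' * (T + 1)" using \<open>0 < e'\<close> by simp
      also have "e' * (T + 1) = e / 2" using \<open>0 \<le> T\<close> by (simp add: e'_def field_simps)
      finally show ?thesis by (simp add: dist_norm norm_minus_commute)
    qed
    then show "\<exists>M. \<forall>x\<in>{0..T}. \<forall>m\<ge>M. \<forall>n>m. dist (y m x) (y n x) < e" by blast
  qed
  then have "uniformly_convergent_on {0..T} y" by (rule Cauchy_uniformly_convergent)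
  then obtain z where z: "uniform_limit {0..T} y z sequentially"
    unfolding uniformly_convergent_on_def by blast
  have P_z: "P m (z t) = y m t" if t: "t \<in> {0..T}" for m t
  proof -
    have "(\<lambda>n. P m (y n t)) \<longlonglongrightarrow> P m (z t)"
      by (rule bounded_linear.tendsto[OF P tendsto_uniform_limitI[OF z t]])
    moreover have "\<forall>\<^sub>F n in sequentially. P m (y n t) = y m t"
      using eventually_ge_at_top[of m] by eventually_elim (rule P_y[OF _ t])
    then have "(\<lambda>n. P m (y n t)) \<longlonglongrightarrow> y m t"
      by (rule tendsto_eventually)
    ultimately show ?thesis by (rule LIMSEQ_unique)
  qed
  show ?thesis
  proof
    show "z 0 = z0"
      by (rule P_eqI) (use P_z[of 0] \<open>0 \<le> T\<close> y(2) in auto)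
    show "weak_solution T g z"
      unfolding weak_solution_def
    proof (intro conjI allI impI)
      show "continuous_on {0..T} z"
        using uniform_limit_theorem[OF _ z] y(1) by simp
      fix n t assume t: "0 < t" "t < T"
      have "(y n has_vector_derivative A n (z t) + P n (g t)) (at t)"
        using y(3)[OF t, of n] P_z[of t n] t A_P[of n n "z t"] by simp
      then show "((\<lambda>s. P n (z s)) has_vector_derivative A n (z t) + P n (g t)) (at t)"
        by (rule has_vector_derivative_transform_within_open[of _ _ _ "{0<..<T}"])
           (use t P_z in auto)
    qed
  qed
qed

end

section \<open>Semilinear equations\<close>

definition radial_cutoff :: "real \<Rightarrow> 'a::real_normed_vector \<Rightarrow> 'a" where
  "radial_cutoff R x = (if norm x \<le> R then x else (R / norm x) *\<^sub>R x)"

lemma norm_radial_cutoff_le: "0 \<le> R \<Longrightarrow> norm (radial_cutoff R x) \<le> R"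
  by (auto simp: radial_cutoff_def)

text \<open>Outside the ball the difference splits into a change of direction and a change of
  radius. Each costs at most \<open>norm (x - y)\<close>, whence the constant 2 in an arbitrary
  normed space.\<close>

lemma radial_cutoff_diff_le:
  assumes "0 \<le> R"
  shows "norm (radial_cutoff R x - radial_cutoff R y) \<le> 2 * norm (x - y)"
proof -
  have far: "norm (x - (R / norm y) *\<^sub>R y) \<le> 2 * norm (x - y)"
    if "norm x \<le> R" "R < norm y" for x y :: 'a
  proof -
    have y: "y \<noteq> 0" using that assms by auto
    have "x - (R / norm y) *\<^sub>R y = (x - y) + (1 - R / norm y) *\<^sub>R y"
      by (simp add: algebra_simps)
    then have "norm (x - (R / norm y) *\<^sub>R y) \<le> norm (x - y) + norm ((1 - R / norm y) *\<^sub>R y)"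
      by (metis norm_triangle_ineq)
    also have "norm ((1 - R / norm y) *\<^sub>R y) = norm y - R"
      using that y by (simp add: field_simps)
    also have "norm y - R \<le> norm (x - y)"
      using that norm_triangle_ineq2[of y x] by (simp add: norm_minus_commute)
    finally show ?thesis by simp
  qed
  have far2: "norm ((R / norm x) *\<^sub>R x - (R / norm y) *\<^sub>R y) \<le> 2 * norm (x - y)"
    if "R < norm x" "R < norm y" for x y :: 'a
  proof -
    have pos: "0 < norm x" "0 < norm y" using that assms by linarith+
    have "(R / norm x) *\<^sub>R x - (R / norm y) *\<^sub>R y
        = (R / norm x) *\<^sub>R (x - y) + (R / norm x - R / norm y) *\<^sub>R y"
      by (simp add: algebra_simps)
    then have "norm ((R / norm x) *\<^sub>R x - (R / norm y) *\<^sub>R y)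
        \<le> norm ((R / norm x) *\<^sub>R (x - y)) + norm ((R / norm x - R / norm y) *\<^sub>R y)"
      by (metis norm_triangle_ineq)
    also have "norm ((R / norm x) *\<^sub>R (x - y)) = (R / norm x) * norm (x - y)"
      using assms by simp
    also have "R / norm x - R / norm y = (R / norm x) * ((norm y - norm x) / norm y)"
      using pos by (simp add: field_simps)
    also have "norm ((R / norm x * ((norm y - norm x) / norm y)) *\<^sub>R y)
        = (R / norm x) * \<bar>norm y - norm x\<bar>"
      using pos assms by (simp add: abs_mult)
    also have "(R / norm x) * norm (x - y) + (R / norm x) * \<bar>norm y - norm x\<bar>
        \<le> 1 * norm (x - y) + 1 * norm (x - y)"
      using that pos assms norm_triangle_ineq3[of y x]
      by (intro add_mono mult_mono) (auto simp: norm_minus_commute)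
    finally show ?thesis by simp
  qed
  show ?thesis
    using far[of x y] far[of y x] far2[of x y] norm_ge_zero[of "x - y"]
    unfolding radial_cutoff_def
    by (smt (verit) norm_minus_commute)
qed

text \<open>The bounds on the derivative \<open>Q\<close> are those of a homogeneous cubic map:
  \<open>Q\<close> is quadratic in its base point and linear in the direction.\<close>

locale semilinear = dissipative_approximation P A
  for P A :: "nat \<Rightarrow> 'a::{real_inner,banach} \<Rightarrow> 'a" +
  fixes F :: "'a \<Rightarrow> 'a" and Q :: "'a \<Rightarrow> 'a \<Rightarrow> 'a" and C :: real
  assumes C: "0 \<le> C"
    and F': "(F has_derivative Q x) (at x)"
    and Q_le: "norm (Q x y) \<le> C * (norm x)\<^sup>2 * norm y"
    and Q_diff_le: "norm (Q x y - Q x' y) \<le> C * (norm x + norm x') * norm (x - x') * norm y"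
begin

lemma Q_diff: "Q x (y - y') = Q x y - Q x y'"
  using has_derivative_bounded_linear[OF F', of x] by (simp add: linear_diff bounded_linear.linear)

lemma F_diff_le:
  assumes "norm x \<le> R" "norm y \<le> R"
  shows "norm (F x - F y) \<le> C * R\<^sup>2 * norm (x - y)"
proof (rule differentiable_bound[of "cball 0 R" F Q])
  fix z :: 'a assume z: "z \<in> cball 0 R"
  show "(F has_derivative Q z) (at z within cball 0 R)"
    using F' by (rule has_derivative_at_withinI)
  show "onorm (Q z) \<le> C * R\<^sup>2"
  proof (rule onorm_bound)
    show "0 \<le> C * R\<^sup>2" using C by simp
    fix w :: 'a
    have "C * (norm z)\<^sup>2 * norm w \<le> C * R\<^sup>2 * norm w"
      using z C by (intro mult_right_mono mult_left_mono power_mono) auto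
    with Q_le[of z w] show "norm (Q z w) \<le> C * R\<^sup>2 * norm w" by linarith
  qed
qed (use assms in auto)

lemma continuous_on_Q:
  assumes "continuous_on S p" "continuous_on S z"
  shows "continuous_on S (\<lambda>t. Q (p t) (z t))"
  unfolding continuous_on_def
proof
  fix t assume t: "t \<in> S"
  have p: "(p \<longlongrightarrow> p t) (at t within S)" and z: "(z \<longlongrightarrow> z t) (at t within S)"
    using assms t by (auto simp: continuous_on_def)
  let ?B = "\<lambda>s. C * (norm (p s) + norm (p t)) * norm (p s - p t) * norm (z s)
      + C * (norm (p t))\<^sup>2 * norm (z s - z t)"
  have "norm (Q (p s) (z s) - Q (p t) (z t)) \<le> ?B s" for s
  proof -
    have "Q (p s) (z s) - Q (p t) (z t)
        = (Q (p s) (z s) - Q (p t) (z s)) + Q (p t) (z s - z t)"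
      by (simp add: Q_diff)
    then have "norm (Q (p s) (z s) - Q (p t) (z t))
        \<le> norm (Q (p s) (z s) - Q (p t) (z s)) + norm (Q (p t) (z s - z t))"
      by (metis norm_triangle_ineq)
    then show ?thesis
      using Q_diff_le[of "p s" "z s" "p t"] Q_le[of "p t" "z s - z t"] by linarith
  qed
  moreover have "(?B \<longlongrightarrow> C * (norm (p t) + norm (p t)) * norm (p t - p t) * norm (z t)
      + C * (norm (p t))\<^sup>2 * norm (z t - z t)) (at t within S)"
    by (intro tendsto_intros p z)
  then have "(?B \<longlongrightarrow> 0) (at t within S)" by simp
  ultimately have "((\<lambda>s. Q (p s) (z s) - Q (p t) (z t)) \<longlongrightarrow> 0) (at t within S)"
    using Lim_null_comparison[of "\<lambda>s. Q (p s) (z s) - Q (p t) (z t)" ?B] always_eventually by blast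
  then show "((\<lambda>s. Q (p s) (z s)) \<longlongrightarrow> Q (p t) (z t)) (at t within S)"
    by (rule LIM_zero_cancel)
qed

text \<open>That \<open>x t\<close> lies in the domain is encoded by the existence of one vector
  \<open>z t\<close> whose projections are all given by the truncated equations.\<close>

definition strong_solution ::
  "(real \<Rightarrow> 'a) \<Rightarrow> real set \<Rightarrow> (real \<Rightarrow> 'a) \<Rightarrow> (real \<Rightarrow> 'a) \<Rightarrow> bool" where
  "strong_solution b J x z \<longleftrightarrow> continuous_on J z \<and>
     (\<forall>t\<in>J. (x has_vector_derivative z t) (at t within J) \<and>
        (\<forall>n. P n (z t) = A n (x t) + P n (b t + F (x t))))"

lemma strong_solution_subset:
  "strong_solution b J x z \<Longrightarrow> J' \<subseteq> J \<Longrightarrow> strong_solution b J' x z"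
  unfolding strong_solution_def
  by (meson continuous_on_subset has_vector_derivative_within_subset subsetD)

lemma strong_solution_continuous: "strong_solution b J x z \<Longrightarrow> continuous_on J x"
  unfolding strong_solution_def
  by (meson continuous_on_eq_continuous_within has_vector_derivative_continuous)

lemma strong_solution_imp_weak:
  assumes "strong_solution b {0..T} x z"
  shows "weak_solution T (\<lambda>t. b t + F (x t)) x"
  unfolding weak_solution_def
proof (intro conjI allI impI)
  show "continuous_on {0..T} x" using assms by (rule strong_solution_continuous)
  fix n t assume t: "0 < t" "t < T"
  then have "t \<in> {0..T}" by simp
  with assms have "(x has_vector_derivative z t) (at t within {0..T})"
    "P n (z t) = A n (x t) + P n (b t + F (x t))"
    unfolding strong_solution_def by blast+
  moreover have "at t within {0..T} = at t"
    using t by (intro at_within_interior) simp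
  ultimately have "(x has_vector_derivative z t) (at t)" "P n (z t) = A n (x t) + P n (b t + F (x t))"
    by simp_all
  then show "((\<lambda>s. P n (x s)) has_vector_derivative A n (x t) + P n (b t + F (x t))) (at t)"
    using bounded_linear.has_vector_derivative[OF P] by metis
qed

text \<open>Both solutions stay in some ball, on which \<open>F\<close> is Lipschitz. At a maximum
  of the weighted distance the contraction estimate bounds this maximum by half of itself.\<close>

lemma weak_solution_unique:
  assumes x: "weak_solution T (\<lambda>t. b t + F (x t)) x" "weak_solution T (\<lambda>t. b t + F (y t)) y"
    and "x 0 = y 0" and t: "t \<in> {0..T}"
  shows "x t = y t"
proof -
  have cont: "continuous_on {0..T} x" "continuous_on {0..T} y"
    using x by (auto simp: weak_solution_def)
  have "bounded (x ` {0..T} \<union> y ` {0..T})"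
    using cont by (auto intro!: compact_imp_bounded compact_continuous_image)
  then obtain R where R: "\<And>s. s \<in> {0..T} \<Longrightarrow> norm (x s) \<le> R"
    "\<And>s. s \<in> {0..T} \<Longrightarrow> norm (y s) \<le> R"
    unfolding bounded_iff by blast
  define K where "K = C * R\<^sup>2"
  have K: "0 \<le> K" using C by (simp add: K_def)
  \<comment> \<open>The summand 1 keeps \<open>\<kappa>\<close> positive when
    \<open>K = 0\<close>.\<close>
  define \<kappa> where "\<kappa> = 2 * K + 1"
  have \<kappa>: "0 < \<kappa>" "K / \<kappa> \<le> 1 / 2" using K by (auto simp: \<kappa>_def field_simps)
  let ?q = "\<lambda>s. norm (x s - y s) / exp (\<kappa> * s)"
  have "continuous_on {0..T} ?q"
    by (intro continuous_intros cont) auto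
  then obtain m where m: "m \<in> {0..T}" "\<And>s. s \<in> {0..T} \<Longrightarrow> ?q s \<le> ?q m"
    using continuous_attains_sup[of "{0..T}" ?q] t by auto
  let ?D = "?q m"
  have D: "norm (x s - y s) \<le> ?D * exp (\<kappa> * s)" if "s \<in> {0..T}" for s
    using m(2)[OF that] by (simp add: pos_divide_le_eq)
  have "norm (x m - y m) \<le> (K * ?D) / \<kappa> * (exp (\<kappa> * m) - 1)"
  proof (rule weak_solution_diff_le_exp[OF x \<open>x 0 = y 0\<close> m(1) \<kappa>(1)])
    fix s assume s: "s \<in> {0..T}"
    have "norm (b s + F (x s) - (b s + F (y s))) \<le> K * norm (x s - y s)"
      using F_diff_le[of "x s" R "y s"] R s by (simp add: K_def)
    also have "\<dots> \<le> K * (?D * exp (\<kappa> * s))"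
      using D[OF s] K by (rule mult_left_mono)
    finally show "norm (b s + F (x s) - (b s + F (y s))) \<le> K * ?D * exp (\<kappa> * s)" by simp
  qed
  also have "\<dots> = (K / \<kappa>) * (?D * (exp (\<kappa> * m) - 1))" by (simp add: mult_ac)
  also have "\<dots> \<le> (1 / 2) * (?D * exp (\<kappa> * m))"
    using \<kappa> K m(1) by (intro mult_mono) (auto intro!: divide_right_mono)
  finally have "norm (x m - y m) \<le> 0" by simp
  then have "norm (x t - y t) \<le> 0" using D[OF t] by simp
  then show ?thesis by simp
qed

lemma strong_solution_unique:
  assumes "strong_solution b {0..T} x z" "strong_solution b {0..T} x' z'" "x 0 = x' 0" "t \<in> {0..T}"
  shows "x t = x' t" "z t = z' t"
proof -
  show *: "x t = x' t"
    by (rule weak_solution_unique[OF assms(1,2)[THEN strong_solution_imp_weak] assms(3,4)])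
  show "z t = z' t"
    by (rule P_eqI) (use assms * in \<open>auto simp: strong_solution_def\<close>)
qed

text \<open>\<open>a0\<close> plays the role of \<open>A x0\<close>. The cutoff acts on the base
  point of \<open>Q\<close> only, so the equation for \<open>z\<close> is linear in \<open>z\<close>
  with a bounded coefficient. The original equation is recovered only up to a time before which the
  solution has not left the ball.\<close>

lemma truncated_solution:
  assumes "0 < T" "0 \<le> R"
    and b: "continuous_on {0..T} b" "continuous_on {0..T} b'"
      "\<And>t. 0 < t \<Longrightarrow> t < T \<Longrightarrow> (b has_vector_derivative b' t) (at t)"
    and x0: "\<And>n. P n a0 = A n x0"
  obtains x z where "continuous_on {0..T} z" "x 0 = x0"
    "\<And>t. t \<in> {0..T} \<Longrightarrow> (x has_vector_derivative z t) (at t within {0..T})"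
    "\<And>\<tau> n. \<tau> \<in> {0..T} \<Longrightarrow> (\<And>s. s \<in> {0..\<tau>} \<Longrightarrow> norm (x s) \<le> R) \<Longrightarrow>
        P n (z \<tau>) = A n (x \<tau>) + P n (b \<tau> + F (x \<tau>))"
proof -
  \<comment> \<open>The value of the derivative at time 0 that the original equation forces.\<close>
  define z0 where "z0 = a0 + b 0 + F x0"
  define X where "X z t = x0 + integral {0..t} z" for z and t :: real
  define g where "g z t = b' t + Q (radial_cutoff R (X z t)) (z t)" for z t
  define L where "L z = (SOME y. weak_solution T (g z) y \<and> y 0 = z0)" for z
  obtain \<beta> where \<beta>: "\<And>t. t \<in> {0..T} \<Longrightarrow> norm (b' t) \<le> \<beta>" "0 \<le> \<beta>"
  proof -
    have "bounded (b' ` {0..T})" using b(2) by (intro compact_imp_bounded compact_continuous_image) auto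
    then obtain B where "\<And>t. t \<in> {0..T} \<Longrightarrow> norm (b' t) \<le> B" unfolding bounded_iff by blast
    moreover from this[of 0] have "0 \<le> B"
      using \<open>0 < T\<close> by (auto intro: order_trans[OF norm_ge_zero])
    ultimately show ?thesis by (rule that)
  qed
  define K where "K = C * R\<^sup>2"
  have K: "0 \<le> K" using C by (simp add: K_def)
  define Z where "Z = norm z0 + \<beta> * T"
  have Z: "0 \<le> Z" using \<beta>(2) \<open>0 < T\<close> by (simp add: Z_def)
  \<comment> \<open>The Lipschitz constant of \<open>Q\<close> in its base point contains the size
    of \<open>z\<close>, so the iteration must live in a set with an a priori bound.
    \<open>Z\<close> pays for the initial value and for \<open>b'\<close>, the exponential for
    \<open>Q\<close>.\<close>
  define S where "S = {z :: real \<Rightarrow> 'a. continuous_on {0..T} z \<and> (\<forall>t\<in>{0..T}. norm (z t) \<le> Z * exp ((K + 1) * t))}"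
  have S_cont: "continuous_on {0..T} z" if "z \<in> S" for z using that by (simp add: S_def)
  have X_cont: "continuous_on {0..T} (X z)" if "z \<in> S" for z
    unfolding X_def
    by (intro continuous_intros indefinite_integral_continuous_1 integrable_continuous_real S_cont that)
  have cutoff_cont: "continuous_on U (radial_cutoff R :: 'a \<Rightarrow> 'a)" for U
  proof -
    have "2-lipschitz_on UNIV (radial_cutoff R :: 'a \<Rightarrow> 'a)"
      using radial_cutoff_diff_le[OF \<open>0 \<le> R\<close>] by (intro lipschitz_onI) (auto simp: dist_norm)
    then have "continuous_on UNIV (radial_cutoff R :: 'a \<Rightarrow> 'a)" by (rule lipschitz_on_continuous_on)
    then show ?thesis by (rule continuous_on_subset) simp
  qed
  have g_cont: "continuous_on {0..T} (g z)" if "z \<in> S" for z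
    unfolding g_def
    by (intro continuous_on_add b continuous_on_Q S_cont that
        continuous_on_compose2[OF cutoff_cont X_cont[OF that] subset_UNIV])
  have L: "weak_solution T (g z) (L z)" "L z 0 = z0" if "z \<in> S" for z
  proof -
    have "\<exists>y. weak_solution T (g z) y \<and> y 0 = z0"
      by (rule weak_solution_exists[OF less_imp_le[OF \<open>0 < T\<close>] g_cont[OF that], where ?z0.0 = z0]) blast
    from someI_ex[OF this] show "weak_solution T (g z) (L z)" "L z 0 = z0"
      by (auto simp: L_def)
  qed
  have Q_cut: "norm (Q (radial_cutoff R x) y) \<le> K * norm y" for x y
  proof -
    have "C * (norm (radial_cutoff R x))\<^sup>2 * norm y \<le> C * R\<^sup>2 * norm y"
      using C norm_radial_cutoff_le[OF \<open>0 \<le> R\<close>]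
      by (intro mult_right_mono mult_left_mono power_mono) auto
    with Q_le[of "radial_cutoff R x" y] show ?thesis unfolding K_def by linarith
  qed
  have L_S: "L z \<in> S" if z: "z \<in> S" for z
    unfolding S_def
  proof (intro CollectI conjI ballI)
    show "continuous_on {0..T} (L z)" using L(1)[OF z] by (simp add: weak_solution_def)
    fix t assume t: "t \<in> {0..T}"
    let ?\<eta> = "\<lambda>s. \<beta> * s + Z * exp ((K + 1) * s)"
    have "norm (L z t - 0) \<le> norm (L z 0 - 0) + ?\<eta> t - ?\<eta> 0"
    proof (rule weak_solution_diff_le[OF L(1)[OF z] weak_solution_zero])
      fix s assume s: "0 < s" "s < t"
      show "(?\<eta> has_real_derivative (\<beta> + (K + 1) * (Z * exp ((K + 1) * s)))) (at s)"
        by (auto intro!: derivative_eq_intros)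
      have "norm (g z s) \<le> norm (b' s) + norm (Q (radial_cutoff R (X z s)) (z s))"
        unfolding g_def by (rule norm_triangle_ineq)
      also have "\<dots> \<le> \<beta> + K * (Z * exp ((K + 1) * s))"
      proof (rule add_mono)
        show "norm (b' s) \<le> \<beta>" using \<beta> s t by auto
        have "norm (z s) \<le> Z * exp ((K + 1) * s)" using z s t by (auto simp: S_def)
        then have "K * norm (z s) \<le> K * (Z * exp ((K + 1) * s))"
          using K by (intro mult_left_mono)
        then show "norm (Q (radial_cutoff R (X z s)) (z s)) \<le> K * (Z * exp ((K + 1) * s))"
          using Q_cut order_trans by blast
      qed
      also have "\<dots> \<le> \<beta> + (K + 1) * (Z * exp ((K + 1) * s))"
        using Z by (intro add_left_mono mult_right_mono) auto
      finally show "norm (g z s - 0) \<le> \<beta> + (K + 1) * (Z * exp ((K + 1) * s))" by simp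
    next
      show "continuous_on {0..t} ?\<eta>" by (intro continuous_intros)
    qed (use t in simp_all)
    then have "norm (L z t) \<le> norm z0 + \<beta> * t + Z * exp ((K + 1) * t) - Z"
      by (simp add: L(2)[OF z])
    moreover have "\<beta> * t \<le> \<beta> * T" using t \<beta>(2) by (intro mult_left_mono) auto
    ultimately show "norm (L z t) \<le> Z * exp ((K + 1) * t)"
      using Z_def by linarith
  qed
  define Zm where "Zm = Z * exp ((K + 1) * T)"
  have Zm: "norm (z t) \<le> Zm" if "z \<in> S" "t \<in> {0..T}" for z t
  proof -
    have "Z * exp ((K + 1) * t) \<le> Z * exp ((K + 1) * T)"
      using that Z K by (intro mult_left_mono) (auto intro!: mult_left_mono)
    with that show ?thesis unfolding S_def Zm_def by fastforce
  qed
  have Zm0: "0 \<le> Zm" using Z by (simp add: Zm_def)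
  \<comment> \<open>From \<open>Q_diff_le\<close>: \<open>R + R\<close> for the two cut-off base
    points, 2 for the Lipschitz constant of the cutoff, \<open>Zm\<close> for the size of
    \<open>z\<close>.\<close>
  define K' where "K' = 4 * C * R * Zm"
  have K': "0 \<le> K'" using C \<open>0 \<le> R\<close> Zm0 by (simp add: K'_def)
  define \<kappa> where "\<kappa> = 2 * (K + K') + 1"
  have \<kappa>: "1 \<le> \<kappa>" "(K + K') / \<kappa> \<le> 1 / 2" using K K' by (auto simp: \<kappa>_def field_simps)
  have contr: "norm (L z1 t - L z2 t) \<le> D / 2 * exp (\<kappa> * t)"
    if z: "z1 \<in> S" "z2 \<in> S" and "0 \<le> D" and t: "t \<in> {0..T}"
      and le: "\<And>t. t \<in> {0..T} \<Longrightarrow> norm (z1 t - z2 t) \<le> D * exp (\<kappa> * t)" for z1 z2 D t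
  proof -
    have "norm (L z1 t - L z2 t) \<le> ((K + K') * D) / \<kappa> * (exp (\<kappa> * t) - 1)"
    proof (rule weak_solution_diff_le_exp[OF L(1)[OF z(1)] L(1)[OF z(2)] _ t])
      fix s assume s: "s \<in> {0..T}"
      let ?p1 = "radial_cutoff R (X z1 s)" and ?p2 = "radial_cutoff R (X z2 s)"
      have int: "z1 integrable_on {0..s}" "z2 integrable_on {0..s}"
        using s by (auto intro!: integrable_continuous_real continuous_on_subset[OF S_cont] z)
      have "X z1 s - X z2 s = integral {0..s} (\<lambda>r. z1 r - z2 r)"
        unfolding X_def using integral_diff[OF int] by simp
      then have "norm (X z1 s - X z2 s) = norm (integral {0..s} (\<lambda>r. z1 r - z2 r))" by simp
      also have "\<dots> \<le> D / \<kappa> * (exp (\<kappa> * s) - 1)"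
      proof (rule norm_integral_le_exp)
        show "continuous_on {0..s} (\<lambda>r. z1 r - z2 r)"
          using s by (intro continuous_on_diff continuous_on_subset[OF S_cont] z) auto
      qed (use s \<kappa>(1) le in auto)
      \<comment> \<open>As \<open>\<kappa>\<close> is at least 1, the gain from integrating
        \<open>z\<close> may be dropped.\<close>
      also have "\<dots> \<le> D / 1 * exp (\<kappa> * s)"
        using \<kappa> \<open>0 \<le> D\<close> s by (intro mult_mono divide_left_mono) auto
      finally have "norm (X z1 s - X z2 s) \<le> D * exp (\<kappa> * s)" by simp
      then have p: "norm (?p1 - ?p2) \<le> 2 * (D * exp (\<kappa> * s))"
        using radial_cutoff_diff_le[OF \<open>0 \<le> R\<close>, of "X z1 s" "X z2 s"] by linarith
      have "g z1 s - g z2 s = Q ?p1 (z1 s - z2 s) + (Q ?p1 (z2 s) - Q ?p2 (z2 s))"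
        by (simp add: g_def Q_diff)
      then have "norm (g z1 s - g z2 s)
          \<le> norm (Q ?p1 (z1 s - z2 s)) + norm (Q ?p1 (z2 s) - Q ?p2 (z2 s))"
        by (metis norm_triangle_ineq)
      also have "norm (Q ?p1 (z1 s - z2 s)) \<le> K * (D * exp (\<kappa> * s))"
        using Q_cut[of "X z1 s" "z1 s - z2 s"] mult_left_mono[OF le[OF s] K] by linarith
      also have "norm (Q ?p1 (z2 s) - Q ?p2 (z2 s)) \<le> C * (norm ?p1 + norm ?p2) * norm (?p1 - ?p2) * norm (z2 s)"
        by (rule Q_diff_le)
      also have "\<dots> \<le> C * (R + R) * (2 * (D * exp (\<kappa> * s))) * Zm"
        by (rule mult_mono[OF mult_mono[OF mult_left_mono[OF add_mono]]])
           (use C p Zm[OF z(2) s] norm_radial_cutoff_le[OF \<open>0 \<le> R\<close>] \<open>0 \<le> R\<close> \<open>0 \<le> D\<close> in simp_all)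
      also have "\<dots> = K' * (D * exp (\<kappa> * s))" by (simp add: K'_def)
      finally show "norm (g z1 s - g z2 s) \<le> (K + K') * D * exp (\<kappa> * s)"
        by (simp add: algebra_simps)
    qed (use \<kappa> L(2) z in auto)
    also have "\<dots> = ((K + K') / \<kappa>) * (D * (exp (\<kappa> * t) - 1))" by simp
    also have "\<dots> \<le> (1 / 2) * (D * exp (\<kappa> * t))"
      using \<kappa> K K' t \<open>0 \<le> D\<close> by (intro mult_mono) (auto intro!: mult_left_mono)
    finally show ?thesis by simp
  qed
  obtain z where z: "z \<in> S" "\<And>t. t \<in> {0..T} \<Longrightarrow> L z t = z t"
  proof (rule weighted_contraction_fixpoint[of \<kappa> S T L "\<lambda>_. 0"])
    show "(\<lambda>_. 0) \<in> S" using Z by (simp add: S_def)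
    show "z \<in> S" if f: "\<And>j. f j \<in> S" and lim: "uniform_limit {0..T} f z sequentially" for f z
      unfolding S_def
    proof (intro CollectI conjI ballI)
      show "continuous_on {0..T} z"
        using uniform_limit_theorem[OF _ lim] S_cont[OF f] by simp
      fix t assume t: "t \<in> {0..T}"
      show "norm (z t) \<le> Z * exp ((K + 1) * t)"
        using f t by (intro LIMSEQ_le_const2[OF tendsto_norm[OF tendsto_uniform_limitI[OF lim t]]])
          (auto simp: S_def)
    qed
  qed (use \<kappa> S_cont L_S contr in auto)
  define x where "x = X z"
  have x': "(x has_vector_derivative z t) (at t within {0..T})" if "t \<in> {0..T}" for t
  proof -
    have "(X z has_vector_derivative 0 + z t) (at t within {0..T})"
      unfolding X_def using that S_cont[OF z(1)]
      by (intro has_vector_derivative_add has_vector_derivative_const integral_has_vector_derivative)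
    then show ?thesis by (simp add: x_def)
  qed
  show ?thesis
  proof
    show "continuous_on {0..T} z" by (rule S_cont[OF z(1)])
    show "x 0 = x0" by (simp add: x_def X_def)
    show "(x has_vector_derivative z t) (at t within {0..T})" if "t \<in> {0..T}" for t
      by (rule x'[OF that])
    fix \<tau> n assume \<tau>: "\<tau> \<in> {0..T}" and R: "\<And>s. s \<in> {0..\<tau>} \<Longrightarrow> norm (x s) \<le> R"
    \<comment> \<open>The residual of the original equation. While \<open>x\<close> stays in the
      ball the cutoff is the identity and the equation for \<open>z\<close> is exactly the
      derivative of the original one, so the residual keeps its initial value, zero.\<close>
    let ?e = "\<lambda>s. P n (z s) - A n (x s) - P n (b s + F (x s))"
    have cx: "continuous_on {0..T} x"
      using x' by (meson continuous_on_eq_continuous_within has_vector_derivative_continuous)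
    have cF: "continuous_on U F" for U
      using F' has_derivative_at_withinI has_derivative_continuous_on by blast
    have "norm (?e \<tau>) \<le> norm (?e 0) + 0 - (0::real)"
    proof (rule norm_le_of_inner_derivative_le[where h = "\<lambda>_. 0" and \<eta> = "\<lambda>_. 0" and y' = "\<lambda>_. 0"])
      have "continuous_on {0..T} ?e"
        by (intro continuous_on_diff continuous_on_add bounded_linear.continuous_on[OF P]
            bounded_linear.continuous_on[OF A] cx S_cont[OF z(1)] b(1)
            continuous_on_compose2[OF cF cx subset_UNIV])
      then show "continuous_on {0..\<tau>} ?e"
        using \<tau> by (auto intro: continuous_on_subset)
      fix s assume s: "0 < s" "s < \<tau>"
      then have sT: "s \<in> {0..T}" "s < T" using \<tau> by auto
      have xs: "(x has_vector_derivative z s) (at s)"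
        using x'[OF sT(1)] s sT by (simp add: at_within_interior[of s "{0..T}"])
      have "((\<lambda>s. P n (L z s)) has_vector_derivative A n (L z s) + P n (g z s)) (at s)"
        using L(1)[OF z(1)] s sT unfolding weak_solution_def by blast
      then have "((\<lambda>s. P n (z s)) has_vector_derivative A n (L z s) + P n (g z s)) (at s)"
        by (rule has_vector_derivative_transform_within_open[of _ _ _ "{0<..<T}"])
           (use s sT z(2) in auto)
      also have "L z s = z s" using z(2) sT(1) by blast
      finally have Pz: "((\<lambda>s. P n (z s)) has_vector_derivative A n (z s) + P n (g z s)) (at s)" .
      have Ax: "((\<lambda>s. A n (x s)) has_vector_derivative A n (z s)) (at s)"
        by (rule bounded_linear.has_vector_derivative[OF A xs])
      have Fx: "((\<lambda>s. F (x s)) has_vector_derivative Q (x s) (z s)) (at s)"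
        using vector_derivative_diff_chain_within[OF xs, of F "Q (x s)"]
          has_derivative_at_withinI[OF F'] by (simp add: o_def)
      have "(?e has_vector_derivative A n (z s) + P n (g z s) - A n (z s) - P n (b' s + Q (x s) (z s))) (at s)"
        by (intro has_vector_derivative_diff has_vector_derivative_add Pz Ax Fx
            bounded_linear.has_vector_derivative[OF P] b(3) s(1) sT(2))
      moreover have "g z s = b' s + Q (x s) (z s)"
        using R[of s] s \<tau> by (simp add: g_def x_def radial_cutoff_def)
      ultimately show "(?e has_vector_derivative 0) (at s)" by simp
    qed (use \<tau> in auto)
    moreover have "z 0 = z0" using z(2)[of 0] L(2)[OF z(1)] \<open>0 < T\<close> by simp
    then have "?e 0 = 0"
      using x0[of n] by (simp add: x_def X_def z0_def P_add)
    ultimately show "P n (z \<tau>) = A n (x \<tau>) + P n (b \<tau> + F (x \<tau>))"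
      by (simp add: algebra_simps)
  qed
qed

end

section \<open>Continuation by a priori bounds\<close>

context semilinear
begin

text \<open>First-exit argument: before the radius is reached the cutoff is inactive and the a
  priori bound applies, but that bound is smaller than the radius by a margin, so by continuity the
  radius is never reached.\<close>

lemma strong_solution_on_interval:
  assumes "0 < T"
    and b: "continuous_on {0..T} b" "continuous_on {0..T} b'"
      "\<And>t. 0 < t \<Longrightarrow> t < T \<Longrightarrow> (b has_vector_derivative b' t) (at t)"
    and x0: "\<And>n. P n a0 = A n x0"
    and apriori: "\<And>\<tau> x z. 0 < \<tau> \<Longrightarrow> \<tau> \<le> T \<Longrightarrow> strong_solution b {0..\<tau>} x z \<Longrightarrow> x 0 = x0 \<Longrightarrow>
        norm (x \<tau>) \<le> B"
  obtains x z where "strong_solution b {0..T} x z" "x 0 = x0"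
proof -
  \<comment> \<open>The margin 1 above \<open>B\<close> is the jump that continuity will forbid;
    including \<open>norm x0\<close> makes the solution start strictly inside.\<close>
  define R where "R = max B (norm x0) + 1"
  have "0 \<le> norm x0" "norm x0 \<le> max B (norm x0)" "B \<le> max B (norm x0)" by simp_all
  then have R: "0 \<le> R" "B \<le> R - 1" "norm x0 < R"
    unfolding R_def by linarith+
  obtain x z where z: "continuous_on {0..T} z" and x0': "x 0 = x0"
    and x': "\<And>t. t \<in> {0..T} \<Longrightarrow> (x has_vector_derivative z t) (at t within {0..T})"
    and eq: "\<And>\<tau> n. \<tau> \<in> {0..T} \<Longrightarrow> (\<And>s. s \<in> {0..\<tau>} \<Longrightarrow> norm (x s) \<le> R) \<Longrightarrow>
        P n (z \<tau>) = A n (x \<tau>) + P n (b \<tau> + F (x \<tau>))"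
    using truncated_solution[OF \<open>0 < T\<close> R(1) b x0] by blast
  have cx: "continuous_on {0..T} x"
    using x' by (meson continuous_on_eq_continuous_within has_vector_derivative_continuous)
  have sol: "strong_solution b {0..\<tau>} x z" if "\<tau> \<le> T" "\<And>s. s \<in> {0..\<tau>} \<Longrightarrow> norm (x s) \<le> R" for \<tau>
    unfolding strong_solution_def
  proof (intro conjI ballI allI)
    show "continuous_on {0..\<tau>} z" using z that by (auto intro: continuous_on_subset)
    fix t assume t: "t \<in> {0..\<tau>}"
    show "(x has_vector_derivative z t) (at t within {0..\<tau>})"
      using t that by (intro has_vector_derivative_within_subset[OF x']) auto
    show "P n (z t) = A n (x t) + P n (b t + F (x t))" for n
      using t that by (intro eq) auto
  qed
  have bound: "norm (x t) < R" if t: "t \<in> {0..T}" for t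
  proof (rule ccontr)
    assume "\<not> norm (x t) < R"
    define E where "E = {s \<in> {0..T}. R \<le> norm (x s)}"
    have "closed E"
      unfolding E_def by (intro continuous_on_closed_Collect_le continuous_intros cx)
    moreover have "bounded E"
      by (rule bounded_subset[of "{0..T}"]) (auto simp: E_def)
    ultimately have "compact E" by (simp add: compact_eq_bounded_closed)
    moreover have "E \<noteq> {}" using t \<open>\<not> norm (x t) < R\<close> by (auto simp: E_def)
    ultimately obtain \<tau> where \<tau>: "\<tau> \<in> E" "\<And>s. s \<in> E \<Longrightarrow> \<tau> \<le> s"
      using compact_attains_inf by metis
    have \<tau>T: "0 \<le> \<tau>" "\<tau> \<le> T" "R \<le> norm (x \<tau>)" using \<tau>(1) by (auto simp: E_def)
    have "0 < \<tau>" using \<tau>T R(3) x0' by (cases "\<tau> = 0") auto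
    obtain d where d: "0 < d" "\<And>s. s \<in> {0..T} \<Longrightarrow> dist s \<tau> < d \<Longrightarrow> dist (x s) (x \<tau>) < 1"
      using cx[unfolded continuous_on_iff, rule_format, of \<tau> 1] \<tau>T by auto
    \<comment> \<open>Close enough to \<open>\<tau>\<close> for the continuity modulus, yet
      positive, as the a priori bound requires.\<close>
    define s where "s = max (\<tau> / 2) (\<tau> - d / 2)"
    have s: "0 < s" "s < \<tau>" "dist s \<tau> < d"
      using \<open>0 < \<tau>\<close> d(1) by (auto simp: s_def dist_real_def max_def)
    have "norm (x r) \<le> R" if "r \<in> {0..s}" for r
    proof (rule ccontr)
      assume "\<not> norm (x r) \<le> R"
      then have "r \<in> E" using that s \<tau>T by (auto simp: E_def)
      then show False using \<tau>(2) that s by fastforce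
    qed
    then have "strong_solution b {0..s} x z" using s \<tau>T by (intro sol) auto
    then have "norm (x s) \<le> B" using s \<tau>T x0' by (intro apriori) auto
    moreover have "norm (x \<tau>) - norm (x s) \<le> dist (x s) (x \<tau>)"
      by (metis dist_commute dist_norm norm_triangle_ineq2)
    moreover have "dist (x s) (x \<tau>) < 1"
      using s \<tau>T by (intro d) auto
    ultimately show False using R(2) \<tau>T(3) by linarith
  qed
  have "strong_solution b {0..T} x z"
    by (rule sol[OF order_refl]) (rule less_imp_le[OF bound])
  with x0' show ?thesis using that by blast
qed

lemma global_strong_solution:
  assumes b: "continuous_on {0..} b" "continuous_on {0..} b'"
      "\<And>t. 0 < t \<Longrightarrow> (b has_vector_derivative b' t) (at t)"
    and x0: "\<And>n. P n a0 = A n x0"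
    and apriori: "\<And>T. 0 < T \<Longrightarrow> \<exists>B. \<forall>\<tau> x z. 0 < \<tau> \<longrightarrow> \<tau> \<le> T \<longrightarrow>
        strong_solution b {0..\<tau>} x z \<longrightarrow> x 0 = x0 \<longrightarrow> norm (x \<tau>) \<le> B"
  obtains x z where "strong_solution b {0..} x z" "x 0 = x0"
proof -
  have "\<exists>x z. strong_solution b {0..T} x z \<and> x 0 = x0" if T: "0 < T" for T
  proof -
    obtain B where B: "\<And>\<tau> x z. 0 < \<tau> \<Longrightarrow> \<tau> \<le> T \<Longrightarrow>
        strong_solution b {0..\<tau>} x z \<Longrightarrow> x 0 = x0 \<Longrightarrow> norm (x \<tau>) \<le> B"
      using apriori[OF T] by blast
    have bc: "continuous_on {0..T} b" "continuous_on {0..T} b'"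
      using b by (auto intro: continuous_on_subset)
    show ?thesis
    proof (rule strong_solution_on_interval[of T b b' a0 x0 B])
      show "P n a0 = A n x0" for n by (rule x0)
    qed (use T bc b(3) B in auto)
  qed
  then obtain X Z where XZ: "\<And>T. 0 < T \<Longrightarrow> strong_solution b {0..T} (X T) (Z T)"
    "\<And>T. 0 < T \<Longrightarrow> X T 0 = x0"
    by metis
  \<comment> \<open>By uniqueness the value at \<open>t\<close> is the same for every horizon beyond
    \<open>t\<close>. The horizon \<open>t + 1\<close> leaves room to the right of \<open>t\<close>,
    so derivatives within it and within the half-line agree.\<close>
  define x where "x t = X (t + 1) t" for t
  define z where "z t = Z (t + 1) t" for t
  have eq: "x t = X T t" "z t = Z T t" if "t \<in> {0..T}" "0 < T" for t T
  proof -
    let ?m = "min T (t + 1)"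
    have m: "0 < ?m" "t \<in> {0..?m}" using that by auto
    have "strong_solution b {0..?m} (X (t + 1)) (Z (t + 1))" "strong_solution b {0..?m} (X T) (Z T)"
      using that by (auto intro!: strong_solution_subset[OF XZ(1)])
    moreover have "X (t + 1) 0 = X T 0" using that by (simp add: XZ(2))
    ultimately show "x t = X T t" "z t = Z T t"
      unfolding x_def z_def using strong_solution_unique m(2) by blast+
  qed
  have at: "at t within {0..t + 1} = at t within {0..}" if "0 \<le> t" for t :: real
    by (rule at_within_nhd[of _ "{..<t + 1}"]) (use that in auto)
  have "strong_solution b {0..} x z"
    unfolding strong_solution_def
  proof (intro conjI ballI allI)
    show "continuous_on {0..} z"
      unfolding continuous_on_eq_continuous_within
    proof
      fix t :: real assume "t \<in> {0..}"
      then have t: "0 \<le> t" "0 < t + 1" by auto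
      have "continuous_on {0..t + 1} (Z (t + 1))"
        using XZ(1)[OF t(2)] by (simp add: strong_solution_def)
      then have "continuous_on {0..t + 1} z"
        by (subst continuous_on_cong[OF refl eq(2)[OF _ t(2)]])
      then have "continuous (at t within {0..t + 1}) z"
        using t(1) by (simp add: continuous_on_eq_continuous_within)
      then show "continuous (at t within {0..}) z"
        by (simp only: at[OF t(1)])
    qed
    fix t :: real assume "t \<in> {0..}"
    then have t: "0 \<le> t" "0 < t + 1" "t \<in> {0..t + 1}" by auto
    have "(X (t + 1) has_vector_derivative Z (t + 1) t) (at t within {0..t + 1})"
      and *: "\<And>n. P n (Z (t + 1) t) = A n (X (t + 1) t) + P n (b t + F (X (t + 1) t))"
      using XZ(1)[OF t(2)] t(3) unfolding strong_solution_def by blast+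
    then have "(x has_vector_derivative Z (t + 1) t) (at t within {0..t + 1})"
      using eq(1)[OF _ t(2)] t(3) by (intro has_vector_derivative_transform[of t _ "x" "X (t + 1)"]) auto
    then show "(x has_vector_derivative z t) (at t within {0..})"
      by (simp only: at[OF t(1)] z_def)
    show "P n (z t) = A n (x t) + P n (b t + F (x t))" for n
      unfolding x_def z_def by (rule *)
  qed
  moreover have "x 0 = x0" by (simp add: x_def XZ(2))
  ultimately show ?thesis by (rule that)
qed

end

section \<open>The space of square-integrable functions\<close>

lemma finite_measure_leb: "finite_measure (leb l)"
  by (rule finite_measure_lebesgue_on) auto

lemma measure_leb: "0 \<le> l \<Longrightarrow> measure (leb l) (space (leb l)) = l"
  by (simp add: measure_restrict_space)

lemma integrable_leb_continuous:
  fixes g :: "real \<Rightarrow> real"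
  assumes "continuous_on {0..l} g"
  shows "integrable (leb l) g" "(LINT x|leb l. g x) = integral {0..l} g"
proof -
  have "integrable (lebesgue_on {0..l}) g"
    using assms by (rule continuous_imp_integrable_real)
  then have "set_integrable lebesgue {0..l} g"
    by (simp add: integrable_restrict_space set_integrable_def)
  then have "set_integrable lebesgue {0<..<l} g"
    by (rule set_integrable_subset) auto
  then show *: "integrable (leb l) g"
    by (simp add: integrable_restrict_space set_integrable_def)
  show "(LINT x|leb l. g x) = integral {0..l} g"
    using lebesgue_integral_eq_integral[OF *] by (simp add: integral_open_interval_real)
qed

lemma integral_leb_derivative:
  fixes G :: "real \<Rightarrow> real"
  assumes "0 \<le> l" "continuous_on {0..l} g"
    and "\<And>x. x \<in> {0..l} \<Longrightarrow> (G has_real_derivative g x) (at x)"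
  shows "(LINT x|leb l. g x) = G l - G 0"
proof -
  have "(g has_integral (G l - G 0)) {0..l}"
    using assms by (intro fundamental_theorem_of_calculus)
      (auto simp: has_real_derivative_iff_has_vector_derivative[symmetric] intro: DERIV_subset)
  then show ?thesis
    using integrable_leb_continuous(2)[OF assms(2)] by (simp add: integral_unique)
qed

definition ip :: "real \<Rightarrow> (real \<Rightarrow> real) \<Rightarrow> (real \<Rightarrow> real) \<Rightarrow> real" where
  "ip l f g = (LINT x|leb l. f x * g x)"

lemma L2_measurable: "f \<in> L2 l \<Longrightarrow> f \<in> borel_measurable (leb l)"
  by (simp add: L2_def)

lemma L2_square_integrable: "f \<in> L2 l \<Longrightarrow> integrable (leb l) (\<lambda>x. (f x)\<^sup>2)"
  by (simp add: L2_def)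

lemma L2_mult_integrable:
  assumes "f \<in> L2 l" "g \<in> L2 l"
  shows "integrable (leb l) (\<lambda>x. f x * g x)"
proof (rule Bochner_Integration.integrable_bound)
  show "integrable (leb l) (\<lambda>x. (f x)\<^sup>2 + (g x)\<^sup>2)"
    using assms by (intro Bochner_Integration.integrable_add L2_square_integrable)
  show "(\<lambda>x. f x * g x) \<in> borel_measurable (leb l)"
    using assms[THEN L2_measurable] by (rule borel_measurable_times)
  have "\<bar>a * b\<bar> \<le> \<bar>a\<^sup>2 + b\<^sup>2\<bar>" for a b :: real
  proof -
    have "2 * (\<bar>a\<bar> * \<bar>b\<bar>) \<le> a\<^sup>2 + b\<^sup>2"
      using sum_squares_bound[of "\<bar>a\<bar>" "\<bar>b\<bar>"] by simp
    moreover have "0 \<le> \<bar>a\<bar> * \<bar>b\<bar>" by simp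
    moreover have "a\<^sup>2 + b\<^sup>2 \<le> \<bar>a\<^sup>2 + b\<^sup>2\<bar>" by simp
    ultimately show ?thesis unfolding abs_mult by linarith
  qed
  then show "AE x in leb l. norm (f x * g x) \<le> norm ((f x)\<^sup>2 + (g x)\<^sup>2)"
    by simp
qed

lemma L2_integrable: "f \<in> L2 l \<Longrightarrow> integrable (leb l) f"
  by (auto simp: L2_def intro: finite_measure.square_integrable_imp_integrable[OF finite_measure_leb])

lemma L2_add: "f \<in> L2 l \<Longrightarrow> g \<in> L2 l \<Longrightarrow> f + g \<in> L2 l"
  using L2_mult_integrable[of f l g]
  by (auto simp: L2_def plus_fun_def power2_sum mult.assoc intro!: borel_measurable_add)

lemma L2_scaleR: "f \<in> L2 l \<Longrightarrow> r *\<^sub>R f \<in> L2 l"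
  by (auto simp: L2_def scaleR_fun_def power_mult_distrib)

lemma L2_uminus: "f \<in> L2 l \<Longrightarrow> - f \<in> L2 l"
  by (auto simp: L2_def fun_Compl_def)

lemma L2_diff: "f \<in> L2 l \<Longrightarrow> g \<in> L2 l \<Longrightarrow> f - g \<in> L2 l"
  using L2_add[of f l "- g"] L2_uminus[of g l] by simp

lemma L2_zero: "0 \<in> L2 l"
  by (simp add: L2_def zero_fun_def)

lemma L2_sum: "(\<And>i. i \<in> I \<Longrightarrow> f i \<in> L2 l) \<Longrightarrow> sum f I \<in> L2 l"
  by (induction I rule: infinite_finite_induct) (auto intro: L2_add L2_zero)

lemma L2_bounded:
  assumes "f \<in> borel_measurable (leb l)" "AE x in leb l. \<bar>f x\<bar> \<le> K" "0 \<le> l"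
  shows "f \<in> L2 l" "0 \<le> K \<Longrightarrow> L2norm l f \<le> K * sqrt l"
proof -
  interpret finite_measure "leb l" by (rule finite_measure_leb)
  have le: "AE x in leb l. (f x)\<^sup>2 \<le> K\<^sup>2"
    using assms(2) by eventually_elim (metis abs_le_square_iff abs_ge_self order_trans)
  have int: "integrable (leb l) (\<lambda>x. (f x)\<^sup>2)"
    using assms(1) le by (intro integrable_const_bound[of _ "K\<^sup>2"]) auto
  with assms(1) show "f \<in> L2 l" by (simp add: L2_def)
  have "(LINT x|leb l. (f x)\<^sup>2) \<le> (LINT x|leb l. K\<^sup>2)"
    using int le by (intro integral_mono_AE) auto
  also have "\<dots> = K\<^sup>2 * l" using assms(3) measure_leb[of l] by simp
  finally have "sqrt (LINT x|leb l. (f x)\<^sup>2) \<le> sqrt (K\<^sup>2 * l)"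
    by (rule real_sqrt_le_mono)
  then show "L2norm l f \<le> K * sqrt l" if "0 \<le> K"
    using that by (simp add: L2norm_def real_sqrt_mult)
qed

lemma L2_continuous:
  assumes "continuous_on {0..l} g"
  shows "g \<in> L2 l"
  using integrable_leb_continuous(1)[of l g] integrable_leb_continuous(1)[of l "\<lambda>x. (g x)\<^sup>2"] assms
  by (auto simp: L2_def intro: continuous_on_power)

lemma ip_commute: "ip l f g = ip l g f"
  by (simp add: ip_def mult.commute)

lemma ip_add_left: "f \<in> L2 l \<Longrightarrow> g \<in> L2 l \<Longrightarrow> h \<in> L2 l \<Longrightarrow> ip l (f + g) h = ip l f h + ip l g h"
  by (simp add: ip_def distrib_right L2_mult_integrable)

lemma ip_scaleR_left: "ip l (r *\<^sub>R f) h = r * ip l f h"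
  by (simp add: ip_def scaleR_fun_def mult.assoc)

lemma ip_uminus_left: "ip l (- f) h = - ip l f h"
  by (simp add: ip_def)

lemma ip_diff_left: "f \<in> L2 l \<Longrightarrow> g \<in> L2 l \<Longrightarrow> h \<in> L2 l \<Longrightarrow> ip l (f - g) h = ip l f h - ip l g h"
  by (simp add: ip_def left_diff_distrib L2_mult_integrable)

lemma ip_zero_left: "ip l 0 h = 0"
  by (simp add: ip_def)

lemma ip_sum_left:
  "(\<And>i. i \<in> I \<Longrightarrow> f i \<in> L2 l) \<Longrightarrow> h \<in> L2 l \<Longrightarrow> ip l (sum f I) h = (\<Sum>i\<in>I. ip l (f i) h)"
  by (induction I rule: infinite_finite_induct) (auto simp: ip_zero_left ip_add_left L2_sum)

lemma ip_cong_AE: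
  assumes "f \<in> L2 l" "g \<in> L2 l" "h \<in> L2 l" "eq_ae l f g"
  shows "ip l f h = ip l g h"
  unfolding ip_def
  using assms by (intro integral_cong_AE borel_measurable_times L2_measurable) (auto simp: eq_ae_def)

lemma L2norm_nonneg: "0 \<le> L2norm l f"
  by (simp add: L2norm_def)

lemma L2norm_squared: "(L2norm l f)\<^sup>2 = ip l f f"
  by (simp add: L2norm_def ip_def power2_eq_square)

lemma L2norm_uminus: "L2norm l (- f) = L2norm l f"
  by (simp add: L2norm_def)

lemma L2norm_commute: "L2norm l (f - g) = L2norm l (g - f)"
  using L2norm_uminus[of l "f - g"] by simp

lemma ip_Cauchy_Schwarz:
  assumes f: "f \<in> L2 l" and g: "g \<in> L2 l"
  shows "\<bar>ip l f g\<bar> \<le> L2norm l f * L2norm l g"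
proof -
  let ?a = "ip l f f" and ?b = "ip l f g" and ?c = "ip l g g"
  have quad: "0 \<le> s\<^sup>2 * ?a - 2 * s * t * ?b + t\<^sup>2 * ?c" for s t
  proof -
    let ?h = "s *\<^sub>R f - t *\<^sub>R g"
    have L2: "s *\<^sub>R f \<in> L2 l" "t *\<^sub>R g \<in> L2 l" "?h \<in> L2 l"
      using f g by (auto intro: L2_scaleR L2_diff)
    have "0 \<le> ip l ?h ?h" by (simp flip: L2norm_squared)
    also have "ip l ?h ?h = s * ip l f ?h - t * ip l g ?h"
      using ip_diff_left[OF L2] by (simp add: ip_scaleR_left)
    also have "ip l f ?h = s * ?a - t * ?b"
      using ip_diff_left[OF L2(1,2) f] unfolding ip_commute[of l f ?h]
      by (simp add: ip_scaleR_left ip_commute[of l g f])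
    also have "ip l g ?h = s * ?b - t * ?c"
      using ip_diff_left[OF L2(1,2) g] unfolding ip_commute[of l g ?h]
      by (simp add: ip_scaleR_left)
    finally show ?thesis by (simp add: algebra_simps power2_eq_square)
  qed
  have "?b\<^sup>2 \<le> ?a * ?c"
  proof (cases "?c = 0")
    case True
    have "?b = 0"
    proof (rule ccontr)
      assume "?b \<noteq> 0"
      \<comment> \<open>This choice of \<open>t\<close> makes the nonnegative quadratic form equal
        to -1.\<close>
      then show False using quad[of 1 "(?a + 1) / (2 * ?b)"] True by (simp add: field_simps)
    qed
    then show ?thesis using True by simp
  next
    case False
    then have "0 < ?c" using L2norm_squared[of l g] zero_le_power2[of "L2norm l g"] by linarith
    \<comment> \<open>With \<open>s = ?c\<close> and \<open>t = ?b\<close> the form factors through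
      \<open>?c\<close>.\<close>
    have "0 \<le> ?c * (?a * ?c - ?b\<^sup>2)"
      using quad[of ?c ?b] by (simp add: algebra_simps power2_eq_square)
    then show ?thesis using \<open>0 < ?c\<close> by (simp add: zero_le_mult_iff)
  qed
  then have "?b\<^sup>2 \<le> (L2norm l f * L2norm l g)\<^sup>2"
    by (simp add: power_mult_distrib L2norm_squared)
  then show ?thesis
    by (metis L2norm_nonneg abs_le_square_iff abs_of_nonneg mult_nonneg_nonneg)
qed

lemma L2norm_triangle:
  assumes f: "f \<in> L2 l" and g: "g \<in> L2 l"
  shows "L2norm l (f + g) \<le> L2norm l f + L2norm l g"
proof (rule power2_le_imp_le)
  have fg: "f + g \<in> L2 l" using f g by (rule L2_add)
  have "(L2norm l (f + g))\<^sup>2 = ip l f (f + g) + ip l g (f + g)"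
    by (simp add: L2norm_squared ip_add_left f g fg)
  also have "ip l f (f + g) = ip l f f + ip l f g"
    using ip_add_left[OF f g f] by (simp add: ip_commute[of l f "f + g"] ip_commute[of l g f])
  also have "ip l g (f + g) = ip l f g + ip l g g"
    using ip_add_left[OF f g g] by (simp add: ip_commute[of l g "f + g"])
  finally have "(L2norm l (f + g))\<^sup>2 = ip l f f + ip l f g + (ip l f g + ip l g g)" .
  moreover have "(L2norm l f + L2norm l g)\<^sup>2 = ip l f f + 2 * (L2norm l f * L2norm l g) + ip l g g"
    by (simp add: power2_sum L2norm_squared)
  ultimately show "(L2norm l (f + g))\<^sup>2 \<le> (L2norm l f + L2norm l g)\<^sup>2"
    using ip_Cauchy_Schwarz[OF f g] by linarith
qed (simp add: L2norm_nonneg)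

lemma tendsto_ip:
  assumes "\<And>n. S n \<in> L2 l" "f \<in> L2 l" "g \<in> L2 l" "(\<lambda>n. L2norm l (f - S n)) \<longlonglongrightarrow> 0"
  shows "(\<lambda>n. ip l (S n) g) \<longlonglongrightarrow> ip l f g"
proof -
  have "(\<lambda>n. L2norm l (f - S n) * L2norm l g) \<longlonglongrightarrow> 0"
    using tendsto_mult_right[OF assms(4), of "L2norm l g"] by simp
  moreover have "norm (ip l (S n) g - ip l f g) \<le> L2norm l (f - S n) * L2norm l g" for n
    using ip_Cauchy_Schwarz[of "f - S n" l g] assms
    by (simp add: ip_diff_left L2_diff abs_minus_commute)
  ultimately have "(\<lambda>n. ip l (S n) g - ip l f g) \<longlonglongrightarrow> 0"
    by (metis (no_types, lifting) Lim_null_comparison always_eventually)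
  then show ?thesis by (rule LIM_zero_cancel)
qed

lemma L2norm_squared_orthonormal_sum:
  assumes e: "\<And>n. e n \<in> L2 l" "\<And>i j. ip l (e i) (e j) = (if i = j then 1 else 0)" and "finite I"
  shows "(L2norm l (\<Sum>i\<in>I. a i *\<^sub>R e i))\<^sup>2 = (\<Sum>i\<in>I. (a i :: real)\<^sup>2)"
proof -
  let ?S = "\<Sum>i\<in>I. a i *\<^sub>R e i"
  have S: "?S \<in> L2 l" by (intro L2_sum L2_scaleR e)
  have "ip l ?S (e j) = (\<Sum>i\<in>I. a i * (if i = j then 1 else 0))" for j
    by (subst ip_sum_left) (auto simp: ip_scaleR_left e L2_scaleR intro!: sum.cong)
  then have ej: "ip l ?S (e j) = a j" if "j \<in> I" for j
    using that \<open>finite I\<close> by (simp add: if_distrib[of "(*) _"] sum.delta cong: if_cong)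
  have "(L2norm l ?S)\<^sup>2 = (\<Sum>i\<in>I. ip l (a i *\<^sub>R e i) ?S)"
    unfolding L2norm_squared by (intro ip_sum_left L2_scaleR e S)
  also have "\<dots> = (\<Sum>i\<in>I. (a i)\<^sup>2)"
    by (intro sum.cong refl) (simp add: ip_scaleR_left ip_commute[of l "e _" ?S] ej power2_eq_square)
  finally show ?thesis .
qed

text \<open>The limit has to be an actual function. Square-mean Cauchy sequences are Cauchy in mean
  on a bounded interval, a subsequence therefore converges almost everywhere, and Fatou's lemma
  shows that its pointwise limit is also the limit in square mean.\<close>

lemma Riesz_Fischer:
  assumes l: "0 \<le> l" and e: "\<And>n. e n \<in> L2 l" "\<And>i j. ip l (e i) (e j) = (if i = j then 1 else 0)"
    and a: "summable (\<lambda>n. (a n :: real)\<^sup>2)"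
  obtains f where "f \<in> L2 l" "(\<lambda>N. L2norm l (f - (\<Sum>i<N. a i *\<^sub>R e i))) \<longlonglongrightarrow> 0"
proof -
  define S where "S N = (\<Sum>i<N. a i *\<^sub>R e i)" for N
  have S: "S N \<in> L2 l" for N unfolding S_def by (intro L2_sum L2_scaleR e)
  have diff: "(L2norm l (S n - S m))\<^sup>2 = (\<Sum>i=m..<n. (a i)\<^sup>2)" if "m \<le> n" for m n
  proof -
    have "S n - S m = (\<Sum>i=m..<n. a i *\<^sub>R e i)"
      unfolding S_def using that sum_diff_nat_ivl[of 0 m n "\<lambda>i. a i *\<^sub>R e i"]
      by (simp add: atLeast0LessThan)
    then show ?thesis by (simp add: L2norm_squared_orthonormal_sum[OF e])
  qed
  have Cauchy2: "\<exists>N. \<forall>m\<ge>N. \<forall>n\<ge>N. L2norm l (S n - S m) < d" if "0 < d" for d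
  proof -
    obtain N where N: "\<And>m n. m \<ge> N \<Longrightarrow> norm (\<Sum>i=m..<n. (a i)\<^sup>2) < d\<^sup>2"
      using a[unfolded summable_Cauchy] \<open>0 < d\<close> by (metis zero_less_power)
    have "L2norm l (S n - S m) < d" if "m \<ge> N" "n \<ge> m" for m n
    proof (rule power2_less_imp_less)
      show "(L2norm l (S n - S m))\<^sup>2 < d\<^sup>2" using N[OF that(1), of n] diff[OF that(2)] by simp
    qed (use \<open>0 < d\<close> in simp)
    then have "L2norm l (S n - S m) < d" if "m \<ge> N" "n \<ge> N" for m n
      using that L2norm_commute[of l "S n" "S m"] by (metis nle_le)
    then show ?thesis by blast
  qed
  have Cauchy1: "\<exists>N. \<forall>i\<ge>N. \<forall>j\<ge>N. (LINT x|leb l. norm (S i x - S j x)) < d" if "0 < d" for d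
  proof -
    \<comment> \<open>Cauchy-Schwarz against the constant 1 costs \<open>sqrt l\<close>; adding 1
      keeps the divisor positive when \<open>l = 0\<close>.\<close>
    define d' where "d' = d / (sqrt l + 1)"
    have "0 < sqrt l + 1" using l by (intro add_nonneg_pos) auto
    then have d': "0 < d'" "d' * (sqrt l + 1) = d" using \<open>0 < d\<close> by (auto simp: d'_def)
    obtain N where N: "\<And>m n. m \<ge> N \<Longrightarrow> n \<ge> N \<Longrightarrow> L2norm l (S n - S m) < d'"
      using Cauchy2[OF d'(1)] by blast
    have "(LINT x|leb l. norm (S i x - S j x)) < d" if "i \<ge> N" "j \<ge> N" for i j
    proof -
      let ?h = "\<lambda>x. \<bar>S i x - S j x\<bar>"
      have h: "?h \<in> L2 l" "L2norm l ?h = L2norm l (S i - S j)"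
        using L2_diff[OF S S, of i j] by (auto simp: L2_def L2norm_def fun_diff_def)
      have one: "(\<lambda>_. 1) \<in> L2 l" "L2norm l (\<lambda>_. 1) = sqrt l"
        using l measure_leb[OF l] L2_continuous[of l "\<lambda>_. 1"] by (auto simp: L2norm_def)
      have "(LINT x|leb l. norm (S i x - S j x)) = ip l ?h (\<lambda>_. 1)" by (simp add: ip_def)
      also have "\<dots> \<le> L2norm l (S i - S j) * sqrt l"
        using ip_Cauchy_Schwarz[OF h(1) one(1)] h one by simp
      also have "\<dots> \<le> d' * sqrt l"
        using N[OF that(2,1)] l by (intro mult_right_mono) auto
      also have "\<dots> < d' * (sqrt l + 1)" using d'(1) by (simp add: distrib_left)
      finally show ?thesis using d'(2) by simp
    qed
    then show ?thesis by blast
  qed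
  obtain r where r: "strict_mono r" and AE_C: "AE x in leb l. Cauchy (\<lambda>i. S (r i) x)"
    by (rule cauchy_L1_AE_cauchy_subseq[of "leb l" S, OF L2_integrable[OF S] Cauchy1])
  define f where "f x = lim (\<lambda>i. S (r i) x)" for x
  have f_meas: "f \<in> borel_measurable (leb l)"
    unfolding f_def by (intro borel_measurable_lim_metric L2_measurable S)
  have AE_lim: "AE x in leb l. (\<lambda>i. S (r i) x) \<longlonglongrightarrow> f x"
    using AE_C by eventually_elim (simp add: f_def Cauchy_convergent convergent_LIMSEQ_iff[THEN iffD1])
  \<comment> \<open>Stated for an arbitrary \<open>m\<close> and \<open>d\<close>, since it serves
    twice: once for the square-integrability of \<open>f\<close>, once for the convergence.\<close>
  have fatou: "integrable (leb l) (\<lambda>x. (f x - S m x)\<^sup>2) \<and> (LINT x|leb l. (f x - S m x)\<^sup>2) \<le> d\<^sup>2"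
    if d: "0 \<le> d" and le: "\<And>n. n \<ge> m \<Longrightarrow> L2norm l (S n - S m) \<le> d" for m d
  proof -
    have meas: "(\<lambda>x. (f x - S m x)\<^sup>2) \<in> borel_measurable (leb l)"
      using f_meas L2_measurable[OF S] by measurable
    have "(\<integral>\<^sup>+x. ennreal ((f x - S m x)\<^sup>2) \<partial>leb l)
        = (\<integral>\<^sup>+x. liminf (\<lambda>i. ennreal ((S (r i) x - S m x)\<^sup>2)) \<partial>leb l)"
    proof (rule nn_integral_cong_AE)
      show "AE x in leb l. ennreal ((f x - S m x)\<^sup>2) = liminf (\<lambda>i. ennreal ((S (r i) x - S m x)\<^sup>2))"
        using AE_lim
      proof eventually_elim
        case (elim x)
        have "(\<lambda>i. ennreal ((S (r i) x - S m x)\<^sup>2)) \<longlonglongrightarrow> ennreal ((f x - S m x)\<^sup>2)"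
          by (intro tendsto_ennrealI tendsto_intros elim)
        from lim_imp_Liminf[OF sequentially_bot this] show ?case by (rule sym)
      qed
    qed
    also have "\<dots> \<le> liminf (\<lambda>i. \<integral>\<^sup>+x. ennreal ((S (r i) x - S m x)\<^sup>2) \<partial>leb l)"
      using L2_measurable[OF S] by (intro nn_integral_liminf) measurable
    also have "\<dots> \<le> ennreal (d\<^sup>2)"
    proof (rule Liminf_le)
      have "(\<integral>\<^sup>+x. ennreal ((S (r i) x - S m x)\<^sup>2) \<partial>leb l) \<le> ennreal (d\<^sup>2)" if "i \<ge> m" for i
      proof -
        have "m \<le> r i" using that seq_suble[OF r, of i] by linarith
        have "(\<integral>\<^sup>+x. ennreal ((S (r i) x - S m x)\<^sup>2) \<partial>leb l) = ennreal (LINT x|leb l. (S (r i) x - S m x)\<^sup>2)"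
          using L2_square_integrable[OF L2_diff[OF S S]] by (intro nn_integral_eq_integral) auto
        also have "(LINT x|leb l. (S (r i) x - S m x)\<^sup>2) = (L2norm l (S (r i) - S m))\<^sup>2"
          by (simp add: L2norm_def)
        also have "ennreal \<dots> \<le> ennreal (d\<^sup>2)"
          using le[OF \<open>m \<le> r i\<close>] L2norm_nonneg by (intro ennreal_leI power_mono)
        finally show ?thesis .
      qed
      then show "\<forall>\<^sub>F i in sequentially. (\<integral>\<^sup>+x. ennreal ((S (r i) x - S m x)\<^sup>2) \<partial>leb l) \<le> ennreal (d\<^sup>2)"
        unfolding eventually_sequentially by blast
    qed simp
    finally have nn: "(\<integral>\<^sup>+x. ennreal ((f x - S m x)\<^sup>2) \<partial>leb l) \<le> ennreal (d\<^sup>2)" .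
    have int: "integrable (leb l) (\<lambda>x. (f x - S m x)\<^sup>2)"
      using meas le_less_trans[OF nn ennreal_less_top] by (intro integrableI_nonneg) auto
    have "ennreal (LINT x|leb l. (f x - S m x)\<^sup>2) \<le> ennreal (d\<^sup>2)"
      using nn nn_integral_eq_integral[OF int] by simp
    with int show ?thesis by simp
  qed
  have f: "f \<in> L2 l"
  proof -
    obtain N where "\<And>n. n \<ge> N \<Longrightarrow> L2norm l (S n - S N) < 1" using Cauchy2[of 1] by auto
    then have "integrable (leb l) (\<lambda>x. (f x - S N x)\<^sup>2)"
      using fatou[of 1 N] by (simp add: less_imp_le)
    then have "f - S N \<in> L2 l"
      using f_meas L2_measurable[OF S, of N] by (simp add: L2_def fun_diff_def)
    from L2_add[OF this S[of N]] show ?thesis by simp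
  qed
  have "(\<lambda>N. L2norm l (f - S N)) \<longlonglongrightarrow> 0"
  proof (rule LIMSEQ_I)
    fix d :: real assume "0 < d"
    then obtain N where N: "\<And>m n. m \<ge> N \<Longrightarrow> n \<ge> N \<Longrightarrow> L2norm l (S n - S m) < d / 2"
      using Cauchy2[of "d / 2"] by auto
    have "norm (L2norm l (f - S m) - 0) < d" if "m \<ge> N" for m
    proof -
      have "(LINT x|leb l. (f x - S m x)\<^sup>2) \<le> (d / 2)\<^sup>2"
        using fatou[of "d / 2" m] N that \<open>0 < d\<close> by (simp add: less_imp_le)
      then have "L2norm l (f - S m) \<le> d / 2"
        using \<open>0 < d\<close> real_sqrt_le_mono[of _ "(d / 2)\<^sup>2"] by (simp add: L2norm_def)
      then show ?thesis using \<open>0 < d\<close> L2norm_nonneg[of l "f - S m"] by simp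
    qed
    then show "\<exists>no. \<forall>m\<ge>no. norm (L2norm l (f - S m) - 0) < d" by blast
  qed
  with f show ?thesis using that unfolding S_def by blast
qed

section \<open>The sine basis\<close>

text \<open>The shift by one makes index 0 the first sine mode, so that all frequencies are
  positive.\<close>

definition freq :: "real \<Rightarrow> nat \<Rightarrow> real" where
  "freq l n = (real n + 1) * pi / l"

definition sinb :: "real \<Rightarrow> nat \<Rightarrow> real \<Rightarrow> real" where
  "sinb l n x = sqrt (2 / l) * sin (freq l n * x)"

definition cosb :: "real \<Rightarrow> nat \<Rightarrow> real \<Rightarrow> real" where
  "cosb l n x = sqrt (2 / l) * cos (freq l n * x)"

lemma freq_pos: "0 < l \<Longrightarrow> 0 < freq l n"
  by (simp add: freq_def add_nonneg_pos)

lemma freq_mult_l: "0 < l \<Longrightarrow> freq l n * l = (real n + 1) * pi"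
  by (simp add: freq_def)

lemma DERIV_sinb: "(sinb l n has_real_derivative freq l n * cosb l n x) (at x)"
  unfolding sinb_def[abs_def] cosb_def by (auto intro!: derivative_eq_intros)

lemma DERIV_cosb: "(cosb l n has_real_derivative - (freq l n * sinb l n x)) (at x)"
  unfolding cosb_def[abs_def] sinb_def by (auto intro!: derivative_eq_intros)

lemma continuous_sinb [continuous_intros]: "continuous_on S (sinb l n)"
  unfolding sinb_def[abs_def] by (intro continuous_intros)

lemma continuous_cosb [continuous_intros]: "continuous_on S (cosb l n)"
  unfolding cosb_def[abs_def] by (intro continuous_intros)

lemma sinb_L2: "sinb l n \<in> L2 l" and cosb_L2: "cosb l n \<in> L2 l"
  by (intro L2_continuous continuous_intros)+

lemma abs_sinb_le: "\<bar>sinb l n x\<bar> \<le> \<bar>sqrt (2 / l)\<bar>"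
  using mult_left_mono[OF abs_sin_le_one[of "freq l n * x"], of "\<bar>sqrt (2 / l)\<bar>"]
  by (simp add: sinb_def abs_mult)

lemma abs_cosb_le: "\<bar>cosb l n x\<bar> \<le> \<bar>sqrt (2 / l)\<bar>"
  using mult_left_mono[OF abs_cos_le_one[of "freq l n * x"], of "\<bar>sqrt (2 / l)\<bar>"]
  by (simp add: cosb_def abs_mult)

lemma sinb_at_0: "sinb l n 0 = 0"
  by (simp add: sinb_def)

lemma sinb_at_l: "0 < l \<Longrightarrow> sinb l n l = 0"
  using sin_zero_iff_int2[of "freq l n * l"] freq_mult_l[of l n]
  by (auto simp: sinb_def intro!: exI[of _ "int n + 1"])

lemma sin_diff_freq_l:
  assumes "0 < l"
  shows "sin ((freq l i - freq l j) * l) = 0" "sin ((freq l i + freq l j) * l) = 0"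
proof -
  have "(freq l i - freq l j) * l = of_int (int i - int j) * pi"
    "(freq l i + freq l j) * l = of_int (int i + int j + 2) * pi"
    unfolding left_diff_distrib distrib_right freq_mult_l[OF assms] by (simp_all add: algebra_simps)
  then show "sin ((freq l i - freq l j) * l) = 0" "sin ((freq l i + freq l j) * l) = 0"
    unfolding sin_zero_iff_int2 by blast+
qed

lemma
  assumes l: "0 < l"
  shows ip_sinb_sinb: "ip l (sinb l i) (sinb l j) = (if i = j then 1 else 0)"
    and ip_cosb_cosb: "ip l (cosb l i) (cosb l j) = (if i = j then 1 else 0)"
proof -
  let ?a = "freq l i" and ?b = "freq l j"
  \<comment> \<open>An antiderivative of \<open>cos ((?a - ?b) * x)\<close>; for
    \<open>i = j\<close> the integrand is the constant 1.\<close>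
  let ?D = "\<lambda>x. if i = j then x else sin ((?a - ?b) * x) / (?a - ?b)"
  let ?S = "\<lambda>x. sin ((?a + ?b) * x) / (?a + ?b)"
  have ab: "?a + ?b \<noteq> 0" using freq_pos[OF l, of i] freq_pos[OF l, of j] by linarith
  have ne: "?a - ?b \<noteq> 0" if "i \<noteq> j" using that l by (simp add: freq_def)
  have D: "(?D has_real_derivative cos ((?a - ?b) * x)) (at x)" for x
    using ne by (cases "i = j") (auto intro!: derivative_eq_intros)
  have S: "(?S has_real_derivative cos ((?a + ?b) * x)) (at x)" for x
    using ab by (auto intro!: derivative_eq_intros)
  have cs: "continuous_on {0..l} (\<lambda>x. (cos ((?a - ?b) * x) - cos ((?a + ?b) * x)) / l)"
    "continuous_on {0..l} (\<lambda>x. (cos ((?a - ?b) * x) + cos ((?a + ?b) * x)) / l)"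
    using l by (auto intro!: continuous_intros)
  have "sinb l i x * sinb l j x = (cos ((?a - ?b) * x) - cos ((?a + ?b) * x)) / l"
    "cosb l i x * cosb l j x = (cos ((?a - ?b) * x) + cos ((?a + ?b) * x)) / l" for x
    using l by (simp_all add: sinb_def cosb_def left_diff_distrib distrib_right cos_diff cos_add field_simps)
  note products = this
  have "((\<lambda>x. (?D x - ?S x) / l) has_real_derivative
      (cos ((?a - ?b) * x) - cos ((?a + ?b) * x)) / l) (at x)"
    "((\<lambda>x. (?D x + ?S x) / l) has_real_derivative
      (cos ((?a - ?b) * x) + cos ((?a + ?b) * x)) / l) (at x)" for x
    by (intro DERIV_cdivide DERIV_diff DERIV_add D S)+
  then have "ip l (sinb l i) (sinb l j) = (?D l - ?S l) / l - (?D 0 - ?S 0) / l"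
    and "ip l (cosb l i) (cosb l j) = (?D l + ?S l) / l - (?D 0 + ?S 0) / l"
    unfolding ip_def products using l cs by (intro integral_leb_derivative; simp)+
  then show "ip l (sinb l i) (sinb l j) = (if i = j then 1 else 0)"
    "ip l (cosb l i) (cosb l j) = (if i = j then 1 else 0)"
    using l sin_diff_freq_l[OF l, of i j] by auto
qed

text \<open>By the product formulas, orthogonality to all sines extends to
  \<open>sin \<theta>\<close> times any power of \<open>cos \<theta>\<close>. Since
  \<open>cos\<close> is injective on the angles in question, every continuous \<open>h\<close> is a
  continuous function of \<open>cos \<theta>\<close>, to which Weierstrass approximation
  applies.\<close>

lemma integral_eq_0_if_ip_sinb_eq_0:
  assumes l: "0 < l" and f: "f \<in> L2 l" and zero: "\<And>n. ip l f (sinb l n) = 0"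
    and h: "continuous_on {0..l} h"
  shows "(LINT x|leb l. f x * sin (pi * x / l) * h x) = 0"
proof -
  let ?\<theta> = "\<lambda>x. pi * x / l"
  have bd: "integrable (leb l) (\<lambda>x. f x * g x)" if "continuous_on {0..l} g" for g
    using L2_mult_integrable[OF f L2_continuous[OF that]] .
  have sines: "(LINT x|leb l. f x * (sin ((real n + 1) * ?\<theta> x) * cos (?\<theta> x) ^ k)) = 0" for n k
  proof (induction k arbitrary: n)
    case 0
    have "ip l f (sinb l n) = (LINT x|leb l. sqrt (2 / l) * (f x * sin ((real n + 1) * ?\<theta> x)))"
      unfolding ip_def by (intro Bochner_Integration.integral_cong) (auto simp: sinb_def freq_def mult_ac)
    then show ?case using zero[of n] l by simp
  next
    case (Suc k)
    let ?u = "\<lambda>m x. f x * (sin (m * ?\<theta> x) * cos (?\<theta> x) ^ k)"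
    have int: "integrable (leb l) (?u m)" for m
      using l by (intro bd continuous_intros) auto
    \<comment> \<open>For \<open>n = 0\<close> the second integrand contains \<open>sin 0\<close>,
      so the truncated subtraction \<open>n - 1\<close> does no harm.\<close>
    have I: "(LINT x|leb l. ?u (real n + 2) x) = 0" "(LINT x|leb l. ?u (real n) x) = 0"
      using Suc.IH[of "Suc n"] Suc.IH[of "n - 1"] by (cases n; simp add: add_ac)+
    have "sin ((real n + 1) * ?\<theta> x) * cos (?\<theta> x)
        = sin ((real n + 2) * ?\<theta> x) / 2 + sin (real n * ?\<theta> x) / 2" for x
    proof -
      have "(real n + 2) * ?\<theta> x = (real n + 1) * ?\<theta> x + ?\<theta> x"
        "real n * ?\<theta> x = (real n + 1) * ?\<theta> x - ?\<theta> x"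
        using l by (simp_all add: field_simps)
      then show ?thesis by (simp only: sin_add sin_diff) (simp add: field_simps)
    qed
    then have "f x * (sin ((real n + 1) * ?\<theta> x) * cos (?\<theta> x) ^ Suc k)
        = ?u (real n + 2) x / 2 + ?u (real n) x / 2" for x
      by (simp only: power_Suc mult.assoc[symmetric]) (simp add: algebra_simps)
    then have "(LINT x|leb l. f x * (sin ((real n + 1) * ?\<theta> x) * cos (?\<theta> x) ^ Suc k))
        = (LINT x|leb l. ?u (real n + 2) x / 2 + ?u (real n) x / 2)" by simp
    also have "\<dots> = 0"
      using I int by (subst Bochner_Integration.integral_add) auto
    finally show ?case .
  qed
  let ?F = "\<lambda>x. f x * sin (?\<theta> x)"
  have Fint: "integrable (leb l) ?F" using l by (intro bd continuous_intros) auto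
  have polys: "(LINT x|leb l. ?F x * p (cos (?\<theta> x))) = 0" if p0: "real_polynomial_function p" for p
  proof -
    obtain a n where p: "p = (\<lambda>x. \<Sum>i\<le>n. a i * x ^ i)"
      using p0 unfolding real_polynomial_function_iff_sum by blast
    have int: "integrable (leb l) (\<lambda>x. f x * (sin (?\<theta> x) * cos (?\<theta> x) ^ i))" for i
      using l by (intro bd continuous_intros) auto
    have "(LINT x|leb l. ?F x * p (cos (?\<theta> x)))
        = (LINT x|leb l. (\<Sum>i\<le>n. a i * (f x * (sin (?\<theta> x) * cos (?\<theta> x) ^ i))))"
      by (simp add: p sum_distrib_left mult_ac)
    also have "\<dots> = (\<Sum>i\<le>n. a i * (LINT x|leb l. f x * (sin (?\<theta> x) * cos (?\<theta> x) ^ i)))"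
      using int by (subst Bochner_Integration.integral_sum) auto
    also have "\<dots> = 0" using sines[of 0] by simp
    finally show ?thesis .
  qed
  have le: "\<bar>LINT x|leb l. ?F x * h x\<bar> \<le> e * (LINT x|leb l. \<bar>?F x\<bar>)" if "0 < e" for e
  proof -
    define g where "g y = h (l / pi * arccos y)" for y
    have "continuous_on {-1..1} g"
      unfolding g_def
    proof (rule continuous_on_compose2[OF h])
      show "continuous_on {-1..1} (\<lambda>y. l / pi * arccos y)"
        by (intro continuous_intros) auto
      show "(\<lambda>y. l / pi * arccos y) ` {-1..1} \<subseteq> {0..l}"
        using l arccos_lbound arccos_ubound by (auto simp: field_simps)
    qed
    then obtain p where p: "real_polynomial_function p" "\<And>y. y \<in> {-1..1} \<Longrightarrow> \<bar>g y - p y\<bar> < e"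
      using Stone_Weierstrass_real_polynomial_function[of "{-1..1}" g e] \<open>0 < e\<close> by auto
    have near: "\<bar>h x - p (cos (?\<theta> x))\<bar> \<le> e" if "x \<in> {0<..<l}" for x
    proof -
      have "0 \<le> ?\<theta> x" "?\<theta> x \<le> pi" using that l by (auto simp: field_simps)
      then have "g (cos (?\<theta> x)) = h x"
        using l by (simp add: g_def arccos_cos)
      then show ?thesis using p(2)[of "cos (?\<theta> x)"] by simp
    qed
    have pc: "continuous_on {0..l} (\<lambda>x. p (cos (?\<theta> x)))"
    proof (rule continuous_on_compose2[of UNIV p])
      show "continuous_on UNIV p"
        using p(1) by (simp add: continuous_on_polymonial_function real_polynomial_function_eq)
      show "continuous_on {0..l} (\<lambda>x. cos (?\<theta> x))"
        using l by (intro continuous_intros) auto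
    qed simp
    have i1: "integrable (leb l) (\<lambda>x. ?F x * h x)" "integrable (leb l) (\<lambda>x. ?F x * p (cos (?\<theta> x)))"
      unfolding mult.assoc using l h pc by (auto intro!: bd continuous_intros)
    have "(LINT x|leb l. ?F x * h x) = (LINT x|leb l. ?F x * h x) - (LINT x|leb l. ?F x * p (cos (?\<theta> x)))"
      by (simp add: polys[OF p(1)])
    also have "\<dots> = (LINT x|leb l. ?F x * (h x - p (cos (?\<theta> x))))"
      using i1 by (simp add: right_diff_distrib)
    finally have "\<bar>LINT x|leb l. ?F x * h x\<bar> \<le> (LINT x|leb l. \<bar>?F x * (h x - p (cos (?\<theta> x)))\<bar>)"
      using integral_abs_bound by simp
    also have "\<dots> \<le> (LINT x|leb l. e * \<bar>?F x\<bar>)"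
    proof (rule Bochner_Integration.integral_mono)
      show "integrable (leb l) (\<lambda>x. \<bar>?F x * (h x - p (cos (?\<theta> x)))\<bar>)"
        unfolding right_diff_distrib
        by (intro Bochner_Integration.integrable_abs Bochner_Integration.integrable_diff i1)
      show "integrable (leb l) (\<lambda>x. e * \<bar>?F x\<bar>)" using Fint by simp
      fix x assume "x \<in> space (leb l)"
      then have "\<bar>h x - p (cos (?\<theta> x))\<bar> \<le> e" by (intro near) simp
      then have "\<bar>?F x\<bar> * \<bar>h x - p (cos (?\<theta> x))\<bar> \<le> \<bar>?F x\<bar> * e" by (intro mult_left_mono) auto
      then show "\<bar>?F x * (h x - p (cos (?\<theta> x)))\<bar> \<le> e * \<bar>?F x\<bar>"
        unfolding abs_mult[of "?F x" "h x - p (cos (?\<theta> x))"] by (simp add: mult.commute)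
    qed
    finally show ?thesis by simp
  qed
  show ?thesis
  proof (rule ccontr)
    assume ne: "(LINT x|leb l. ?F x * h x) \<noteq> 0"
    let ?I = "LINT x|leb l. \<bar>?F x\<bar>"
    have I: "0 \<le> ?I" by simp
    \<comment> \<open>Chosen so that the estimate bounds the integral by half of itself; the summand
      1 guards against a zero divisor.\<close>
    define e where "e = \<bar>LINT x|leb l. ?F x * h x\<bar> / (2 * (?I + 1))"
    have I1: "0 < ?I + 1" using I by linarith
    have "0 < e" unfolding e_def using ne I1 by (intro divide_pos_pos mult_pos_pos) simp_all
    have "\<bar>LINT x|leb l. ?F x * h x\<bar> \<le> e * ?I" by (rule le[OF \<open>0 < e\<close>])
    also have "\<dots> \<le> e * (?I + 1)" using \<open>0 < e\<close> by simp
    also have "\<dots> = \<bar>LINT x|leb l. ?F x * h x\<bar> / 2" using I1 unfolding e_def by (simp add: field_simps del: Bochner_Integration.integral_add)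
    finally show False using ne by simp
  qed
qed

text \<open>Testing with continuous approximations of the sign of \<open>?F\<close> gives that the
  integral of \<open>\<bar>?F\<bar>\<close> is zero; the weight \<open>sin (pi * x / l)\<close> is
  positive inside the interval, so \<open>f\<close> itself vanishes.\<close>

lemma sinb_complete:
  assumes l: "0 < l" and f: "f \<in> L2 l" and zero: "\<And>n. ip l f (sinb l n) = 0"
  shows "AE x in leb l. f x = 0"
proof -
  let ?F = "\<lambda>x. f x * sin (pi * x / l)"
  have Fint: "integrable (leb l) ?F"
    using l by (intro L2_mult_integrable[OF f L2_continuous] continuous_intros) auto
  have "(\<lambda>x. sgn (?F x)) \<in> borel_measurable (leb l)"
    using borel_measurable_integrable[OF Fint] by measurable
  then have "(\<lambda>x. sgn (?F x)) measurable_on {0<..<l}"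
    by (simp add: measurable_on_iff_borel_measurable)
  then obtain N g where N: "negligible N" and g: "\<And>n. continuous_on UNIV (g n)"
    "\<And>x. x \<notin> N \<Longrightarrow> (\<lambda>n. g n x) \<longlonglongrightarrow> (if x \<in> {0<..<l} then sgn (?F x) else 0)"
    unfolding measurable_on_def by blast
  \<comment> \<open>Clipping to \<open>[-1, 1]\<close> keeps the limit and supplies the dominating
    function.\<close>
  define c where "c n x = max (-1) (min 1 (g n x))" for n x
  have c_cont: "continuous_on S (c n)" for S n
    unfolding c_def by (intro continuous_intros continuous_on_subset[OF g(1)]) auto
  have "AE x in lebesgue. x \<notin> N"
    using N by (intro AE_not_in) (simp add: negligible_iff_null_sets)
  then have AE_N: "AE x in leb l. x \<notin> N"
    by (auto simp: AE_restrict_space_iff elim: eventually_mono)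
  have "AE x in leb l. (\<lambda>n. ?F x * c n x) \<longlonglongrightarrow> \<bar>?F x\<bar>"
    using AE_N AE_space
  proof eventually_elim
    case (elim x)
    then have "(\<lambda>n. c n x) \<longlonglongrightarrow> max (-1) (min 1 (sgn (?F x)))"
      unfolding c_def using g(2)[of x] by (intro tendsto_intros) auto
    then have "(\<lambda>n. ?F x * c n x) \<longlonglongrightarrow> ?F x * max (-1) (min 1 (sgn (?F x)))"
      by (rule tendsto_mult_left)
    also have "?F x * max (-1) (min 1 (sgn (?F x))) = \<bar>?F x\<bar>"
      by (auto simp: sgn_if abs_if)
    finally show ?case .
  qed
  then have "(\<lambda>n. LINT x|leb l. ?F x * c n x) \<longlonglongrightarrow> (LINT x|leb l. \<bar>?F x\<bar>)"
  proof (rule integral_dominated_convergence[rotated 3, where w = "\<lambda>x. \<bar>?F x\<bar>"])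
    have "\<bar>a * max (-1) (min 1 y)\<bar> \<le> \<bar>a\<bar>" for a y :: real
      unfolding abs_mult by (rule mult_left_le) auto
    then show "AE x in leb l. norm (?F x * c n x) \<le> \<bar>?F x\<bar>" for n
      unfolding c_def by simp
    show "(\<lambda>x. ?F x * c n x) \<in> borel_measurable (leb l)" for n
    proof -
      have "continuous_on {0..l} (\<lambda>x. sin (pi * x / l) * c n x)"
        using l by (intro continuous_intros c_cont) auto
      from borel_measurable_integrable[OF L2_mult_integrable[OF f L2_continuous[OF this]]]
      show ?thesis by (simp add: mult.assoc)
    qed
  qed (use Fint in auto)
  moreover have "(LINT x|leb l. ?F x * c n x) = 0" for n
    by (rule integral_eq_0_if_ip_sinb_eq_0[OF l f zero c_cont])
  ultimately have "(LINT x|leb l. \<bar>?F x\<bar>) = 0"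
    by (simp add: LIMSEQ_const_iff)
  then have "AE x in leb l. \<bar>?F x\<bar> = 0"
    using Fint by (subst (asm) integral_nonneg_eq_0_iff_AE) auto
  then show ?thesis
    using AE_space
  proof eventually_elim
    case (elim x)
    have "0 < sin (pi * x / l)"
      using elim(2) l by (intro sin_gt_zero) (auto simp: field_simps)
    then show ?case using elim(1) by simp
  qed
qed

section \<open>Sine coefficients\<close>

lemma L2norm_cong_AE:
  assumes "f \<in> L2 l" "g \<in> L2 l" "eq_ae l f g"
  shows "L2norm l f = L2norm l g"
proof -
  have "ip l f f = ip l g g"
    using ip_cong_AE[OF assms(1,2) assms(1) assms(3)] ip_cong_AE[OF assms(1,2) assms(2) assms(3)]
    by (simp add: ip_commute[of l f g])
  then show ?thesis
    by (metis L2norm_nonneg L2norm_squared power2_eq_iff_nonneg)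
qed

lemma L2norm_scaleR: "L2norm l (r *\<^sub>R f) = \<bar>r\<bar> * L2norm l f"
  by (simp add: L2norm_def scaleR_fun_def power_mult_distrib real_sqrt_mult)

text \<open>\<open>Abs_ell2\<close> is the true inverse only on square-summable sequences; for
  \<open>f\<close> in \<open>L2 l\<close> and \<open>l\<close> positive this is Bessel's
  inequality.\<close>

definition sc :: "real \<Rightarrow> (real \<Rightarrow> real) \<Rightarrow> ell2" where
  "sc l f = Abs_ell2 (\<lambda>n. ip l f (sinb l n))"

definition syn :: "real \<Rightarrow> ell2 \<Rightarrow> real \<Rightarrow> real" where
  "syn l a = (SOME f. f \<in> L2 l \<and>
     (\<lambda>N. L2norm l (f - (\<Sum>i<N. ell2_nth a i *\<^sub>R sinb l i))) \<longlonglongrightarrow> 0)"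

lemma Bessel_sinb:
  assumes "0 < l" "f \<in> L2 l"
  shows "(\<Sum>i<N. (ip l f (sinb l i))\<^sup>2) \<le> (L2norm l f)\<^sup>2"
proof -
  let ?c = "\<lambda>i. ip l f (sinb l i)" and ?S = "\<Sum>i<N. ip l f (sinb l i) *\<^sub>R sinb l i"
  let ?q = "\<Sum>i<N. (ip l f (sinb l i))\<^sup>2"
  have S: "?S \<in> L2 l" by (intro L2_sum L2_scaleR sinb_L2)
  have "ip l ?S f = ?q"
    by (subst ip_sum_left)
      (auto simp: ip_scaleR_left L2_scaleR sinb_L2 assms ip_commute[of l _ f] power2_eq_square)
  moreover have "ip l ?S ?S = ?q"
    using L2norm_squared_orthonormal_sum[OF sinb_L2 ip_sinb_sinb[OF assms(1)], of "{..<N}" ?c]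
    by (simp add: L2norm_squared)
  moreover have "0 \<le> ip l (f - ?S) (f - ?S)"
    by (simp flip: L2norm_squared)
  moreover have "ip l (f - ?S) (f - ?S) = ip l f (f - ?S) - ip l ?S (f - ?S)"
    by (rule ip_diff_left[OF assms(2) S L2_diff[OF assms(2) S]])
  moreover have "ip l f (f - ?S) = ip l f f - ip l ?S f"
    using ip_diff_left[OF assms(2) S assms(2)] by (simp add: ip_commute[of l f "f - ?S"])
  moreover have "ip l ?S (f - ?S) = ip l ?S f - ip l ?S ?S"
    using ip_diff_left[OF assms(2) S S] by (simp add: ip_commute[of l ?S "f - ?S"] ip_commute[of l f ?S])
  ultimately show ?thesis by (simp only: L2norm_squared)
qed

lemma ell2_nth_sc:
  assumes "0 < l" "f \<in> L2 l"
  shows "ell2_nth (sc l f) n = ip l f (sinb l n)"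
proof -
  have "summable (\<lambda>i. (ip l f (sinb l i))\<^sup>2)"
    by (rule ell2_summableI_bounded[OF Bessel_sinb[OF assms]])
  then show ?thesis by (simp add: sc_def Abs_ell2_inverse)
qed

lemma syn:
  assumes "0 < l"
  shows "syn l a \<in> L2 l"
    and "(\<lambda>N. L2norm l (syn l a - (\<Sum>i<N. ell2_nth a i *\<^sub>R sinb l i))) \<longlonglongrightarrow> 0"
proof -
  have "\<exists>f. f \<in> L2 l \<and> (\<lambda>N. L2norm l (f - (\<Sum>i<N. ell2_nth a i *\<^sub>R sinb l i))) \<longlonglongrightarrow> 0"
    by (rule Riesz_Fischer[of l "sinb l" "ell2_nth a"])
      (use assms in \<open>auto simp: sinb_L2 ip_sinb_sinb\<close>)
  from someI_ex[OF this]
  show "syn l a \<in> L2 l"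
    and "(\<lambda>N. L2norm l (syn l a - (\<Sum>i<N. ell2_nth a i *\<^sub>R sinb l i))) \<longlonglongrightarrow> 0"
    by (auto simp: syn_def)
qed

lemma ip_sinb_limit:
  assumes l: "0 < l" and f: "f \<in> L2 l"
    and lim: "(\<lambda>N. L2norm l (f - (\<Sum>i<N. a i *\<^sub>R sinb l i))) \<longlonglongrightarrow> 0"
  shows "ip l f (sinb l n) = a n"
proof -
  let ?S = "\<lambda>N. \<Sum>i<N. a i *\<^sub>R sinb l i"
  have "(\<lambda>N. ip l (?S N) (sinb l n)) \<longlonglongrightarrow> ip l f (sinb l n)"
    by (rule tendsto_ip[OF _ f sinb_L2 lim]) (intro L2_sum L2_scaleR sinb_L2)
  moreover have ip_S: "ip l (?S N) (sinb l n) = (\<Sum>i<N. a i * (if i = n then 1 else 0))" for N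
    by (subst ip_sum_left) (auto simp: L2_scaleR sinb_L2 ip_scaleR_left ip_sinb_sinb[OF l])
  have "\<forall>\<^sub>F N in sequentially. ip l (?S N) (sinb l n) = a n"
    using eventually_gt_at_top[of n]
    by eventually_elim (simp add: ip_S if_distrib[of "(*) _"] cong: if_cong)
  then have "(\<lambda>N. ip l (?S N) (sinb l n)) \<longlonglongrightarrow> a n"
    by (rule tendsto_eventually)
  ultimately show ?thesis by (rule LIMSEQ_unique)
qed

lemma sc_syn: "0 < l \<Longrightarrow> sc l (syn l a) = a"
  by (rule ell2_eqI) (simp add: ell2_nth_sc syn ip_sinb_limit[OF _ syn])

lemma sc_eq_imp_eq_ae:
  assumes "0 < l" "f \<in> L2 l" "g \<in> L2 l" "sc l f = sc l g"
  shows "eq_ae l f g"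
proof -
  have "ip l (f - g) (sinb l n) = 0" for n
    using assms ell2_nth_sc[of l f n] ell2_nth_sc[of l g n]
    by (simp add: ip_diff_left sinb_L2)
  then have "AE x in leb l. (f - g) x = 0"
    using assms by (intro sinb_complete L2_diff)
  then show ?thesis by (simp add: eq_ae_def)
qed

lemma eq_ae_imp_sc_eq:
  assumes "0 < l" "f \<in> L2 l" "g \<in> L2 l" "eq_ae l f g"
  shows "sc l f = sc l g"
  by (rule ell2_eqI) (simp add: ell2_nth_sc assms ip_cong_AE[OF assms(2,3) sinb_L2 assms(4)])

text \<open>Parseval's identity: by completeness \<open>f\<close> equals the sum of its sine series
  almost everywhere, and the norms of the partial sums are known from orthonormality.\<close>

lemma norm_sc:
  assumes l: "0 < l" and f: "f \<in> L2 l"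
  shows "norm (sc l f) = L2norm l f"
proof -
  let ?a = "sc l f"
  let ?g = "syn l ?a" and ?S = "\<lambda>N. \<Sum>i<N. ell2_nth (sc l f) i *\<^sub>R sinb l i"
  have S: "?S N \<in> L2 l" for N by (intro L2_sum L2_scaleR sinb_L2)
  have g: "?g \<in> L2 l" by (rule syn(1)[OF l])
  have "eq_ae l f ?g"
    using sc_syn[OF l] by (intro sc_eq_imp_eq_ae l f g) simp
  then have fg: "L2norm l f = L2norm l ?g" by (rule L2norm_cong_AE[OF f g])
  have "norm (L2norm l (?S N) - L2norm l ?g) \<le> L2norm l (?g - ?S N)" for N
    using L2norm_triangle[OF S[of N] L2_diff[OF g S[of N]]]
      L2norm_triangle[OF g L2_diff[OF S[of N] g]] L2norm_commute[of l ?g "?S N"]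
    by (simp add: abs_le_iff)
  then have "(\<lambda>N. L2norm l (?S N) - L2norm l ?g) \<longlonglongrightarrow> 0"
    by (intro Lim_null_comparison[OF always_eventually syn(2)[OF l, of ?a]]) blast
  then have "(\<lambda>N. (L2norm l (?S N))\<^sup>2) \<longlonglongrightarrow> (L2norm l ?g)\<^sup>2"
    by (rule tendsto_power[OF LIM_zero_cancel])
  moreover have "(L2norm l (?S N))\<^sup>2 = (\<Sum>i<N. (ell2_nth ?a i)\<^sup>2)" for N
    by (rule L2norm_squared_orthonormal_sum[OF sinb_L2 ip_sinb_sinb[OF l]]) simp
  ultimately have "(\<lambda>i. (ell2_nth ?a i)\<^sup>2) sums (L2norm l ?g)\<^sup>2"
    by (simp add: sums_def)
  then have "(norm ?a)\<^sup>2 = (L2norm l f)\<^sup>2"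
    unfolding norm_ell2_squared fg by (simp add: sums_iff)
  then show ?thesis
    by (simp add: L2norm_nonneg)
qed

lemma sc_add: "0 < l \<Longrightarrow> f \<in> L2 l \<Longrightarrow> g \<in> L2 l \<Longrightarrow> sc l (f + g) = sc l f + sc l g"
  by (rule ell2_eqI) (simp add: ell2_nth_sc L2_add ip_add_left sinb_L2)

lemma sc_diff: "0 < l \<Longrightarrow> f \<in> L2 l \<Longrightarrow> g \<in> L2 l \<Longrightarrow> sc l (f - g) = sc l f - sc l g"
  by (rule ell2_eqI) (simp add: ell2_nth_sc L2_diff ip_diff_left sinb_L2)

lemma sc_scaleR: "0 < l \<Longrightarrow> f \<in> L2 l \<Longrightarrow> sc l (r *\<^sub>R f) = r *\<^sub>R sc l f"
  by (rule ell2_eqI) (simp add: ell2_nth_sc L2_scaleR ip_scaleR_left)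

lemma sc_uminus: "0 < l \<Longrightarrow> f \<in> L2 l \<Longrightarrow> sc l (- f) = - sc l f"
  by (rule ell2_eqI) (simp add: ell2_nth_sc L2_uminus ip_uminus_left)

lemma sc_zero: "0 < l \<Longrightarrow> sc l 0 = 0"
  by (rule ell2_eqI) (simp add: ell2_nth_sc L2_zero ip_zero_left)

section \<open>Continuous representatives\<close>

definition inv_freq2 :: "real \<Rightarrow> ell2" where
  "inv_freq2 l = Abs_ell2 (\<lambda>n. 1 / (freq l n)\<^sup>2)"

lemma ell2_nth_inv_freq2:
  assumes "0 < l"
  shows "ell2_nth (inv_freq2 l) n = 1 / (freq l n)\<^sup>2"
proof -
  have "summable (\<lambda>n. (1 / (freq l n)\<^sup>2)\<^sup>2)"
  proof (rule summable_comparison_test')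
    show "summable (\<lambda>n. (l / pi) ^ 4 * (1 / real (Suc n) ^ 2))"
    proof (rule summable_mult)
      have "summable (\<lambda>n. inverse (real (Suc n) ^ 2))"
        using inverse_power_summable[of 2, where ?'a = real] by (subst summable_Suc_iff) simp
      then show "summable (\<lambda>n. 1 / real (Suc n) ^ 2)" by (simp add: inverse_eq_divide)
    qed
    fix n :: nat
    have "1 * real (Suc n) ^ 2 \<le> real (Suc n) ^ 2 * real (Suc n) ^ 2"
      by (intro mult_right_mono) (auto simp: one_le_power)
    then have "1 / (real (Suc n) ^ 2 * real (Suc n) ^ 2) \<le> 1 / real (Suc n) ^ 2"
      by (intro divide_left_mono mult_pos_pos) auto
    then have "(l / pi) ^ 4 * (1 / (real (Suc n) ^ 2 * real (Suc n) ^ 2)) \<le> (l / pi) ^ 4 * (1 / real (Suc n) ^ 2)"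
      by (intro mult_left_mono) auto
    moreover have "(1 / (freq l n)\<^sup>2)\<^sup>2 = (l / pi) ^ 4 * (1 / (real (Suc n) ^ 2 * real (Suc n) ^ 2))"
      using assms by (simp add: freq_def field_simps power2_eq_square eval_nat_numeral)
    ultimately show "norm ((1 / (freq l n)\<^sup>2)\<^sup>2) \<le> (l / pi) ^ 4 * (1 / real (Suc n) ^ 2)"
      by simp
  qed
  then show ?thesis by (simp add: inv_freq2_def Abs_ell2_inverse)
qed

text \<open>\<open>sser l a\<close> is the continuous function with second derivative \<open>- syn l a\<close> that vanishes at both ends.\<close>

definition sser :: "real \<Rightarrow> ell2 \<Rightarrow> real \<Rightarrow> real" where
  "sser l a x = (\<Sum>n. ell2_nth a n / (freq l n)\<^sup>2 * sinb l n x)"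

text \<open>A constant for the embedding of \<open>H2\<close> with zero boundary values into the
  continuous functions, relative to the norm of the second derivative.\<close>

definition sser_bound :: "real \<Rightarrow> real" where
  "sser_bound l = \<bar>sqrt (2 / l)\<bar> * norm (inv_freq2 l)"

lemma summable_sser_coeff:
  assumes "0 < l"
  shows "summable (\<lambda>n. \<bar>ell2_nth a n / (freq l n)\<^sup>2\<bar>)"
    and "(\<Sum>n. \<bar>ell2_nth a n / (freq l n)\<^sup>2\<bar>) \<le> norm a * norm (inv_freq2 l)"
proof -
  \<comment> \<open>The absolute values are packed into a sequence of their own, so that
    Cauchy-Schwarz in \<open>ell2\<close> bounds the absolute series.\<close>
  have "(\<lambda>n. \<bar>ell2_nth a n\<bar>) \<in> {a. summable (\<lambda>n. (a n)\<^sup>2)}" by simp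
  then have b: "ell2_nth (Abs_ell2 (\<lambda>n. \<bar>ell2_nth a n\<bar>)) = (\<lambda>n. \<bar>ell2_nth a n\<bar>)"
    by (rule Abs_ell2_inverse)
  let ?b = "Abs_ell2 (\<lambda>n. \<bar>ell2_nth a n\<bar>)"
  have eq: "\<bar>ell2_nth a n / (freq l n)\<^sup>2\<bar> = ell2_nth ?b n * ell2_nth (inv_freq2 l) n" for n
    by (simp add: b ell2_nth_inv_freq2[OF assms])
  show "summable (\<lambda>n. \<bar>ell2_nth a n / (freq l n)\<^sup>2\<bar>)"
    unfolding eq by simp
  have "(\<Sum>n. \<bar>ell2_nth a n / (freq l n)\<^sup>2\<bar>) = ?b \<bullet> inv_freq2 l"
    unfolding eq inner_ell2_def ..
  also have "\<dots> \<le> norm ?b * norm (inv_freq2 l)" by (rule norm_cauchy_schwarz)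
  also have "norm ?b = norm a"
    unfolding norm_eq_sqrt_inner inner_ell2_def by (simp add: b)
  finally show "(\<Sum>n. \<bar>ell2_nth a n / (freq l n)\<^sup>2\<bar>) \<le> norm a * norm (inv_freq2 l)" .
qed

lemma sser_term_le:
  "norm (ell2_nth a n / (freq l n)\<^sup>2 * sinb l n x) \<le> \<bar>ell2_nth a n / (freq l n)\<^sup>2\<bar> * \<bar>sqrt (2 / l)\<bar>"
  using abs_sinb_le[of l n x] by (simp only: real_norm_def abs_mult) (intro mult_left_mono, auto)

lemma summable_sser:
  assumes "0 < l"
  shows "summable (\<lambda>n. ell2_nth a n / (freq l n)\<^sup>2 * sinb l n x)"
  by (rule summable_comparison_test'[OF summable_mult2[OF summable_sser_coeff(1)[OF assms]] sser_term_le])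

lemma sser_uniform_limit:
  assumes "0 < l"
  shows "uniform_limit UNIV (\<lambda>N x. \<Sum>n<N. ell2_nth a n / (freq l n)\<^sup>2 * sinb l n x) (sser l a) sequentially"
  unfolding sser_def[abs_def]
  by (rule Weierstrass_m_test[OF sser_term_le summable_mult2[OF summable_sser_coeff(1)[OF assms]]])

lemma continuous_sser:
  assumes "0 < l"
  shows "continuous_on S (sser l a)"
proof -
  have "continuous_on UNIV (sser l a)"
    by (rule uniform_limit_theorem[OF _ sser_uniform_limit[OF assms]])
       (intro always_eventually allI continuous_on_sum continuous_on_mult continuous_on_const
          continuous_sinb, simp)
  then show ?thesis by (rule continuous_on_subset) simp
qed

lemma sser_L2: "0 < l \<Longrightarrow> sser l a \<in> L2 l"
  by (intro L2_continuous continuous_sser)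

lemma sser_at_ends: "0 < l \<Longrightarrow> sser l a 0 = 0" "0 < l \<Longrightarrow> sser l a l = 0"
  by (simp_all add: sser_def sinb_at_0 sinb_at_l)

lemma abs_sser_le:
  assumes "0 < l"
  shows "\<bar>sser l a x\<bar> \<le> sser_bound l * norm a"
proof -
  have "\<bar>sser l a x\<bar> \<le> (\<Sum>n. \<bar>ell2_nth a n / (freq l n)\<^sup>2\<bar> * \<bar>sqrt (2 / l)\<bar>)"
    unfolding sser_def using norm_suminf_le[OF sser_term_le summable_mult2[OF summable_sser_coeff(1)[OF assms]]]
    by simp
  also have "\<dots> = (\<Sum>n. \<bar>ell2_nth a n / (freq l n)\<^sup>2\<bar>) * \<bar>sqrt (2 / l)\<bar>"
    by (rule suminf_mult2[symmetric, OF summable_sser_coeff(1)[OF assms]])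
  also have "\<dots> \<le> (norm a * norm (inv_freq2 l)) * \<bar>sqrt (2 / l)\<bar>"
    by (intro mult_right_mono summable_sser_coeff assms) simp
  finally show ?thesis by (simp add: sser_bound_def mult_ac)
qed

lemma sser_add: "0 < l \<Longrightarrow> sser l (a + b) x = sser l a x + sser l b x"
  unfolding sser_def using suminf_add[OF summable_sser[of l a x] summable_sser[of l b x]]
  by (simp add: add_divide_distrib distrib_right)

lemma sser_scaleR: "0 < l \<Longrightarrow> sser l (r *\<^sub>R a) x = r * sser l a x"
  unfolding sser_def using suminf_mult[OF summable_sser[of l a x], of r]
  by (simp add: mult.assoc)

lemma sser_diff: "0 < l \<Longrightarrow> sser l (a - b) x = sser l a x - sser l b x"
  using sser_add[of l a "- b" x] sser_scaleR[of l "-1" b x] by simp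

lemma sser_L2norm_limit:
  assumes l: "0 < l"
  shows "(\<lambda>N. L2norm l (sser l a - (\<Sum>i<N. (ell2_nth a i / (freq l i)\<^sup>2) *\<^sub>R sinb l i))) \<longlonglongrightarrow> 0"
proof (rule LIMSEQ_I)
  fix r :: real assume "0 < r"
  let ?S = "\<lambda>N. \<Sum>i<N. (ell2_nth a i / (freq l i)\<^sup>2) *\<^sub>R sinb l i"
  have S: "?S N \<in> L2 l" for N by (intro L2_sum L2_scaleR sinb_L2)
  have S_x: "?S N x = (\<Sum>n<N. ell2_nth a n / (freq l n)\<^sup>2 * sinb l n x)" for N x
    by (induction N) (auto simp: scaleR_fun_def)
  define e where "e = r / (2 * sqrt l)"
  have "0 < e" using l \<open>0 < r\<close> by (simp add: e_def)
  then obtain M where M: "\<And>N x. N \<ge> M \<Longrightarrow> dist (\<Sum>n<N. ell2_nth a n / (freq l n)\<^sup>2 * sinb l n x) (sser l a x) < e"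
    using uniform_limitD[OF sser_uniform_limit[OF l]] unfolding eventually_sequentially by blast
  have "norm (L2norm l (sser l a - ?S N) - 0) < r" if "N \<ge> M" for N
  proof -
    have "L2norm l (sser l a - ?S N) \<le> e * sqrt l"
    proof (rule L2_bounded(2))
      show "sser l a - ?S N \<in> borel_measurable (leb l)"
        by (intro L2_measurable L2_diff sser_L2 S l)
      have "\<bar>(sser l a - ?S N) x\<bar> \<le> e" for x
        using M[OF that, of x] unfolding S_x[symmetric] dist_real_def
        by (simp add: abs_minus_commute)
      then show "AE x in leb l. \<bar>(sser l a - ?S N) x\<bar> \<le> e" by blast
    qed (use l \<open>0 < e\<close> in auto)
    also have "\<dots> = r / 2" using l by (simp add: e_def)
    finally show ?thesis using \<open>0 < r\<close> L2norm_nonneg[of l "sser l a - ?S N"] by simp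
  qed
  then show "\<exists>no. \<forall>N\<ge>no. norm (L2norm l (sser l a - ?S N) - 0) < r" by blast
qed

lemma ell2_nth_sc_sser: "0 < l \<Longrightarrow> ell2_nth (sc l (sser l a)) n = ell2_nth a n / (freq l n)\<^sup>2"
  by (simp add: ell2_nth_sc sser_L2 ip_sinb_limit[OF _ sser_L2 sser_L2norm_limit])

section \<open>Weak derivatives and test functions\<close>

lemma C1c_derivative:
  assumes "\<phi> \<in> C1c l"
  shows "(\<phi> has_real_derivative deriv \<phi> x) (at x)" "continuous_on S (deriv \<phi>)"
proof -
  obtain D where D: "\<And>x. (\<phi> has_vector_derivative D x) (at x)" "continuous_on UNIV D"
    using assms by (auto simp: C1c_def C1_differentiable_on_def)
  then have D': "(\<phi> has_real_derivative D x) (at x)" for x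
    by (simp add: has_real_derivative_iff_has_vector_derivative)
  then have "deriv \<phi> = D" by (auto intro: DERIV_imp_deriv)
  with D D' show "(\<phi> has_real_derivative deriv \<phi> x) (at x)" "continuous_on S (deriv \<phi>)"
    by (auto intro: continuous_on_subset)
qed

lemma C1c_continuous: "\<phi> \<in> C1c l \<Longrightarrow> continuous_on S \<phi>"
  using C1c_derivative(1) by (meson DERIV_isCont continuous_at_imp_continuous_on)

lemma zero_off_support: "x \<notin> closure {x. \<phi> x \<noteq> 0} \<Longrightarrow> \<phi> x = 0"
  using closure_subset[of "{x. \<phi> x \<noteq> 0}"] by blast

lemma C1c_at_ends:
  assumes "\<phi> \<in> C1c l"
  shows "\<phi> 0 = 0" "\<phi> l = 0"
proof -
  have "closure {x. \<phi> x \<noteq> 0} \<subseteq> {0<..<l}" using assms by (simp add: C1c_def)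
  moreover have "0 \<notin> {0<..<l}" "l \<notin> {0<..<l}" by simp_all
  ultimately show "\<phi> 0 = 0" "\<phi> l = 0" using zero_off_support by blast+
qed

lemma C1c_L2: "\<phi> \<in> C1c l \<Longrightarrow> \<phi> \<in> L2 l" and C1c_deriv_L2: "\<phi> \<in> C1c l \<Longrightarrow> deriv \<phi> \<in> L2 l"
  by (intro L2_continuous C1c_continuous C1c_derivative; assumption)+

lemma C1cI:
  assumes "\<And>x. (\<phi> has_real_derivative D x) (at x)" "continuous_on UNIV D"
    and "closed K" "K \<subseteq> {0<..<l}" "\<And>x. x \<notin> K \<Longrightarrow> \<phi> x = 0"
  shows "\<phi> \<in> C1c l" "deriv \<phi> = D"
proof -
  have "closure {x. \<phi> x \<noteq> 0} \<subseteq> K"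
    using assms(3,5) by (intro closure_minimal) auto
  then show "\<phi> \<in> C1c l"
    using assms(1,2,4)
    by (auto simp: C1c_def C1_differentiable_on_def has_real_derivative_iff_has_vector_derivative)
  show "deriv \<phi> = D" using assms(1) by (auto intro: DERIV_imp_deriv)
qed

lemma C1c_add:
  assumes "\<phi> \<in> C1c l" "\<psi> \<in> C1c l"
  shows "\<phi> + \<psi> \<in> C1c l" "deriv (\<phi> + \<psi>) = deriv \<phi> + deriv \<psi>"
proof -
  let ?K = "closure {x. \<phi> x \<noteq> 0} \<union> closure {x. \<psi> x \<noteq> 0}"
  have D: "(\<phi> + \<psi> has_real_derivative (deriv \<phi> + deriv \<psi>) x) (at x)" for x
    unfolding plus_fun_def by (intro DERIV_add C1c_derivative(1)[OF assms(1)] C1c_derivative(1)[OF assms(2)])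
  have c: "continuous_on UNIV (deriv \<phi> + deriv \<psi>)"
    unfolding plus_fun_def by (intro continuous_on_add C1c_derivative(2)[OF assms(1)] C1c_derivative(2)[OF assms(2)])
  have K: "?K \<subseteq> {0<..<l}" using assms by (auto simp: C1c_def)
  have "(\<phi> + \<psi>) x = 0" if "x \<notin> ?K" for x
    using that zero_off_support[of x \<phi>] zero_off_support[of x \<psi>] by simp
  with C1cI[OF D c _ K] show "\<phi> + \<psi> \<in> C1c l" "deriv (\<phi> + \<psi>) = deriv \<phi> + deriv \<psi>"
    by auto
qed

lemma C1c_scaleR:
  assumes "\<phi> \<in> C1c l"
  shows "r *\<^sub>R \<phi> \<in> C1c l" "deriv (r *\<^sub>R \<phi>) = r *\<^sub>R deriv \<phi>"
proof -
  let ?K = "closure {x. \<phi> x \<noteq> 0}"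
  have D: "(r *\<^sub>R \<phi> has_real_derivative (r *\<^sub>R deriv \<phi>) x) (at x)" for x
    unfolding scaleR_fun_def real_scaleR_def by (intro DERIV_cmult C1c_derivative(1)[OF assms])
  have c: "continuous_on UNIV (r *\<^sub>R deriv \<phi>)"
    unfolding scaleR_fun_def by (intro continuous_intros C1c_derivative(2)[OF assms])
  have K: "?K \<subseteq> {0<..<l}" using assms by (auto simp: C1c_def)
  have "(r *\<^sub>R \<phi>) x = 0" if "x \<notin> ?K" for x
    using that zero_off_support[of x \<phi>] by (simp add: scaleR_fun_def)
  with C1cI[OF D c _ K] show "r *\<^sub>R \<phi> \<in> C1c l" "deriv (r *\<^sub>R \<phi>) = r *\<^sub>R deriv \<phi>"
    by auto
qed

lemma C1c_zero: "0 \<in> C1c l" "deriv 0 = (0 :: real \<Rightarrow> real)"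
  using C1cI[of 0 0 "{}" l] by (auto simp: zero_fun_def)

lemma weak_deriv_iff:
  "weak_deriv l f g \<longleftrightarrow> f \<in> L2 l \<and> g \<in> L2 l \<and> (\<forall>\<phi>\<in>C1c l. ip l f (deriv \<phi>) = - ip l g \<phi>)"
  by (simp add: weak_deriv_def ip_def)

lemma weak_derivD:
  "weak_deriv l f g \<Longrightarrow> f \<in> L2 l" "weak_deriv l f g \<Longrightarrow> g \<in> L2 l"
  "weak_deriv l f g \<Longrightarrow> \<phi> \<in> C1c l \<Longrightarrow> ip l f (deriv \<phi>) = - ip l g \<phi>"
  by (auto simp: weak_deriv_iff)

lemma weak_deriv_cong:
  assumes "weak_deriv l f g" "f' \<in> L2 l" "g' \<in> L2 l" "eq_ae l f f'" "eq_ae l g g'"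
  shows "weak_deriv l f' g'"
  using assms unfolding weak_deriv_iff
  by (metis C1c_L2 C1c_deriv_L2 ip_cong_AE)

lemma weak_deriv_add:
  "weak_deriv l f g \<Longrightarrow> weak_deriv l f' g' \<Longrightarrow> weak_deriv l (f + f') (g + g')"
  by (auto simp: weak_deriv_iff L2_add ip_add_left C1c_L2 C1c_deriv_L2)

lemma weak_deriv_diff:
  "weak_deriv l f g \<Longrightarrow> weak_deriv l f' g' \<Longrightarrow> weak_deriv l (f - f') (g - g')"
  by (auto simp: weak_deriv_iff L2_diff ip_diff_left C1c_L2 C1c_deriv_L2)

lemma weak_deriv_scaleR: "weak_deriv l f g \<Longrightarrow> weak_deriv l (r *\<^sub>R f) (r *\<^sub>R g)"
  by (auto simp: weak_deriv_iff L2_scaleR ip_scaleR_left)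

lemma weak_deriv_zero: "weak_deriv l 0 0"
  by (auto simp: weak_deriv_iff L2_zero ip_zero_left)

lemma weak_deriv_sum:
  "(\<And>i. i \<in> I \<Longrightarrow> weak_deriv l (f i) (g i)) \<Longrightarrow> weak_deriv l (sum f I) (sum g I)"
  by (induction I rule: infinite_finite_induct) (auto intro: weak_deriv_add weak_deriv_zero)

lemma weak_deriv_limit:
  assumes "\<And>n. weak_deriv l (F n) (G n)" "f \<in> L2 l" "g \<in> L2 l"
    and "(\<lambda>n. L2norm l (f - F n)) \<longlonglongrightarrow> 0" "(\<lambda>n. L2norm l (g - G n)) \<longlonglongrightarrow> 0"
  shows "weak_deriv l f g"
  unfolding weak_deriv_iff
proof (intro conjI ballI assms)
  fix \<phi> assume \<phi>: "\<phi> \<in> C1c l"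
  have "(\<lambda>n. ip l (F n) (deriv \<phi>)) \<longlonglongrightarrow> ip l f (deriv \<phi>)"
    by (rule tendsto_ip[OF weak_derivD(1)[OF assms(1)] assms(2) C1c_deriv_L2[OF \<phi>] assms(4)])
  moreover have "(\<lambda>n. - ip l (G n) \<phi>) \<longlonglongrightarrow> - ip l g \<phi>"
    by (rule tendsto_minus[OF tendsto_ip[OF weak_derivD(2)[OF assms(1)] assms(3) C1c_L2[OF \<phi>] assms(5)]])
  moreover have "ip l (F n) (deriv \<phi>) = - ip l (G n) \<phi>" for n
    using assms(1) \<phi> by (rule weak_derivD)
  ultimately show "ip l f (deriv \<phi>) = - ip l g \<phi>"
    using LIMSEQ_unique by simp
qed

lemma weak_deriv_classical:
  assumes "0 < l" "\<And>x. (F has_real_derivative G x) (at x)" "continuous_on UNIV G"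
  shows "weak_deriv l F G"
  unfolding weak_deriv_iff
proof (intro conjI ballI)
  have F: "continuous_on S F" for S
    using assms(2) by (meson DERIV_isCont continuous_at_imp_continuous_on)
  have G: "continuous_on S G" for S
    using assms(3) by (rule continuous_on_subset) simp
  show L2: "F \<in> L2 l" "G \<in> L2 l" by (intro L2_continuous F G)+
  fix \<phi> assume \<phi>: "\<phi> \<in> C1c l"
  have "(LINT x|leb l. F x * deriv \<phi> x + G x * \<phi> x) = F l * \<phi> l - F 0 * \<phi> 0"
  proof (rule integral_leb_derivative)
    show "continuous_on {0..l} (\<lambda>x. F x * deriv \<phi> x + G x * \<phi> x)"
      by (intro continuous_intros F G C1c_derivative[OF \<phi>] C1c_continuous[OF \<phi>])
    show "((\<lambda>x. F x * \<phi> x) has_real_derivative F x * deriv \<phi> x + G x * \<phi> x) (at x)" for x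
      using DERIV_mult[OF assms(2) C1c_derivative(1)[OF \<phi>], of x] by (simp add: algebra_simps)
  qed (use assms in simp)
  then have "(LINT x|leb l. F x * deriv \<phi> x + G x * \<phi> x) = 0"
    by (simp add: C1c_at_ends[OF \<phi>])
  moreover have "(LINT x|leb l. F x * deriv \<phi> x + G x * \<phi> x) = ip l F (deriv \<phi>) + ip l G \<phi>"
    unfolding ip_def
    by (intro Bochner_Integration.integral_add L2_mult_integrable L2 C1c_L2 C1c_deriv_L2 \<phi>)
  ultimately show "ip l F (deriv \<phi>) = - ip l G \<phi>" by simp
qed

lemma weak_deriv_cosb: "0 < l \<Longrightarrow> weak_deriv l (cosb l n) (- (freq l n *\<^sub>R sinb l n))"
  using DERIV_cosb
  by (auto intro!: weak_deriv_classical continuous_intros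
      simp: scaleR_fun_def fun_Compl_def)

lemma weak_deriv_C1c: "0 < l \<Longrightarrow> \<phi> \<in> C1c l \<Longrightarrow> weak_deriv l \<phi> (deriv \<phi>)"
  by (intro weak_deriv_classical C1c_derivative)

text \<open>\<open>H0_pair l f g\<close> says that \<open>f\<close> is in \<open>H\<^sup>1\<^sub>0\<close> with weak derivative \<open>g\<close>, without recourse to
  the choice operator behind \<open>wd\<close>.\<close>

definition H0_pair :: "real \<Rightarrow> (real \<Rightarrow> real) \<Rightarrow> (real \<Rightarrow> real) \<Rightarrow> bool" where
  "H0_pair l f g \<longleftrightarrow> f \<in> L2 l \<and> g \<in> L2 l \<and>
     (\<forall>e>0. \<exists>\<phi>\<in>C1c l. L2norm l (f - \<phi>) < e \<and> L2norm l (g - deriv \<phi>) < e)"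

lemma H0_pairD:
  "H0_pair l f g \<Longrightarrow> f \<in> L2 l" "H0_pair l f g \<Longrightarrow> g \<in> L2 l"
  by (auto simp: H0_pair_def)

text \<open>Integration by parts without boundary terms: \<open>f\<close> and its derivative are
  approximated simultaneously by test functions, for which the identity is the definition of a weak
  derivative.\<close>

lemma H0_pair_ip:
  assumes h: "weak_deriv l h k" and f: "H0_pair l f g"
  shows "ip l h g = - ip l k f"
proof -
  let ?C = "L2norm l h + L2norm l k + 1"
  note L2 = weak_derivD(1,2)[OF h] H0_pairD[OF f]
  have C: "0 < ?C" using L2norm_nonneg[of l h] L2norm_nonneg[of l k] by linarith
  have "\<bar>ip l h g + ip l k f\<bar> \<le> 0 + e" if "0 < e" for e
  proof -
    have "0 < e / ?C" using that C by simp
    then obtain \<phi> where \<phi>: "\<phi> \<in> C1c l" "L2norm l (f - \<phi>) < e / ?C" "L2norm l (g - deriv \<phi>) < e / ?C"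
      using f unfolding H0_pair_def by blast
    note \<phi>L = C1c_L2[OF \<phi>(1)] C1c_deriv_L2[OF \<phi>(1)]
    have "\<bar>ip l h g + ip l k f\<bar> = \<bar>ip l (g - deriv \<phi>) h + ip l (f - \<phi>) k\<bar>"
      using weak_derivD(3)[OF h \<phi>(1)] L2 \<phi>L
      by (simp add: ip_diff_left ip_commute[of l h] ip_commute[of l k])
    also have "\<dots> \<le> L2norm l (g - deriv \<phi>) * L2norm l h + L2norm l (f - \<phi>) * L2norm l k"
      using ip_Cauchy_Schwarz[OF L2_diff[OF L2(4) \<phi>L(2)] L2(1)]
        ip_Cauchy_Schwarz[OF L2_diff[OF L2(3) \<phi>L(1)] L2(2)] by linarith
    also have "\<dots> \<le> (e / ?C) * L2norm l h + (e / ?C) * L2norm l k"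
      using \<phi>(2,3) L2norm_nonneg by (intro add_mono mult_right_mono) auto
    also have "\<dots> = (e / ?C) * (?C - 1)" by (simp add: distrib_left add_divide_distrib)
    also have "\<dots> \<le> (e / ?C) * ?C"
      using \<open>0 < e / ?C\<close> by (intro mult_left_mono) auto
    also have "\<dots> = e" using C by simp
    finally show ?thesis by simp
  qed
  then have "\<bar>ip l h g + ip l k f\<bar> \<le> 0" by (rule field_le_epsilon)
  then show ?thesis by simp
qed

lemma H0_pair_C1c:
  assumes "\<phi> \<in> C1c l"
  shows "H0_pair l \<phi> (deriv \<phi>)"
  unfolding H0_pair_def
proof (intro conjI allI impI)
  show "\<phi> \<in> L2 l" "deriv \<phi> \<in> L2 l" using assms by (rule C1c_L2 C1c_deriv_L2)+
  fix e :: real assume "0 < e"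
  then show "\<exists>\<psi>\<in>C1c l. L2norm l (\<phi> - \<psi>) < e \<and> L2norm l (deriv \<phi> - deriv \<psi>) < e"
    using assms by (intro bexI[of _ \<phi>]) (auto simp: L2norm_def)
qed

lemma H0_pair_add:
  assumes "H0_pair l f g" "H0_pair l f' g'"
  shows "H0_pair l (f + f') (g + g')"
  unfolding H0_pair_def
proof (intro conjI allI impI)
  note L2 = H0_pairD[OF assms(1)] H0_pairD[OF assms(2)]
  show "f + f' \<in> L2 l" "g + g' \<in> L2 l" using L2 by (auto intro: L2_add)
  fix e :: real assume "0 < e"
  then have e2: "0 < e / 2" by simp
  obtain \<phi> \<phi>' where \<phi>: "\<phi> \<in> C1c l" "L2norm l (f - \<phi>) < e / 2" "L2norm l (g - deriv \<phi>) < e / 2"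
    and \<phi>': "\<phi>' \<in> C1c l" "L2norm l (f' - \<phi>') < e / 2" "L2norm l (g' - deriv \<phi>') < e / 2"
    using assms e2 unfolding H0_pair_def by blast
  note \<phi>L = C1c_L2[OF \<phi>(1)] C1c_deriv_L2[OF \<phi>(1)] C1c_L2[OF \<phi>'(1)] C1c_deriv_L2[OF \<phi>'(1)]
  have "L2norm l ((f - \<phi>) + (f' - \<phi>')) < e"
    using L2norm_triangle[of "f - \<phi>" l "f' - \<phi>'"] L2 \<phi>L \<phi>(2) \<phi>'(2) by (simp add: L2_diff)
  moreover have "L2norm l ((g - deriv \<phi>) + (g' - deriv \<phi>')) < e"
    using L2norm_triangle[of "g - deriv \<phi>" l "g' - deriv \<phi>'"] L2 \<phi>L \<phi>(3) \<phi>'(3) by (simp add: L2_diff)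
  moreover have "(f - \<phi>) + (f' - \<phi>') = (f + f') - (\<phi> + \<phi>')"
    "(g - deriv \<phi>) + (g' - deriv \<phi>') = (g + g') - deriv (\<phi> + \<phi>')"
    by (simp_all add: C1c_add(2)[OF \<phi>(1) \<phi>'(1)])
  ultimately show "\<exists>\<phi>\<in>C1c l. L2norm l (f + f' - \<phi>) < e \<and> L2norm l (g + g' - deriv \<phi>) < e"
    using C1c_add(1)[OF \<phi>(1) \<phi>'(1)] by metis
qed

lemma H0_pair_zero: "H0_pair l 0 0"
  using H0_pair_C1c[OF C1c_zero(1)] by (simp add: C1c_zero)

lemma H0_pair_scaleR:
  assumes "H0_pair l f g"
  shows "H0_pair l (r *\<^sub>R f) (r *\<^sub>R g)"
  unfolding H0_pair_def
proof (intro conjI allI impI)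
  note L2 = H0_pairD[OF assms]
  show "r *\<^sub>R f \<in> L2 l" "r *\<^sub>R g \<in> L2 l" using L2 by (auto intro: L2_scaleR)
  fix e :: real assume "0 < e"
  then have "0 < e / (\<bar>r\<bar> + 1)" by simp
  then obtain \<phi> where \<phi>: "\<phi> \<in> C1c l" "L2norm l (f - \<phi>) < e / (\<bar>r\<bar> + 1)"
    "L2norm l (g - deriv \<phi>) < e / (\<bar>r\<bar> + 1)"
    using assms unfolding H0_pair_def by blast
  have scale: "\<bar>r\<bar> * s < e" if "s < e / (\<bar>r\<bar> + 1)" "0 \<le> s" for s
  proof -
    have "\<bar>r\<bar> * s \<le> (\<bar>r\<bar> + 1) * s" using that by (simp add: distrib_right)
    also have "\<dots> < e" using that by (simp add: pos_less_divide_eq mult.commute)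
    finally show ?thesis .
  qed
  have "L2norm l (r *\<^sub>R f - r *\<^sub>R \<phi>) < e" "L2norm l (r *\<^sub>R g - r *\<^sub>R deriv \<phi>) < e"
    using scale[OF \<phi>(2) L2norm_nonneg] scale[OF \<phi>(3) L2norm_nonneg]
    by (simp_all add: L2norm_scaleR flip: scaleR_diff_right)
  then show "\<exists>\<phi>\<in>C1c l. L2norm l (r *\<^sub>R f - \<phi>) < e \<and> L2norm l (r *\<^sub>R g - deriv \<phi>) < e"
    using C1c_scaleR[OF \<phi>(1), of r] by (metis (no_types))
qed

lemma H0_pair_sum:
  "(\<And>i. i \<in> I \<Longrightarrow> H0_pair l (f i) (g i)) \<Longrightarrow> H0_pair l (sum f I) (sum g I)"
  by (induction I rule: infinite_finite_induct) (auto intro: H0_pair_add H0_pair_zero)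

lemma H0_pair_limit:
  assumes FG: "\<And>n. H0_pair l (F n) (G n)" and L2: "f \<in> L2 l" "g \<in> L2 l"
    and lim: "(\<lambda>n. L2norm l (f - F n)) \<longlonglongrightarrow> 0" "(\<lambda>n. L2norm l (g - G n)) \<longlonglongrightarrow> 0"
  shows "H0_pair l f g"
  unfolding H0_pair_def
proof (intro conjI allI impI L2)
  fix e :: real assume "0 < e"
  then have e2: "0 < e / 2" by simp
  have "\<forall>\<^sub>F n in sequentially. L2norm l (f - F n) < e / 2 \<and> L2norm l (g - G n) < e / 2"
    using order_tendstoD(2)[OF lim(1) e2] order_tendstoD(2)[OF lim(2) e2] by (rule eventually_conj)
  then obtain n where n: "L2norm l (f - F n) < e / 2" "L2norm l (g - G n) < e / 2"
    using eventually_happens'[OF sequentially_bot] by blast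
  obtain \<phi> where \<phi>: "\<phi> \<in> C1c l" "L2norm l (F n - \<phi>) < e / 2" "L2norm l (G n - deriv \<phi>) < e / 2"
    using FG[of n] e2 unfolding H0_pair_def by blast
  note \<phi>L = C1c_L2[OF \<phi>(1)] C1c_deriv_L2[OF \<phi>(1)] H0_pairD[OF FG[of n]]
  have "L2norm l (f - \<phi>) < e"
    using L2norm_triangle[of "f - F n" l "F n - \<phi>"] L2 \<phi>L n \<phi> by (simp add: L2_diff)
  moreover have "L2norm l (g - deriv \<phi>) < e"
    using L2norm_triangle[of "g - G n" l "G n - deriv \<phi>"] L2 \<phi>L n \<phi> by (simp add: L2_diff)
  ultimately show "\<exists>\<phi>\<in>C1c l. L2norm l (f - \<phi>) < e \<and> L2norm l (g - deriv \<phi>) < e"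
    using \<phi>(1) by blast
qed

lemma H0_pair_imp_weak_deriv:
  assumes "0 < l" "H0_pair l f g"
  shows "weak_deriv l f g"
  unfolding weak_deriv_iff
proof (intro conjI ballI H0_pairD[OF assms(2)])
  fix \<phi> assume "\<phi> \<in> C1c l"
  from H0_pair_ip[OF weak_deriv_C1c[OF assms(1) this] assms(2)]
  show "ip l f (deriv \<phi>) = - ip l g \<phi>"
    by (simp add: ip_commute[of l f] ip_commute[of l g])
qed

section \<open>Cutoff functions\<close>

text \<open>A step from 0 to 1 with knots 0, 1/2, 1. Test functions need only be continuously
  differentiable, so a quadratic spline is smooth enough; its derivative \<open>hat\<close> is a
  tent of height 2.\<close>

definition quad_spline :: "real \<Rightarrow> real" where
  "quad_spline t = 2 * ((max 0 t)\<^sup>2 - 2 * (max 0 (t - 1 / 2))\<^sup>2 + (max 0 (t - 1))\<^sup>2)"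

definition hat :: "real \<Rightarrow> real" where
  "hat t = 4 * (max 0 t - 2 * max 0 (t - 1 / 2) + max 0 (t - 1))"

lemma DERIV_max_0_squared: "((\<lambda>t::real. (max 0 t)\<^sup>2) has_real_derivative 2 * max 0 t) (at t)"
proof -
  consider "t < 0" | "0 < t" | "t = 0" by linarith
  then show ?thesis
  proof cases
    case 1
    have "((\<lambda>_. 0) has_real_derivative 0) (at t)" by simp
    then have "((\<lambda>t. (max 0 t)\<^sup>2) has_real_derivative 0) (at t)"
      by (rule has_field_derivative_transform_within_open[of _ _ _ "{..<0}"]) (use 1 in auto)
    then show ?thesis using 1 by simp
  next
    case 2
    have "((\<lambda>t. t\<^sup>2) has_real_derivative 2 * t) (at t)" by (auto intro!: derivative_eq_intros)
    then have "((\<lambda>t. (max 0 t)\<^sup>2) has_real_derivative 2 * t) (at t)"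
      by (rule has_field_derivative_transform_within_open[of _ _ _ "{0<..}"]) (use 2 in auto)
    then show ?thesis using 2 by simp
  next
    case 3
    have lim: "((\<lambda>h. \<bar>h\<bar>) \<longlongrightarrow> \<bar>0::real\<bar>) (at 0)" by (intro tendsto_intros)
    have "((\<lambda>h. ((max 0 (0 + h))\<^sup>2 - (max 0 0)\<^sup>2) / h) \<longlongrightarrow> (0::real)) (at 0)"
    proof (rule Lim_null_comparison)
      show "\<forall>\<^sub>F h in at 0. norm (((max 0 (0 + h))\<^sup>2 - (max 0 0)\<^sup>2) / h) \<le> \<bar>h :: real\<bar>"
        by (rule always_eventually) (auto simp: max_def power2_eq_square)
      show "((\<lambda>h. \<bar>h\<bar>) \<longlongrightarrow> (0::real)) (at 0)" using lim by simp
    qed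
    then show ?thesis unfolding 3 by (simp add: DERIV_def)
  qed
qed

lemma DERIV_quad_spline: "(quad_spline has_real_derivative hat t) (at t)"
proof -
  have D: "((\<lambda>t. (max 0 (t - c))\<^sup>2) has_real_derivative 2 * max 0 (t - c) * 1) (at t)" for c
    by (rule DERIV_chain2[OF DERIV_max_0_squared]) (auto intro!: derivative_eq_intros)
  have "((\<lambda>t. 2 * ((max 0 (t - 0))\<^sup>2 - 2 * (max 0 (t - 1 / 2))\<^sup>2 + (max 0 (t - 1))\<^sup>2)) has_real_derivative
      2 * (2 * max 0 (t - 0) * 1 - 2 * (2 * max 0 (t - 1 / 2) * 1) + 2 * max 0 (t - 1) * 1)) (at t)"
    by (intro DERIV_cmult DERIV_add DERIV_diff D)
  then show ?thesis
    by (simp add: quad_spline_def[abs_def] hat_def algebra_simps)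
qed

lemma hat_bounds: "0 \<le> hat t" "hat t \<le> 2" "t \<le> 0 \<or> 1 \<le> t \<Longrightarrow> hat t = 0"
  by (auto simp: hat_def max_def)

lemma continuous_hat [continuous_intros]: "continuous_on S f \<Longrightarrow> continuous_on S (\<lambda>x. hat (f x))"
  unfolding hat_def by (intro continuous_intros)

lemma quad_spline_eq: "t \<le> 0 \<Longrightarrow> quad_spline t = 0" "1 \<le> t \<Longrightarrow> quad_spline t = 1"
  by (auto simp: quad_spline_def max_def power2_eq_square algebra_simps)

lemma quad_spline_bounds: "0 \<le> quad_spline t" "quad_spline t \<le> 1"
proof -
  have mono: "quad_spline s \<le> quad_spline t" if "s \<le> t" for s t
    using that by (rule DERIV_nonneg_imp_nondecreasing) (use DERIV_quad_spline hat_bounds in blast)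
  show "0 \<le> quad_spline t"
    using mono[of "min t 0" t] quad_spline_eq(1)[of "min t 0"] by simp
  show "quad_spline t \<le> 1"
    using mono[of t "max t 1"] quad_spline_eq(2)[of "max t 1"] by simp
qed

lemma continuous_quad_spline [continuous_intros]:
  "continuous_on S f \<Longrightarrow> continuous_on S (\<lambda>x. quad_spline (f x))"
  unfolding quad_spline_def by (intro continuous_intros)

text \<open>The shift by 1 makes the function vanish within \<open>1 / k\<close> of either end,
  which gives compact support; it equals 1 from distance \<open>2 / k\<close> on.\<close>

definition cutoff :: "real \<Rightarrow> nat \<Rightarrow> real \<Rightarrow> real" where
  "cutoff l k x = quad_spline (real k * x - 1) * quad_spline (real k * (l - x) - 1)"

definition cutoff' :: "real \<Rightarrow> nat \<Rightarrow> real \<Rightarrow> real" where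
  "cutoff' l k x = quad_spline (real k * x - 1) * (hat (real k * (l - x) - 1) * (- real k))
     + hat (real k * x - 1) * real k * quad_spline (real k * (l - x) - 1)"

lemma DERIV_cutoff: "(cutoff l k has_real_derivative cutoff' l k x) (at x)"
  unfolding cutoff_def[abs_def] cutoff'_def
  by (rule DERIV_mult' DERIV_chain2[OF DERIV_quad_spline] | force intro!: derivative_eq_intros)+

lemma continuous_cutoff [continuous_intros]: "continuous_on S (cutoff l k)" "continuous_on S (cutoff' l k)"
  unfolding cutoff_def[abs_def] cutoff'_def[abs_def] by (intro continuous_intros)+

lemma cutoff_bounds: "0 \<le> cutoff l k x" "cutoff l k x \<le> 1"
  unfolding cutoff_def
  by (simp_all add: quad_spline_bounds mult_le_one)

lemma abs_cutoff'_le: "\<bar>cutoff' l k x\<bar> \<le> 4 * real k"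
proof -
  have "\<bar>quad_spline s * (hat t * (- real k))\<bar> \<le> 1 * (2 * real k)"
    "\<bar>hat t * real k * quad_spline s\<bar> \<le> 2 * real k * 1" for s t
    unfolding abs_mult using quad_spline_bounds[of s] hat_bounds[of t]
    by (intro mult_mono; simp)+
  note b = this(1)[of "real k * x - 1" "real k * (l - x) - 1"]
    this(2)[of "real k * x - 1" "real k * (l - x) - 1"]
  show ?thesis unfolding cutoff'_def using b by linarith
qed

lemma cutoff'_eq_0: "2 \<le> real k * x \<Longrightarrow> 2 \<le> real k * (l - x) \<Longrightarrow> cutoff' l k x = 0"
  by (simp add: cutoff'_def hat_bounds)

lemma cutoff_eq_1: "2 \<le> real k * x \<Longrightarrow> 2 \<le> real k * (l - x) \<Longrightarrow> cutoff l k x = 1"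
  by (simp add: cutoff_def quad_spline_eq)

lemma cutoff_eventually:
  assumes "x \<in> {0<..<l}"
  shows "\<forall>\<^sub>F k in sequentially. cutoff l k x = 1 \<and> cutoff' l k x = 0"
proof -
  have "\<forall>\<^sub>F k in sequentially. 2 / x \<le> real k" "\<forall>\<^sub>F k in sequentially. 2 / (l - x) \<le> real k"
    using filterlim_real_sequentially unfolding filterlim_at_top by blast+
  then show ?thesis
  proof eventually_elim
    case (elim k)
    then show ?case
      using assms by (intro conjI cutoff_eq_1 cutoff'_eq_0) (auto simp: field_simps)
  qed
qed

lemma mult_cutoff_C1c:
  assumes "0 < l" "0 < k" "\<And>x. (\<psi> has_real_derivative \<psi>' x) (at x)" "continuous_on UNIV \<psi>'"
  shows "(\<lambda>x. \<psi> x * cutoff l k x) \<in> C1c l"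
    and "deriv (\<lambda>x. \<psi> x * cutoff l k x) = (\<lambda>x. \<psi>' x * cutoff l k x + \<psi> x * cutoff' l k x)"
proof -
  let ?K = "{1 / real k .. l - 1 / real k}"
  have \<psi>: "continuous_on UNIV \<psi>"
    using assms(3) by (meson DERIV_isCont continuous_at_imp_continuous_on)
  have D: "((\<lambda>x. \<psi> x * cutoff l k x) has_real_derivative
      \<psi>' x * cutoff l k x + \<psi> x * cutoff' l k x) (at x)" for x
    using DERIV_mult'[OF assms(3) DERIV_cutoff[of l k], of x] by (simp add: algebra_simps)
  have c: "continuous_on UNIV (\<lambda>x. \<psi>' x * cutoff l k x + \<psi> x * cutoff' l k x)"
    by (intro continuous_intros \<psi> assms)
  have K: "?K \<subseteq> {0<..<l}"
  proof
    fix x assume "x \<in> ?K"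
    moreover have "0 < 1 / real k" using \<open>0 < k\<close> by simp
    ultimately show "x \<in> {0<..<l}" by (auto simp del: zero_less_divide_1_iff)
  qed
  have z: "\<psi> x * cutoff l k x = 0" if "x \<notin> ?K" for x
  proof -
    have "real k * x - 1 \<le> 0 \<or> real k * (l - x) - 1 \<le> 0"
      using that \<open>0 < k\<close> by (auto simp: field_simps not_le)
    then show ?thesis by (auto simp: cutoff_def quad_spline_eq)
  qed
  show "(\<lambda>x. \<psi> x * cutoff l k x) \<in> C1c l"
    and "deriv (\<lambda>x. \<psi> x * cutoff l k x) = (\<lambda>x. \<psi>' x * cutoff l k x + \<psi> x * cutoff' l k x)"
    using C1cI[OF D c closed_atLeastAtMost K z] by auto
qed

lemma L2norm_tendsto_0_bounded:
  assumes "0 < l" "\<And>k. F k \<in> L2 l" "\<And>k x. x \<in> {0<..<l} \<Longrightarrow> \<bar>F k x\<bar> \<le> K"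
    and "\<And>x. x \<in> {0<..<l} \<Longrightarrow> (\<lambda>k. F k x) \<longlonglongrightarrow> 0"
  shows "(\<lambda>k. L2norm l (F k)) \<longlonglongrightarrow> 0"
proof -
  interpret finite_measure "leb l" by (rule finite_measure_leb)
  have "(\<lambda>k. LINT x|leb l. (F k x)\<^sup>2) \<longlonglongrightarrow> (LINT x|leb l. 0)"
  proof (rule integral_dominated_convergence[where w = "\<lambda>_. K\<^sup>2"])
    show "(\<lambda>x. (F k x)\<^sup>2) \<in> borel_measurable (leb l)" for k
      using L2_square_integrable[OF assms(2)] by (rule borel_measurable_integrable)
    show "AE x in leb l. (\<lambda>k. (F k x)\<^sup>2) \<longlonglongrightarrow> 0"
    proof (rule AE_I2)
      fix x assume "x \<in> space (leb l)"
      then have "(\<lambda>k. (F k x)\<^sup>2) \<longlonglongrightarrow> 0\<^sup>2" using assms(4) by (intro tendsto_power) simp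
      then show "(\<lambda>k. (F k x)\<^sup>2) \<longlonglongrightarrow> 0" by simp
    qed
    show "AE x in leb l. norm ((F k x)\<^sup>2) \<le> K\<^sup>2" for k
    proof (rule AE_I2)
      fix x assume "x \<in> space (leb l)"
      then have "\<bar>F k x\<bar> ^ 2 \<le> K ^ 2" using assms(3)[of x k] by (intro power_mono) auto
      then show "norm ((F k x)\<^sup>2) \<le> K\<^sup>2" by simp
    qed
  qed auto
  then have "(\<lambda>k. sqrt (LINT x|leb l. (F k x)\<^sup>2)) \<longlonglongrightarrow> sqrt 0"
    by (intro tendsto_real_sqrt) simp
  then show ?thesis by (simp add: L2norm_def)
qed

lemma abs_sinb_le_dist:
  assumes "0 < l"
  shows "\<bar>sinb l n x\<bar> \<le> \<bar>sqrt (2 / l)\<bar> * freq l n * \<bar>x\<bar>"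
    and "\<bar>sinb l n x\<bar> \<le> \<bar>sqrt (2 / l)\<bar> * freq l n * \<bar>l - x\<bar>"
proof -
  have f: "0 < freq l n" using assms by (rule freq_pos)
  have "\<bar>sin (freq l n * x)\<bar> \<le> \<bar>freq l n * x\<bar>"
    by (rule abs_sin_x_le_abs_x)
  then have "\<bar>sqrt (2 / l)\<bar> * \<bar>sin (freq l n * x)\<bar> \<le> \<bar>sqrt (2 / l)\<bar> * \<bar>freq l n * x\<bar>"
    by (rule mult_left_mono) simp
  then show "\<bar>sinb l n x\<bar> \<le> \<bar>sqrt (2 / l)\<bar> * freq l n * \<bar>x\<bar>"
    using f by (simp add: sinb_def abs_mult)
  have "sin (freq l n * l) = 0"
    using sinb_at_l[OF assms, of n] assms by (simp add: sinb_def)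
  then have "sin (freq l n * (l - (l - x))) = - cos (freq l n * l) * sin (freq l n * (l - x))"
    unfolding right_diff_distrib[of _ l "l - x"] sin_diff by simp
  then have "\<bar>sin (freq l n * x)\<bar> = \<bar>cos (freq l n * l)\<bar> * \<bar>sin (freq l n * (l - x))\<bar>"
    by (simp add: abs_mult)
  also have "\<dots> \<le> 1 * \<bar>freq l n * (l - x)\<bar>"
    by (intro mult_mono abs_cos_le_one abs_sin_x_le_abs_x) auto
  finally have "\<bar>sqrt (2 / l)\<bar> * \<bar>sin (freq l n * x)\<bar> \<le> \<bar>sqrt (2 / l)\<bar> * \<bar>freq l n * (l - x)\<bar>"
    by (intro mult_left_mono) auto
  then show "\<bar>sinb l n x\<bar> \<le> \<bar>sqrt (2 / l)\<bar> * freq l n * \<bar>l - x\<bar>"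
    using f by (simp add: sinb_def abs_mult)
qed

text \<open>\<open>cutoff'\<close> may be as large as \<open>4 * k\<close>, but only within
  \<open>2 / k\<close> of an end, where the sine is at most its slope times the distance. The powers
  of \<open>k\<close> cancel and \<open>4 * 2 = 8\<close> remains.\<close>

lemma abs_sinb_cutoff'_le:
  assumes l: "0 < l" and x: "x \<in> {0<..<l}"
  shows "\<bar>sinb l n x * cutoff' l k x\<bar> \<le> 8 * (\<bar>sqrt (2 / l)\<bar> * freq l n)"
proof -
  let ?c = "\<bar>sqrt (2 / l)\<bar> * freq l n"
  have c: "0 \<le> ?c" using freq_pos[OF l, of n] by simp
  have near: "\<bar>sinb l n x * cutoff' l k x\<bar> \<le> 8 * ?c" if "\<bar>sinb l n x\<bar> \<le> ?c * d" "real k * d \<le> 2" for d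
  proof -
    have "\<bar>sinb l n x * cutoff' l k x\<bar> \<le> (?c * d) * (4 * real k)"
      unfolding abs_mult using that abs_cutoff'_le by (intro mult_mono) auto
    also have "\<dots> = (4 * ?c) * (real k * d)" by simp
    also have "\<dots> \<le> (4 * ?c) * 2" using c that by (intro mult_left_mono) auto
    finally show ?thesis by simp
  qed
  show ?thesis
  proof (cases "2 \<le> real k * x \<and> 2 \<le> real k * (l - x)")
    case True
    then show ?thesis using c by (simp add: cutoff'_eq_0)
  next
    case False
    then consider "real k * \<bar>x\<bar> \<le> 2" | "real k * \<bar>l - x\<bar> \<le> 2"
      using x by fastforce
    then show ?thesis
      using near abs_sinb_le_dist[OF l, of n x] by cases blast+
  qed
qed

text \<open>\<open>mult_cutoff_C1c\<close> needs a positive index, so all limits run over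
  \<open>Suc k\<close>.\<close>

lemma cutoff_eventually_Suc:
  assumes "x \<in> {0<..<l}"
  shows "\<forall>\<^sub>F k in sequentially. cutoff l (Suc k) x = 1 \<and> cutoff' l (Suc k) x = 0"
  using cutoff_eventually[OF assms] unfolding eventually_sequentially by (meson le_SucI)

lemma L2norm_cutoff_limit:
  assumes l: "0 < l" and \<psi>: "continuous_on UNIV \<psi>"
  shows "(\<lambda>k. L2norm l (\<psi> - (\<lambda>x. \<psi> x * cutoff l (Suc k) x))) \<longlonglongrightarrow> 0"
proof -
  have "bounded (\<psi> ` {0..l})"
    by (intro compact_imp_bounded compact_continuous_image continuous_on_subset[OF \<psi>]) auto
  then obtain K where K: "\<And>x. x \<in> {0..l} \<Longrightarrow> \<bar>\<psi> x\<bar> \<le> K"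
    unfolding bounded_iff real_norm_def by blast
  show ?thesis
  proof (rule L2norm_tendsto_0_bounded[OF l])
    show "\<psi> - (\<lambda>x. \<psi> x * cutoff l (Suc k) x) \<in> L2 l" for k
      by (intro L2_diff L2_continuous continuous_intros continuous_on_subset[OF \<psi>]) auto
    fix x assume x: "x \<in> {0<..<l}"
    show "\<bar>(\<psi> - (\<lambda>x. \<psi> x * cutoff l (Suc k) x)) x\<bar> \<le> K" for k
    proof -
      have "\<bar>\<psi> x * (1 - cutoff l (Suc k) x)\<bar> \<le> K * 1"
        unfolding abs_mult using K[of x] x cutoff_bounds[of l "Suc k" x] by (intro mult_mono) auto
      then show ?thesis by (simp add: algebra_simps)
    qed
    have "\<forall>\<^sub>F k in sequentially. (\<psi> - (\<lambda>x. \<psi> x * cutoff l (Suc k) x)) x = 0"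
      using cutoff_eventually_Suc[OF x] by eventually_elim simp
    then show "(\<lambda>k. (\<psi> - (\<lambda>x. \<psi> x * cutoff l (Suc k) x)) x) \<longlonglongrightarrow> 0"
      by (rule tendsto_eventually)
  qed
qed

text \<open>In the derivative of the cut-off sine, the term with \<open>cutoff'\<close> is bounded
  uniformly in \<open>k\<close> and is eventually zero at each point, hence it vanishes in square
  mean by dominated convergence.\<close>

lemma H0_pair_sinb:
  assumes l: "0 < l"
  shows "H0_pair l (sinb l n) (freq l n *\<^sub>R cosb l n)"
proof (rule H0_pair_limit)
  let ?\<phi> = "\<lambda>k x. sinb l n x * cutoff l (Suc k) x"
  have cs: "continuous_on UNIV (\<lambda>x. freq l n * cosb l n x)" by (intro continuous_intros)
  have \<phi>: "?\<phi> k \<in> C1c l"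
    "deriv (?\<phi> k) = (\<lambda>x. freq l n * cosb l n x * cutoff l (Suc k) x + sinb l n x * cutoff' l (Suc k) x)" for k
    by (rule mult_cutoff_C1c(1)[OF l zero_less_Suc DERIV_sinb cs])
      (rule mult_cutoff_C1c(2)[OF l zero_less_Suc DERIV_sinb cs])
  show "H0_pair l (?\<phi> k) (deriv (?\<phi> k))" for k
    by (rule H0_pair_C1c[OF \<phi>(1)])
  show "sinb l n \<in> L2 l" "freq l n *\<^sub>R cosb l n \<in> L2 l"
    by (intro L2_scaleR sinb_L2 cosb_L2)+
  show "(\<lambda>k. L2norm l (sinb l n - ?\<phi> k)) \<longlonglongrightarrow> 0"
    by (intro L2norm_cutoff_limit l continuous_intros)
  let ?c = "freq l n * \<bar>sqrt (2 / l)\<bar> + 8 * (\<bar>sqrt (2 / l)\<bar> * freq l n)"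
  show "(\<lambda>k. L2norm l (freq l n *\<^sub>R cosb l n - deriv (?\<phi> k))) \<longlonglongrightarrow> 0"
  proof (rule L2norm_tendsto_0_bounded[OF l])
    show "freq l n *\<^sub>R cosb l n - deriv (?\<phi> k) \<in> L2 l" for k
      by (intro L2_diff L2_scaleR cosb_L2 C1c_deriv_L2 \<phi>(1))
    fix x assume x: "x \<in> {0<..<l}"
    have eq: "(freq l n *\<^sub>R cosb l n - deriv (?\<phi> k)) x
        = freq l n * cosb l n x * (1 - cutoff l (Suc k) x) - sinb l n x * cutoff' l (Suc k) x" for k
      by (simp add: \<phi>(2) scaleR_fun_def algebra_simps)
    show "\<bar>(freq l n *\<^sub>R cosb l n - deriv (?\<phi> k)) x\<bar> \<le> ?c" for k
    proof -
      have "\<bar>freq l n * cosb l n x * (1 - cutoff l (Suc k) x)\<bar> \<le> (freq l n * \<bar>sqrt (2 / l)\<bar>) * 1"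
        unfolding abs_mult using freq_pos[OF l, of n] abs_cosb_le[of l n x] cutoff_bounds[of l "Suc k" x]
        by (intro mult_mono) auto
      then show ?thesis
        unfolding eq using abs_sinb_cutoff'_le[OF l x, of n "Suc k"] by linarith
    qed
    have "\<forall>\<^sub>F k in sequentially. (freq l n *\<^sub>R cosb l n - deriv (?\<phi> k)) x = 0"
      using cutoff_eventually_Suc[OF x] unfolding eq by eventually_elim simp
    then show "(\<lambda>k. (freq l n *\<^sub>R cosb l n - deriv (?\<phi> k)) x) \<longlonglongrightarrow> 0"
      by (rule tendsto_eventually)
  qed
qed

text \<open>The sine itself kills the boundary terms, so \<open>f\<close> may have any boundary
  values.\<close>

lemma ip_weak_deriv_sinb:
  assumes "0 < l" "weak_deriv l f g"
  shows "ip l g (sinb l n) = - freq l n * ip l f (cosb l n)"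
  using H0_pair_ip[OF assms(2) H0_pair_sinb[OF assms(1)], of n]
  by (simp add: ip_commute[of l f "freq l n *\<^sub>R cosb l n"] ip_scaleR_left ip_commute[of l "cosb l n"])

text \<open>The cosine does not vanish at the ends; here \<open>f\<close> has to remove the boundary
  terms.\<close>

lemma ip_H0_pair_cosb:
  assumes "0 < l" "H0_pair l f g"
  shows "ip l g (cosb l n) = freq l n * ip l f (sinb l n)"
  using H0_pair_ip[OF weak_deriv_cosb[OF assms(1)] assms(2), of n]
  by (simp add: ip_uminus_left ip_scaleR_left ip_commute[of l "cosb l n"] ip_commute[of l "sinb l n"])

text \<open>The integrand is at most \<open>4 * k * e\<close> on two end strips of length
  \<open>2 / k\<close> each, and zero elsewhere: \<open>4 * 4 = 16\<close>.\<close>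

lemma integral_cutoff'_bound:
  assumes l: "0 < l" and k: "0 < k" and q: "q \<in> L2 l" and "0 \<le> e"
    and small: "\<And>x. x \<in> {0<..<l} \<Longrightarrow> x \<le> 2 / real k \<or> l - x \<le> 2 / real k \<Longrightarrow> \<bar>q x\<bar> \<le> e"
  shows "\<bar>LINT x|leb l. q x * cutoff' l k x\<bar> \<le> 16 * e"
proof -
  interpret finite_measure "leb l" by (rule finite_measure_leb)
  let ?A = "{0..2 / real k}" and ?B = "{l - 2 / real k..l}"
  have mA: "integrable (leb l) (indicator A :: real \<Rightarrow> real)"
    "(LINT x|leb l. indicator A x) \<le> 2 / real k" if "A = ?A \<or> A = ?B" for A
  proof -
    have A: "A \<in> lmeasurable" using that by auto
    then have "A \<inter> {0<..<l} \<in> sets (leb l)"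
      by (subst sets_restrict_space_iff) (auto intro: fmeasurableD)
    then have "integrable (leb l) (indicator (A \<inter> {0<..<l}) :: real \<Rightarrow> real)"
      by (intro integrable_real_indicator) (auto simp: emeasure_eq_measure)
    then show "integrable (leb l) (indicator A :: real \<Rightarrow> real)"
      by (rule Bochner_Integration.integrable_cong[THEN iffD1, rotated 2])
        (auto simp: indicator_def)
    have "(LINT x|leb l. indicator A x) = measure (leb l) (A \<inter> {0<..<l})"
      by simp
    also have "\<dots> = measure lebesgue (A \<inter> {0<..<l})"
      by (simp add: measure_restrict_space)
    also have "\<dots> \<le> measure lebesgue A"
      using A by (intro measure_mono_fmeasurable) (auto intro: fmeasurableD)
    also have "\<dots> = 2 / real k" using that k by auto
    finally show "(LINT x|leb l. indicator A x) \<le> 2 / real k" .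
  qed
  have int: "integrable (leb l) (\<lambda>x. q x * cutoff' l k x)"
    by (intro L2_mult_integrable q L2_continuous continuous_intros)
  have "\<bar>LINT x|leb l. q x * cutoff' l k x\<bar> \<le> (LINT x|leb l. \<bar>q x * cutoff' l k x\<bar>)"
    by (rule integral_abs_bound)
  also have "\<dots> \<le> (LINT x|leb l. 4 * real k * e * (indicator ?A x + indicator ?B x))"
  proof (rule Bochner_Integration.integral_mono)
    show "integrable (leb l) (\<lambda>x. \<bar>q x * cutoff' l k x\<bar>)" using int by simp
    show "integrable (leb l) (\<lambda>x. 4 * real k * e * (indicator ?A x + indicator ?B x))"
      using mA(1) by (intro integrable_mult_right Bochner_Integration.integrable_add) auto
    fix x assume "x \<in> space (leb l)"
    then have x: "x \<in> {0<..<l}" by simp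
    show "\<bar>q x * cutoff' l k x\<bar> \<le> 4 * real k * e * (indicator ?A x + indicator ?B x)"
    proof (cases "2 \<le> real k * x \<and> 2 \<le> real k * (l - x)")
      case True
      then show ?thesis using \<open>0 \<le> e\<close> by (simp add: cutoff'_eq_0)
    next
      case False
      then have near: "x \<le> 2 / real k \<or> l - x \<le> 2 / real k"
        using k by (auto simp: pos_le_divide_eq mult.commute not_le)
      then have "\<bar>q x\<bar> * \<bar>cutoff' l k x\<bar> \<le> e * (4 * real k)"
        using small[OF x] abs_cutoff'_le by (intro mult_mono) auto
      moreover have "1 \<le> (indicator ?A x + indicator ?B x :: real)"
        using near x by (auto simp: indicator_def)
      then have "4 * real k * e * 1 \<le> 4 * real k * e * (indicator ?A x + indicator ?B x)"
        using \<open>0 \<le> e\<close> by (intro mult_left_mono) auto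
      ultimately show ?thesis by (simp add: abs_mult mult_ac)
    qed
  qed
  also have "\<dots> = 4 * real k * e * ((LINT x|leb l. indicator ?A x) + (LINT x|leb l. indicator ?B x))"
    unfolding Bochner_Integration.integral_mult_right_zero
    by (subst Bochner_Integration.integral_add) (simp_all only: mA(1) simp_thms)
  also have "\<dots> \<le> 4 * real k * e * (2 / real k + 2 / real k)"
    using mA(2)[of ?A] mA(2)[of ?B] \<open>0 \<le> e\<close> by (intro mult_left_mono add_mono) auto
  also have "\<dots> = 16 * e" using k by (simp add: field_simps)
  finally show ?thesis .
qed

text \<open>The counterpart of \<open>ip_H0_pair_cosb\<close> for the boundary condition in the
  domain of \<open>A0\<close>, stated through a continuous representative. In the test with a
  cut-off cosine the boundary term is an integral against \<open>cutoff'\<close>, small because the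
  representative is small near the ends.\<close>

lemma ip_vanishing_cosb:
  assumes l: "0 < l" and h: "weak_deriv l h g" and vanish: "vanishes_at_ends l h"
  shows "ip l g (cosb l n) = freq l n * ip l h (sinb l n)"
proof -
  obtain q where q: "continuous_on {0..l} q" "eq_ae l h q" "q 0 = 0" "q l = 0"
    using vanish unfolding vanishes_at_ends_def by blast
  note gL = weak_derivD(2)[OF h] and qL = L2_continuous[OF q(1)]
  have "weak_deriv l q g"
    by (rule weak_deriv_cong[OF h qL gL q(2)]) (simp add: eq_ae_def)
  let ?\<phi> = "\<lambda>k x. cosb l n x * cutoff l (Suc k) x"
  have cs: "continuous_on UNIV (\<lambda>x. - (freq l n * sinb l n x))" by (intro continuous_intros)
  let ?s = "\<lambda>k x. sinb l n x * cutoff l (Suc k) x"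
  let ?r = "\<lambda>k x. cosb l n x * cutoff' l (Suc k) x"
  have \<phi>: "?\<phi> k \<in> C1c l"
    "deriv (?\<phi> k) = (\<lambda>x. - (freq l n * sinb l n x) * cutoff l (Suc k) x + cosb l n x * cutoff' l (Suc k) x)" for k
    by (rule mult_cutoff_C1c(1)[OF l zero_less_Suc DERIV_cosb cs])
      (rule mult_cutoff_C1c(2)[OF l zero_less_Suc DERIV_cosb cs])
  have L2: "?s k \<in> L2 l" "?r k \<in> L2 l" for k
    by (intro L2_continuous continuous_intros)+
  have d: "deriv (?\<phi> k) = ?r k - freq l n *\<^sub>R ?s k" for k
    by (simp add: \<phi>(2) fun_eq_iff scaleR_fun_def)
  have eq: "ip l (?r k) q - freq l n * ip l (?s k) q = - ip l (?\<phi> k) g" for k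
  proof -
    have "ip l (deriv (?\<phi> k)) q = - ip l (?\<phi> k) g"
      using weak_derivD(3)[OF \<open>weak_deriv l q g\<close> \<phi>(1)[of k]]
      by (simp add: ip_commute[of l q] ip_commute[of l g])
    then show ?thesis unfolding d using L2 qL by (simp add: ip_diff_left L2_scaleR ip_scaleR_left)
  qed
  have "(\<lambda>k. ip l (?\<phi> k) g) \<longlonglongrightarrow> ip l (cosb l n) g"
    by (intro tendsto_ip gL cosb_L2 C1c_L2[OF \<phi>(1)] L2norm_cutoff_limit l continuous_intros)
  then have "(\<lambda>k. - ip l (?\<phi> k) g) \<longlonglongrightarrow> - ip l (cosb l n) g"
    by (rule tendsto_minus)
  moreover have "(\<lambda>k. ip l (?s k) q) \<longlonglongrightarrow> ip l (sinb l n) q"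
    by (intro tendsto_ip qL sinb_L2 L2 L2norm_cutoff_limit l continuous_intros)
  moreover have "(\<lambda>k. ip l (?r k) q) \<longlonglongrightarrow> 0"
  proof (rule LIMSEQ_I)
    fix e :: real assume "0 < e"
    let ?K = "\<bar>sqrt (2 / l)\<bar> + 1"
    \<comment> \<open>The strip estimate contributes 16 and the cosine at most \<open>?K\<close>, so
      the total is \<open>e / 2\<close>.\<close>
    define e' where "e' = e / (32 * ?K)"
    have e': "0 < e'" using \<open>0 < e\<close> by (simp add: e'_def)
    obtain d0 where d0: "0 < d0" "\<And>x. x \<in> {0..l} \<Longrightarrow> dist x 0 < d0 \<Longrightarrow> dist (q x) (q 0) < e'"
      using q(1)[unfolded continuous_on_iff, rule_format, of 0 e'] e' l by auto
    obtain d1 where d1: "0 < d1" "\<And>x. x \<in> {0..l} \<Longrightarrow> dist x l < d1 \<Longrightarrow> dist (q x) (q l) < e'"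
      using q(1)[unfolded continuous_on_iff, rule_format, of l e'] e' l by auto
    define d where "d = min d0 d1"
    have d: "0 < d" "d \<le> d0" "d \<le> d1" using d0(1) d1(1) by (auto simp: d_def)
    obtain M :: nat where M: "2 / d < real M" using reals_Archimedean2 by blast
    have "norm (ip l (?r k) q - 0) < e" if "k \<ge> M" for k
    proof -
      have "2 / d < real (Suc k)" using M that by simp
      then have small: "2 / real (Suc k) < d"
        using d(1) by (simp add: field_simps)
      have "\<bar>LINT x|leb l. (cosb l n x * q x) * cutoff' l (Suc k) x\<bar> \<le> 16 * (?K * e')"
      proof (rule integral_cutoff'_bound[OF l])
        show "(\<lambda>x. cosb l n x * q x) \<in> L2 l"
          by (intro L2_continuous continuous_intros q)
        fix x assume x: "x \<in> {0<..<l}" and near: "x \<le> 2 / real (Suc k) \<or> l - x \<le> 2 / real (Suc k)"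
        have "\<bar>q x\<bar> < e'"
          using near
        proof
          assume "x \<le> 2 / real (Suc k)"
          then show ?thesis using d0(2)[of x] small d x q(3) by (simp add: dist_real_def)
        next
          assume "l - x \<le> 2 / real (Suc k)"
          then show ?thesis using d1(2)[of x] small d x q(4) by (simp add: dist_real_def)
        qed
        then show "\<bar>cosb l n x * q x\<bar> \<le> ?K * e'"
          unfolding abs_mult using abs_cosb_le[of l n x] by (intro mult_mono) auto
      qed (use e' in auto)
      also have "16 * (?K * e') = e / 2" by (simp add: e'_def field_simps)
      also have "e / 2 < e" using \<open>0 < e\<close> by simp
      finally show ?thesis by (simp add: ip_def mult_ac)
    qed
    then show "\<exists>no. \<forall>k\<ge>no. norm (ip l (?r k) q - 0) < e" by blast
  qed
  ultimately have "(\<lambda>k. ip l (?r k) q - freq l n * ip l (?s k) q) \<longlonglongrightarrow> 0 - freq l n * ip l (sinb l n) q"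
    by (intro tendsto_intros)
  then have "0 - freq l n * ip l (sinb l n) q = - ip l (cosb l n) g"
    unfolding eq using \<open>(\<lambda>k. - ip l (?\<phi> k) g) \<longlonglongrightarrow> - ip l (cosb l n) g\<close> by (rule LIMSEQ_unique)
  moreover have "ip l h (sinb l n) = ip l q (sinb l n)"
    by (rule ip_cong_AE[OF weak_derivD(1)[OF h] qL sinb_L2 q(2)])
  ultimately show ?thesis by (simp add: ip_commute[of l g] ip_commute[of l q])
qed

section \<open>Sobolev spaces in terms of sine coefficients\<close>

text \<open>The sine coefficients of a weak derivative are determined by the function, and sines are
  complete.\<close>

lemma weak_deriv_unique:
  assumes "0 < l" "weak_deriv l f g" "weak_deriv l f g'"
  shows "eq_ae l g g'"
  using assms weak_derivD(2)
  by (intro sc_eq_imp_eq_ae ell2_eqI) (auto simp: ell2_nth_sc ip_weak_deriv_sinb)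

lemma weak_deriv_wd: "weak_deriv l f g \<Longrightarrow> weak_deriv l f (wd l f)"
  unfolding wd_def by (rule someI[where P = "weak_deriv l f"])

lemma eq_ae_refl: "eq_ae l f f"
  by (simp add: eq_ae_def)

lemma Hsob_L2: "f \<in> Hsob m l \<Longrightarrow> f \<in> L2 l"
  by (cases m) (auto dest: weak_derivD)

lemma Hsob_cong:
  assumes "f \<in> Hsob m l" "f' \<in> L2 l" "eq_ae l f f'"
  shows "f' \<in> Hsob m l"
proof (cases m)
  case (Suc k)
  then obtain g where g: "g \<in> Hsob k l" "weak_deriv l f g" using assms by auto
  have "weak_deriv l f' g"
    by (rule weak_deriv_cong[OF g(2) assms(2) weak_derivD(2)[OF g(2)] assms(3) eq_ae_refl])
  with g Suc show ?thesis by auto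
qed (use assms in auto)

text \<open>The derivative picked by \<open>wd\<close> agrees with the witness in
  \<open>Hsob\<close> only almost everywhere, so invariance of \<open>Hsob\<close> under such
  changes is needed.\<close>

lemma Hsob_Suc_wd:
  assumes "0 < l" "f \<in> Hsob (Suc m) l"
  shows "weak_deriv l f (wd l f)" "wd l f \<in> Hsob m l"
proof -
  obtain g where g: "g \<in> Hsob m l" "weak_deriv l f g" using assms by auto
  show wd: "weak_deriv l f (wd l f)" using g(2) by (rule weak_deriv_wd)
  show "wd l f \<in> Hsob m l"
    by (rule Hsob_cong[OF g(1) weak_derivD(2)[OF wd] weak_deriv_unique[OF assms(1) g(2) wd]])
qed

lemma H1norm_squared:
  assumes "weak_deriv l f g" "0 < l"
  shows "(H1norm l f)\<^sup>2 = (L2norm l f)\<^sup>2 + (L2norm l g)\<^sup>2"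
proof -
  note wd = weak_deriv_wd[OF assms(1)]
  have "(LINT x|leb l. (f x)\<^sup>2 + (wd l f x)\<^sup>2) = (LINT x|leb l. (f x)\<^sup>2) + (LINT x|leb l. (wd l f x)\<^sup>2)"
    using weak_derivD(1,2)[OF wd] by (intro Bochner_Integration.integral_add L2_square_integrable)
  moreover have "0 \<le> (LINT x|leb l. (f x)\<^sup>2 + (wd l f x)\<^sup>2)" by simp
  ultimately have "(H1norm l f)\<^sup>2 = (L2norm l f)\<^sup>2 + (L2norm l (wd l f))\<^sup>2"
    by (simp add: H1norm_def L2norm_def)
  also have "L2norm l (wd l f) = L2norm l g"
    by (intro L2norm_cong_AE weak_derivD(2)[OF wd] weak_derivD(2)[OF assms(1)]
        weak_deriv_unique[OF assms(2) wd assms(1)])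
  finally show ?thesis .
qed

lemma H10_iff_H0_pair:
  assumes l: "0 < l"
  shows "f \<in> H10 l \<and> weak_deriv l f g \<longleftrightarrow> H0_pair l f g"
proof
  assume f: "f \<in> H10 l \<and> weak_deriv l f g"
  show "H0_pair l f g"
    unfolding H0_pair_def
  proof (intro conjI allI impI)
    show "f \<in> L2 l" "g \<in> L2 l" using f weak_derivD by auto
    fix e :: real assume "0 < e"
    then obtain \<phi> where \<phi>: "\<phi> \<in> C1c l" "H1norm l (f - \<phi>) < e"
      using f unfolding H10_def by blast
    have "weak_deriv l (f - \<phi>) (g - deriv \<phi>)"
      using f weak_deriv_C1c[OF l \<phi>(1)] by (blast intro: weak_deriv_diff)
    from H1norm_squared[OF this l]
    have "(L2norm l (f - \<phi>))\<^sup>2 \<le> (H1norm l (f - \<phi>))\<^sup>2" "(L2norm l (g - deriv \<phi>))\<^sup>2 \<le> (H1norm l (f - \<phi>))\<^sup>2"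
      by simp_all
    moreover have "0 \<le> H1norm l (f - \<phi>)" by (simp add: H1norm_def)
    ultimately have "L2norm l (f - \<phi>) \<le> H1norm l (f - \<phi>)" "L2norm l (g - deriv \<phi>) \<le> H1norm l (f - \<phi>)"
      by (auto intro: power2_le_imp_le)
    then show "\<exists>\<phi>\<in>C1c l. L2norm l (f - \<phi>) < e \<and> L2norm l (g - deriv \<phi>) < e"
      using \<phi> by (intro bexI[of _ \<phi>]) auto
  qed
next
  assume f: "H0_pair l f g"
  then have wd: "weak_deriv l f g" by (rule H0_pair_imp_weak_deriv[OF l])
  have "f \<in> Hsob 1 l" using wd weak_derivD(2)[OF wd] by auto
  moreover have "\<exists>\<phi>\<in>C1c l. H1norm l (f - \<phi>) < e" if e: "0 < e" for e
  proof -
    obtain \<phi> where \<phi>: "\<phi> \<in> C1c l" "L2norm l (f - \<phi>) < e / 2" "L2norm l (g - deriv \<phi>) < e / 2"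
      using f half_gt_zero[OF e] unfolding H0_pair_def by blast
    have "weak_deriv l (f - \<phi>) (g - deriv \<phi>)"
      using wd weak_deriv_C1c[OF l \<phi>(1)] by (rule weak_deriv_diff)
    from H1norm_squared[OF this l]
    have "(H1norm l (f - \<phi>))\<^sup>2 \<le> (L2norm l (f - \<phi>) + L2norm l (g - deriv \<phi>))\<^sup>2"
      using L2norm_nonneg by (simp add: power2_sum)
    then have "H1norm l (f - \<phi>) \<le> L2norm l (f - \<phi>) + L2norm l (g - deriv \<phi>)"
      by (rule power2_le_imp_le) (simp add: L2norm_nonneg)
    then show ?thesis using \<phi> by (intro bexI[of _ \<phi>]) auto
  qed
  ultimately show "f \<in> H10 l \<and> weak_deriv l f g" using wd by (simp add: H10_def)
qed

lemma H2_H10_coeff: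
  assumes l: "0 < l" and w: "w \<in> Hsob 2 l" "w \<in> H10 l"
  shows "wd l (wd l w) \<in> L2 l"
    and "ell2_nth (sc l (wd l (wd l w))) n = - ((freq l n)\<^sup>2 * ell2_nth (sc l w) n)"
proof -
  note wd1 = Hsob_Suc_wd[OF l, of w 1] and wd2 = Hsob_Suc_wd[OF l, of "wd l w" 0]
  have w1: "weak_deriv l w (wd l w)" "wd l w \<in> Hsob 1 l"
    using wd1 w(1) by (simp_all add: numeral_2_eq_2)
  have w2: "weak_deriv l (wd l w) (wd l (wd l w))"
    using wd2 w1(2) by simp
  show L2: "wd l (wd l w) \<in> L2 l" using w2 by (rule weak_derivD)
  have "H0_pair l w (wd l w)" using H10_iff_H0_pair[OF l] w(2) w1(1) by blast
  then have "ip l (wd l w) (cosb l n) = freq l n * ip l w (sinb l n)"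
    by (rule ip_H0_pair_cosb[OF l])
  moreover have "ip l (wd l (wd l w)) (sinb l n) = - freq l n * ip l (wd l w) (cosb l n)"
    by (rule ip_weak_deriv_sinb[OF l w2])
  ultimately show "ell2_nth (sc l (wd l (wd l w))) n = - ((freq l n)\<^sup>2 * ell2_nth (sc l w) n)"
    using weak_derivD(1)[OF w1(1)] L2 l by (simp add: ell2_nth_sc power2_eq_square)
qed

text \<open>Termwise differentiation: the first derivative is rebuilt as a cosine series with
  coefficients \<open>a n / freq l n\<close>, and both \<open>H0_pair\<close> and
  \<open>weak_deriv\<close> are closed under limits in square mean.\<close>

lemma H2_H10_I:
  assumes l: "0 < l" and w: "w \<in> L2 l" "\<And>n. ell2_nth (sc l w) n = ell2_nth a n / (freq l n)\<^sup>2"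
  obtains w' where "H0_pair l w w'" "weak_deriv l w' (- syn l a)"
proof -
  have "summable (\<lambda>n. (ell2_nth a n / freq l n)\<^sup>2)"
  proof (rule summable_comparison_test'[OF summable_mult[OF summable_ell2, of "(l / pi)\<^sup>2" a]])
    fix n :: nat
    have "pi / l \<le> freq l n" using l by (simp add: freq_def field_simps)
    then have "1 / freq l n \<le> 1 / (pi / l)"
      using l freq_pos[OF l, of n] by (intro divide_left_mono mult_pos_pos) auto
    then have "(1 / freq l n)\<^sup>2 \<le> (l / pi)\<^sup>2"
      using freq_pos[OF l, of n] by (intro power_mono) auto
    then have "(1 / freq l n)\<^sup>2 * (ell2_nth a n)\<^sup>2 \<le> (l / pi)\<^sup>2 * (ell2_nth a n)\<^sup>2"
      by (rule mult_right_mono) simp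
    then show "norm ((ell2_nth a n / freq l n)\<^sup>2) \<le> (l / pi)\<^sup>2 * (ell2_nth a n)\<^sup>2"
      by (simp add: power_divide)
  qed
  then obtain w' where w': "w' \<in> L2 l"
    "(\<lambda>N. L2norm l (w' - (\<Sum>i<N. (ell2_nth a i / freq l i) *\<^sub>R cosb l i))) \<longlonglongrightarrow> 0"
    by (rule Riesz_Fischer[OF less_imp_le[OF l] cosb_L2 ip_cosb_cosb[OF l]])
  let ?c = "\<lambda>i. ell2_nth (sc l w) i"
  have lim_w: "(\<lambda>N. L2norm l (w - (\<Sum>i<N. ?c i *\<^sub>R sinb l i))) \<longlonglongrightarrow> 0"
  proof -
    have S: "(\<Sum>i<N. ?c i *\<^sub>R sinb l i) \<in> L2 l" for N by (intro L2_sum L2_scaleR sinb_L2)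
    have "eq_ae l (syn l (sc l w)) w"
      using sc_syn[OF l] syn(1)[OF l] w(1) by (intro sc_eq_imp_eq_ae l) auto
    then have "L2norm l (syn l (sc l w) - (\<Sum>i<N. ?c i *\<^sub>R sinb l i)) = L2norm l (w - (\<Sum>i<N. ?c i *\<^sub>R sinb l i))" for N
      by (intro L2norm_cong_AE L2_diff syn(1) w(1) l S) (auto simp: eq_ae_def)
    then show ?thesis using syn(2)[OF l, of "sc l w"] by simp
  qed
  have "H0_pair l w w'"
  proof (rule H0_pair_limit[OF _ w(1) w'(1) lim_w w'(2)])
    fix N
    have "H0_pair l (?c i *\<^sub>R sinb l i) ((ell2_nth a i / freq l i) *\<^sub>R cosb l i)" for i
      using H0_pair_scaleR[OF H0_pair_sinb[OF l], of "?c i" i] w(2)[of i] freq_pos[OF l, of i]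
      by (simp add: power2_eq_square)
    then show "H0_pair l (\<Sum>i<N. ?c i *\<^sub>R sinb l i) (\<Sum>i<N. (ell2_nth a i / freq l i) *\<^sub>R cosb l i)"
      by (intro H0_pair_sum)
  qed
  moreover have "weak_deriv l w' (- syn l a)"
  proof (rule weak_deriv_limit[OF _ w'(1) L2_uminus[OF syn(1)[OF l]] w'(2)])
    fix N
    have "weak_deriv l ((ell2_nth a i / freq l i) *\<^sub>R cosb l i) (- (ell2_nth a i *\<^sub>R sinb l i))" for i
      using weak_deriv_scaleR[OF weak_deriv_cosb[OF l], of "ell2_nth a i / freq l i" i] freq_pos[OF l, of i]
      by simp
    then show "weak_deriv l (\<Sum>i<N. (ell2_nth a i / freq l i) *\<^sub>R cosb l i) (\<Sum>i<N. - (ell2_nth a i *\<^sub>R sinb l i))"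
      by (intro weak_deriv_sum)
  next
    have "L2norm l (- syn l a - (\<Sum>i<N. - (ell2_nth a i *\<^sub>R sinb l i)))
        = L2norm l (syn l a - (\<Sum>i<N. ell2_nth a i *\<^sub>R sinb l i))" for N
      by (subst L2norm_uminus[symmetric]) (simp add: sum_negf)
    then show "(\<lambda>N. L2norm l (- syn l a - (\<Sum>i<N. - (ell2_nth a i *\<^sub>R sinb l i)))) \<longlonglongrightarrow> 0"
      using syn(2)[OF l, of a] by simp
  qed
  ultimately show ?thesis by (rule that)
qed

section \<open>Multipliers on \<open>\<ell>\<^sup>2\<close>\<close>

definition mul :: "(nat \<Rightarrow> real) \<Rightarrow> ell2 \<Rightarrow> ell2" where
  "mul m a = Abs_ell2 (\<lambda>n. m n * ell2_nth a n)"

lemma mul: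
  assumes "\<And>n. \<bar>m n\<bar> \<le> B"
  shows ell2_nth_mul: "ell2_nth (mul m a) n = m n * ell2_nth a n"
    and norm_mul_le: "norm (mul m a) \<le> B * norm a"
proof -
  have B: "0 \<le> B" using assms[of 0] by linarith
  have le: "(m n * ell2_nth a n)\<^sup>2 \<le> B\<^sup>2 * (ell2_nth a n)\<^sup>2" for n
    unfolding power_mult_distrib using power_mono[OF assms[of n], of 2]
    by (intro mult_right_mono) auto
  have "summable (\<lambda>n. (m n * ell2_nth a n)\<^sup>2)"
    using le by (intro summable_comparison_test'[OF summable_mult[OF summable_ell2, of "B\<^sup>2" a]]) auto
  then have nth: "ell2_nth (mul m a) = (\<lambda>n. m n * ell2_nth a n)"
    by (simp add: mul_def Abs_ell2_inverse)
  then show "ell2_nth (mul m a) n = m n * ell2_nth a n" by simp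
  have "(\<Sum>n<N. (ell2_nth (mul m a) n)\<^sup>2) \<le> (B * norm a)\<^sup>2" for N
  proof -
    have "(\<Sum>n<N. (ell2_nth (mul m a) n)\<^sup>2) \<le> (\<Sum>n<N. B\<^sup>2 * (ell2_nth a n)\<^sup>2)"
      unfolding nth by (intro sum_mono le)
    also have "\<dots> = B\<^sup>2 * (\<Sum>n<N. (ell2_nth a n)\<^sup>2)" by (simp add: sum_distrib_left)
    also have "\<dots> \<le> B\<^sup>2 * (norm a)\<^sup>2"
      by (intro mult_left_mono sum_squares_le_norm_ell2) auto
    finally show ?thesis by (simp add: power_mult_distrib)
  qed
  then show "norm (mul m a) \<le> B * norm a"
    using B by (intro norm_ell2_leI) auto
qed

lemma bounded_linear_mul:
  assumes "\<And>n. \<bar>m n\<bar> \<le> B"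
  shows "bounded_linear (mul m)"
proof (rule bounded_linear_intro[of _ B])
  show "mul m (a + b) = mul m a + mul m b" for a b
    by (rule ell2_eqI) (simp add: ell2_nth_mul[OF assms] distrib_left)
  show "mul m (r *\<^sub>R a) = r *\<^sub>R mul m a" for r a
    by (rule ell2_eqI) (simp add: ell2_nth_mul[OF assms])
  show "norm (mul m a) \<le> norm a * B" for a
    using norm_mul_le[of m B a, OF assms] by (simp add: mult.commute)
qed

text \<open>Cutting off makes any multiplier bounded, also the unbounded frequencies and dampings of
  the beam.\<close>

definition trunc :: "nat \<Rightarrow> (nat \<Rightarrow> real) \<Rightarrow> nat \<Rightarrow> real" where
  "trunc N m n = (if n < N then m n else 0)"

lemma abs_trunc_le: "\<bar>trunc N m n\<bar> \<le> (\<Sum>i<N. \<bar>m i\<bar>)"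
  using member_le_sum[of n "{..<N}" "\<lambda>i. \<bar>m i\<bar>"] by (auto simp: trunc_def intro: sum_nonneg)

lemma ell2_nth_mul_trunc [simp]: "ell2_nth (mul (trunc N m) a) n = trunc N m n * ell2_nth a n"
  by (rule ell2_nth_mul[OF abs_trunc_le])

lemma bounded_linear_mul_trunc: "bounded_linear (mul (trunc N m))"
  by (rule bounded_linear_mul[OF abs_trunc_le])

lemma norm_mul_trunc_1_le: "norm (mul (trunc N (\<lambda>_. 1)) a) \<le> norm a"
  using norm_mul_le[of "trunc N (\<lambda>_. 1)" 1 a] by (simp add: trunc_def)

lemma mul_trunc_1_tendsto: "(\<lambda>N. mul (trunc N (\<lambda>_. 1)) a) \<longlonglongrightarrow> a"
proof -
  have eq: "(norm (mul (trunc N (\<lambda>_. 1)) a - a))\<^sup>2 = (norm a)\<^sup>2 - (\<Sum>n<N. (ell2_nth a n)\<^sup>2)" for N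
  proof -
    let ?f = "\<lambda>n. if n < N then (ell2_nth a n)\<^sup>2 else 0"
    have f: "?f sums (\<Sum>n<N. ?f n)" by (rule sums_finite) auto
    have "(norm (mul (trunc N (\<lambda>_. 1)) a - a))\<^sup>2 = (\<Sum>n. (ell2_nth a n)\<^sup>2 - ?f n)"
      unfolding norm_ell2_squared by (intro suminf_cong) (simp add: trunc_def)
    also have "\<dots> = (\<Sum>n. (ell2_nth a n)\<^sup>2) - (\<Sum>n. ?f n)"
      using sums_summable[OF f] by (intro suminf_diff[symmetric]) auto
    also have "(\<Sum>n. ?f n) = (\<Sum>n<N. (ell2_nth a n)\<^sup>2)"
      using sums_unique[OF f] by simp
    finally show ?thesis by (simp add: norm_ell2_squared)
  qed
  have "(\<lambda>N. \<Sum>n<N. (ell2_nth a n)\<^sup>2) \<longlonglongrightarrow> (norm a)\<^sup>2"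
    unfolding norm_ell2_squared by (rule summable_LIMSEQ) simp
  then have "(\<lambda>N. (norm a)\<^sup>2 - (\<Sum>n<N. (ell2_nth a n)\<^sup>2)) \<longlonglongrightarrow> (norm a)\<^sup>2 - (norm a)\<^sup>2"
    by (intro tendsto_intros)
  then have "(\<lambda>N. sqrt ((norm (mul (trunc N (\<lambda>_. 1)) a - a))\<^sup>2)) \<longlonglongrightarrow> sqrt 0"
    unfolding eq by (intro tendsto_real_sqrt) simp
  then have "(\<lambda>N. norm (mul (trunc N (\<lambda>_. 1)) a - a)) \<longlonglongrightarrow> 0" by simp
  then show ?thesis by (simp add: LIM_zero_iff tendsto_norm_zero_iff)
qed

lemma inner_mul_trunc: "mul (trunc N m) a \<bullet> b = (\<Sum>n<N. m n * ell2_nth a n * ell2_nth b n)"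
proof -
  have "mul (trunc N m) a \<bullet> b = (\<Sum>n. if n < N then m n * ell2_nth a n * ell2_nth b n else 0)"
    unfolding inner_ell2_def by (intro suminf_cong) (simp add: trunc_def)
  also have "\<dots> = (\<Sum>n<N. if n < N then m n * ell2_nth a n * ell2_nth b n else 0)"
    by (rule suminf_finite) auto
  finally show ?thesis by simp
qed

section \<open>Norm calculus in coordinates\<close>

lemma has_vector_derivative_iff_quotient:
  "(f has_vector_derivative D) (at t within S) \<longleftrightarrow>
     ((\<lambda>s. norm ((1 / (s - t)) *\<^sub>R (f s - f t) - D)) \<longlongrightarrow> 0) (at t within S)"
proof -
  have "\<forall>\<^sub>F s in at t within S. norm (f s - f t - (s - t) *\<^sub>R D) / norm (s - t)
      = norm ((1 / (s - t)) *\<^sub>R (f s - f t) - D)"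
    unfolding eventually_at_filter
  proof (intro always_eventually allI impI)
    fix s assume "s \<noteq> t" "s \<in> S"
    then have "(1 / (s - t)) *\<^sub>R (f s - f t) - D = (1 / (s - t)) *\<^sub>R (f s - f t - (s - t) *\<^sub>R D)"
      by (simp add: scaleR_diff_right)
    then show "norm (f s - f t - (s - t) *\<^sub>R D) / norm (s - t)
        = norm ((1 / (s - t)) *\<^sub>R (f s - f t) - D)" by simp
  qed
  then have "((\<lambda>s. norm (f s - f t - (s - t) *\<^sub>R D) / norm (s - t)) \<longlongrightarrow> 0) (at t within S)
      \<longleftrightarrow> ((\<lambda>s. norm ((1 / (s - t)) *\<^sub>R (f s - f t) - D)) \<longlongrightarrow> 0) (at t within S)"
    by (rule filterlim_cong[OF refl refl])
  then show ?thesis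
    unfolding has_vector_derivative_def has_derivative_iff_norm
    by (simp add: bounded_linear_scaleR_left)
qed

text \<open>Carries calculus with an explicit norm functional on a set of raw functions over to
  calculus in a genuine normed space. The map need only be linear on \<open>C\<close> and isometric
  up to the factor \<open>r\<close>.\<close>

locale coordinates =
  fixes C :: "'v::real_vector set" and N :: "'v \<Rightarrow> real" and c :: "'v \<Rightarrow> 'h::real_normed_vector"
    and r :: real
  assumes r: "0 < r"
    and C_diff: "x \<in> C \<Longrightarrow> y \<in> C \<Longrightarrow> x - y \<in> C"
    and C_scaleR: "x \<in> C \<Longrightarrow> a *\<^sub>R x \<in> C"
    and c_diff: "x \<in> C \<Longrightarrow> y \<in> C \<Longrightarrow> c (x - y) = c x - c y"
    and c_scaleR: "x \<in> C \<Longrightarrow> c (a *\<^sub>R x) = a *\<^sub>R c x"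
    and N_eq: "x \<in> C \<Longrightarrow> N x = r * norm (c x)"
begin

lemma scaled_limit:
  assumes "\<And>s. s \<in> S \<Longrightarrow> g s = r * h s"
  shows "(g \<longlongrightarrow> 0) (at t within S) \<longleftrightarrow> (h \<longlongrightarrow> 0) (at t within S)"
proof -
  have "\<forall>\<^sub>F s in at t within S. g s = r * h s"
    using assms by (simp add: eventually_at_filter)
  then have "(g \<longlongrightarrow> 0) (at t within S) \<longleftrightarrow> ((\<lambda>s. r * h s) \<longlongrightarrow> 0) (at t within S)"
    by (rule filterlim_cong[OF refl refl])
  also have "\<dots> \<longleftrightarrow> (h \<longlongrightarrow> 0) (at t within S)"
    using r tendsto_mult_left_iff[of r h 0] by simp
  finally show ?thesis .
qed

lemma norm_continuous_on_iff:
  assumes "\<And>t. t \<in> S \<Longrightarrow> x t \<in> C"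
  shows "norm_continuous_on N S x \<longleftrightarrow> continuous_on S (\<lambda>t. c (x t))"
  unfolding norm_continuous_on_def continuous_on_def
proof (intro ball_cong refl)
  fix t assume t: "t \<in> S"
  have "((\<lambda>s. N (x s - x t)) \<longlongrightarrow> 0) (at t within S)
      \<longleftrightarrow> ((\<lambda>s. norm (c (x s) - c (x t))) \<longlongrightarrow> 0) (at t within S)"
    using assms t by (intro scaled_limit) (simp add: N_eq C_diff c_diff)
  then show "((\<lambda>s. N (x s - x t)) \<longlongrightarrow> 0) (at t within S)
      \<longleftrightarrow> ((\<lambda>s. c (x s)) \<longlongrightarrow> c (x t)) (at t within S)"
    by (simp add: tendsto_norm_zero_iff LIM_zero_iff)
qed

lemma has_norm_derivative_iff:
  assumes "\<And>s. s \<in> S \<Longrightarrow> x s \<in> C" "x t \<in> C" "d \<in> C"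
  shows "has_norm_derivative N S x d t \<longleftrightarrow> ((\<lambda>s. c (x s)) has_vector_derivative c d) (at t within S)"
  unfolding has_norm_derivative_def has_vector_derivative_iff_quotient
  using assms by (intro scaled_limit) (simp add: N_eq C_diff C_scaleR c_diff c_scaleR)

lemma C1_with_iff:
  "C1_with C N S x x' \<longleftrightarrow> (\<forall>t\<in>S. x t \<in> C \<and> x' t \<in> C \<and>
     ((\<lambda>s. c (x s)) has_vector_derivative c (x' t)) (at t within S)) \<and> continuous_on S (\<lambda>t. c (x' t))"
  unfolding C1_with_def using norm_continuous_on_iff[of S x'] has_norm_derivative_iff[of S x] by blast

end

lemma coordinates_L2: "0 < l \<Longrightarrow> coordinates (L2 l) (L2norm l) (sc l) 1"
  by unfold_locales (auto simp: L2_diff L2_scaleR sc_diff sc_scaleR norm_sc)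

section \<open>The railway track in coordinates\<close>

lemma mem_H2_H10_iff:
  assumes l: "0 < l"
  shows "w \<in> Hsob 2 l \<inter> H10 l \<longleftrightarrow>
    w \<in> L2 l \<and> (\<exists>a. \<forall>n. ell2_nth (sc l w) n = ell2_nth a n / (freq l n)\<^sup>2)"
proof
  assume w: "w \<in> Hsob 2 l \<inter> H10 l"
  have "ell2_nth (sc l w) n = ell2_nth (- sc l (wd l (wd l w))) n / (freq l n)\<^sup>2" for n
    using H2_H10_coeff(2)[OF l, of w n] w freq_pos[OF l, of n] by simp
  then show "w \<in> L2 l \<and> (\<exists>a. \<forall>n. ell2_nth (sc l w) n = ell2_nth a n / (freq l n)\<^sup>2)"
    using w Hsob_L2 by blast
next
  assume "w \<in> L2 l \<and> (\<exists>a. \<forall>n. ell2_nth (sc l w) n = ell2_nth a n / (freq l n)\<^sup>2)"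
  then obtain a where a: "w \<in> L2 l" "\<And>n. ell2_nth (sc l w) n = ell2_nth a n / (freq l n)\<^sup>2" by blast
  obtain w' where w': "H0_pair l w w'" "weak_deriv l w' (- syn l a)"
    by (rule H2_H10_I[OF l a])
  have "weak_deriv l w w'" using w'(1) by (rule H0_pair_imp_weak_deriv[OF l])
  then have "w \<in> Hsob 2 l"
    using w'(2) weak_derivD(2)[OF w'(2)] by (auto simp: numeral_2_eq_2)
  then show "w \<in> Hsob 2 l \<inter> H10 l" using H10_iff_H0_pair[OF l] w'(1) by blast
qed

text \<open>Four integrations by parts alternate between sines, where no boundary condition is
  needed, and cosines, where the vanishing of \<open>h''\<close> and then of \<open>h\<close> at the
  ends is used.\<close>

lemma domA0_coeff:
  assumes l: "0 < tlen p" and h: "h \<in> domA0 p"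
  shows "h \<in> L2 (tlen p)" "A0 p h \<in> L2 (tlen p)"
    and "ell2_nth (sc (tlen p) (A0 p h)) n = (freq (tlen p) n) ^ 4 * ell2_nth (sc (tlen p) h) n"
proof -
  let ?l = "tlen p"
  let ?h1 = "wd ?l h" let ?h2 = "wd ?l ?h1" let ?h3 = "wd ?l ?h2" let ?h4 = "wd ?l ?h3"
  have H: "h \<in> Hsob (Suc (Suc (Suc (Suc 0)))) ?l" and v: "vanishes_at_ends ?l h" "vanishes_at_ends ?l ?h2"
    using h by (auto simp: domA0_def eval_nat_numeral simp del: Hsob.simps)
  note s1 = Hsob_Suc_wd[OF l H] note s2 = Hsob_Suc_wd[OF l s1(2)]
  note s3 = Hsob_Suc_wd[OF l s2(2)] note s4 = Hsob_Suc_wd[OF l s3(2)]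
  show hL: "h \<in> L2 ?l" using s1(1) by (rule weak_derivD)
  have A: "A0 p h = ?h4" by (simp add: A0_def eval_nat_numeral)
  show AL: "A0 p h \<in> L2 ?l" unfolding A using s4(1) by (rule weak_derivD)
  have "ip ?l ?h4 (sinb ?l n) = (freq ?l n) ^ 4 * ip ?l h (sinb ?l n)"
    using ip_weak_deriv_sinb[OF l s4(1), of n] ip_vanishing_cosb[OF l s3(1) v(2), of n]
      ip_weak_deriv_sinb[OF l s2(1), of n] ip_vanishing_cosb[OF l s1(1) v(1), of n]
    by (simp add: eval_nat_numeral)
  then show "ell2_nth (sc ?l (A0 p h)) n = (freq ?l n) ^ 4 * ell2_nth (sc ?l h) n"
    using hL AL by (simp add: ell2_nth_sc[OF l] A)
qed

text \<open>\<open>sser l a\<close> has the same coefficients and is the continuous representative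
  required.\<close>

lemma vanishes_at_ends_I:
  assumes l: "0 < l" and f: "f \<in> L2 l" "\<And>n. ell2_nth (sc l f) n = ell2_nth a n / (freq l n)\<^sup>2"
  shows "vanishes_at_ends l f"
proof -
  have "sc l f = sc l (sser l a)"
    by (rule ell2_eqI) (simp add: f(2) ell2_nth_sc_sser[OF l])
  then have "eq_ae l f (sser l a)" by (intro sc_eq_imp_eq_ae l f sser_L2)
  then show ?thesis
    unfolding vanishes_at_ends_def using continuous_sser[OF l] sser_at_ends[OF l] by blast
qed

lemma domA0_I:
  assumes l: "0 < tlen p" and h: "h \<in> L2 (tlen p)"
    "\<And>n. ell2_nth (sc (tlen p) h) n = ell2_nth b n / (freq (tlen p) n) ^ 4"
  shows "h \<in> domA0 p"
proof -
  let ?l = "tlen p"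
  \<comment> \<open>Both \<open>a\<close> and \<open>b\<close> are coefficient sequences:
    \<open>h\<close> has the form that \<open>H2_H10_I\<close> needs relative to \<open>a\<close>,
    and so has its second derivative relative to \<open>- b\<close>.\<close>
  define a where "a = sc ?l (sser ?l b)"
  have a: "ell2_nth a n = ell2_nth b n / (freq ?l n)\<^sup>2" for n
    by (simp add: a_def ell2_nth_sc_sser[OF l])
  have ha: "ell2_nth (sc ?l h) n = ell2_nth a n / (freq ?l n)\<^sup>2" for n
    by (simp add: h(2) a eval_nat_numeral)
  obtain w' where w': "H0_pair ?l h w'" "weak_deriv ?l w' (- syn ?l a)"
    by (rule H2_H10_I[OF l h(1) ha])
  have hw: "weak_deriv ?l h w'" using w'(1) by (rule H0_pair_imp_weak_deriv[OF l])
  have L: "- syn ?l a \<in> L2 ?l" by (intro L2_uminus syn l)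
  have c: "ell2_nth (sc ?l (- syn ?l a)) n = ell2_nth (- b) n / (freq ?l n)\<^sup>2" for n
    by (simp add: sc_uminus[OF l syn(1)[OF l]] sc_syn[OF l] a)
  then have "- syn ?l a \<in> Hsob 2 ?l"
    using mem_H2_H10_iff[OF l, of "- syn ?l a"] L by blast
  then have H4: "h \<in> Hsob (Suc (Suc (Suc (Suc 0)))) ?l"
    using hw w'(2) by (auto simp: numeral_2_eq_2)
  note s1 = Hsob_Suc_wd[OF l H4] note s2 = Hsob_Suc_wd[OF l s1(2)]
  \<comment> \<open>The boundary condition on the second derivative is phrased with
    \<open>wd\<close>, so the constructed derivatives are matched with the chosen ones.\<close>
  have "eq_ae ?l w' (wd ?l h)" by (rule weak_deriv_unique[OF l hw s1(1)])
  then have "weak_deriv ?l (wd ?l h) (- syn ?l a)"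
    by (rule weak_deriv_cong[OF w'(2) weak_derivD(2)[OF s1(1)] L _ eq_ae_refl])
  then have "eq_ae ?l (wd ?l (wd ?l h)) (- syn ?l a)"
    by (rule weak_deriv_unique[OF l s2(1)])
  then have sc2: "sc ?l (wd ?l (wd ?l h)) = sc ?l (- syn ?l a)"
    by (rule eq_ae_imp_sc_eq[OF l weak_derivD(2)[OF s2(1)] L])
  have "vanishes_at_ends ?l h" by (rule vanishes_at_ends_I[OF l h(1) ha])
  moreover have "vanishes_at_ends ?l (wd ?l (wd ?l h))"
    by (rule vanishes_at_ends_I[OF l weak_derivD(2)[OF s2(1)], of "- b"]) (simp only: sc2 c)
  moreover have "h \<in> Hsob 4 ?l" using H4 by (simp add: eval_nat_numeral)
  ultimately show ?thesis by (simp add: domA0_def)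
qed

section \<open>The modal system and its truncations\<close>

locale track_model =
  fixes p :: track
  assumes params: "track_params p"
begin

abbreviation "l \<equiv> tlen p"
definition "ra = trho p * ta p"
definition "EI = tE p * tI p"

lemma pos: "0 < l" "0 < ra" "0 < EI" "0 < tk p" "0 < talpha p" "0 < tmu p" "0 \<le> tCd p"
  using params by (auto simp: track_params_def ra_def EI_def)

text \<open>\<open>sg\<close> and \<open>dm\<close> are the \<open>\<sigma>\<^sub>n\<close> and \<open>d\<^sub>n\<close> of the introduction; \<open>to_H2\<close> turns the coordinate
  \<open>\<sigma>\<^sub>n w\<^sub>n\<close> into the coefficient of \<open>- w''\<close>, and \<open>ww\<close> recovers \<open>w\<close> from it.\<close>

definition sg :: "nat \<Rightarrow> real" where
  "sg n = sqrt ((EI * freq l n ^ 4 + tk p) / ra)"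

definition dm :: "nat \<Rightarrow> real" where
  "dm n = (tCd p * freq l n ^ 4 + tmu p) / ra"

lemma freq_p: "0 < freq l n"
  by (rule freq_pos[OF pos(1)])

lemma sg_squared: "ra * (sg n)\<^sup>2 = EI * freq l n ^ 4 + tk p"
  using pos freq_p[of n] by (simp add: sg_def)

lemma ra_dm: "ra * dm n = tCd p * freq l n ^ 4 + tmu p"
  using pos by (simp add: dm_def)

lemma sg_pos: "0 < sg n"
  using pos freq_p[of n] by (auto simp: sg_def intro!: divide_pos_pos add_pos_pos mult_pos_pos)

lemma dm_nonneg: "0 \<le> dm n"
  using pos freq_p[of n] by (auto simp: dm_def intro!: divide_nonneg_pos add_nonneg_nonneg mult_nonneg_nonneg)

text \<open>\<open>sg n\<close> and the squared frequency are comparable in both directions, since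
  frequencies are bounded below by \<open>pi / l\<close>. This is the equivalence of the energy norm
  with the norm of the second derivative.\<close>

lemma sg_ratio_bounds:
  "\<bar>(freq l n)\<^sup>2 / sg n\<bar> \<le> sqrt (ra / EI)"
  "\<bar>sg n / (freq l n)\<^sup>2\<bar> \<le> sqrt ((EI + tk p * (l / pi) ^ 4) / ra)"
proof -
  have f: "0 < freq l n" by (rule freq_p)
  have f4: "((freq l n)\<^sup>2)\<^sup>2 = freq l n ^ 4" by (simp flip: power_mult)
  have "((freq l n)\<^sup>2 / sg n)\<^sup>2 \<le> ra / EI"
  proof -
    have "EI * freq l n ^ 4 \<le> ra * (sg n)\<^sup>2" using pos by (simp add: sg_squared)
    then show ?thesis
      using pos sg_pos[of n] unfolding power_divide f4 by (simp add: divide_le_eq pos_le_divide_eq mult.commute)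
  qed
  then have "\<bar>(freq l n)\<^sup>2 / sg n\<bar>\<^sup>2 \<le> (sqrt (ra / EI))\<^sup>2"
    unfolding power2_abs using pos by simp
  then show "\<bar>(freq l n)\<^sup>2 / sg n\<bar> \<le> sqrt (ra / EI)"
    by (rule power2_le_imp_le) (use pos in simp)
  have "pi / l \<le> freq l n" using pos by (simp add: freq_def field_simps)
  then have "1 / freq l n \<le> 1 / (pi / l)"
    using pos f by (intro divide_left_mono mult_pos_pos) auto
  then have "(1 / freq l n) ^ 4 \<le> (l / pi) ^ 4"
    using f by (intro power_mono) auto
  then have "tk p * (1 / freq l n) ^ 4 \<le> tk p * (l / pi) ^ 4"
    using pos by (intro mult_left_mono) auto
  then have "(EI + tk p * (1 / freq l n) ^ 4) / ra \<le> (EI + tk p * (l / pi) ^ 4) / ra"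
    using pos by (intro divide_right_mono) auto
  moreover have "(sg n / (freq l n)\<^sup>2)\<^sup>2 = (EI + tk p * (1 / freq l n) ^ 4) / ra"
  proof -
    have "(sg n)\<^sup>2 = (EI * freq l n ^ 4 + tk p) / ra"
      using sg_squared[of n] pos by (simp add: field_simps)
    then show ?thesis
      unfolding power_divide f4 using f by (simp add: add_divide_distrib)
  qed
  ultimately have "\<bar>sg n / (freq l n)\<^sup>2\<bar>\<^sup>2 \<le> (sqrt ((EI + tk p * (l / pi) ^ 4) / ra))\<^sup>2"
    unfolding power2_abs using pos by simp
  then show "\<bar>sg n / (freq l n)\<^sup>2\<bar> \<le> sqrt ((EI + tk p * (l / pi) ^ 4) / ra)"
    by (rule power2_le_imp_le) (use pos in simp)
qed

definition to_H2 :: "ell2 \<Rightarrow> ell2" where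
  "to_H2 = mul (\<lambda>n. (freq l n)\<^sup>2 / sg n)"

lemma ell2_nth_to_H2: "ell2_nth (to_H2 a) n = (freq l n)\<^sup>2 / sg n * ell2_nth a n"
  unfolding to_H2_def by (rule ell2_nth_mul[OF sg_ratio_bounds(1)])

lemma norm_to_H2_le: "norm (to_H2 a) \<le> sqrt (ra / EI) * norm a"
  unfolding to_H2_def by (rule norm_mul_le[OF sg_ratio_bounds(1)])

definition PP :: "nat \<Rightarrow> ell2 \<times> ell2 \<Rightarrow> ell2 \<times> ell2" where
  "PP N X = (mul (trunc N (\<lambda>_. 1)) (fst X), mul (trunc N (\<lambda>_. 1)) (snd X))"

definition AA :: "nat \<Rightarrow> ell2 \<times> ell2 \<Rightarrow> ell2 \<times> ell2" where
  "AA N X = (mul (trunc N sg) (snd X), - mul (trunc N sg) (fst X) - mul (trunc N dm) (snd X))"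

lemma bounded_linear_PP: "bounded_linear (PP n)"
  unfolding PP_def[abs_def]
  by (intro bounded_linear_Pair bounded_linear_compose[OF bounded_linear_mul_trunc bounded_linear_fst]
      bounded_linear_compose[OF bounded_linear_mul_trunc bounded_linear_snd])

lemma bounded_linear_AA: "bounded_linear (AA n)"
  unfolding AA_def[abs_def]
  by (intro bounded_linear_Pair bounded_linear_sub bounded_linear_minus
      bounded_linear_compose[OF bounded_linear_mul_trunc bounded_linear_fst]
      bounded_linear_compose[OF bounded_linear_mul_trunc bounded_linear_snd])

lemma norm_PP_le: "norm (PP n x) \<le> norm x"
  unfolding PP_def norm_prod_def
  by (auto intro!: real_sqrt_le_mono add_mono power_mono norm_mul_trunc_1_le)

lemma PP_tendsto: "(\<lambda>n. PP n x) \<longlonglongrightarrow> x"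
  unfolding PP_def using tendsto_Pair[OF mul_trunc_1_tendsto[of "fst x"] mul_trunc_1_tendsto[of "snd x"]]
  by simp

lemma PP_AA_compose:
  assumes "m \<le> n"
  shows "PP m (PP n x) = PP m x" "PP m (AA n x) = AA m x" "AA n (PP m x) = AA m x"
  using assms by (auto simp: PP_def AA_def trunc_def intro!: ell2_eqI)

text \<open>The scaling of the displacement by \<open>sg\<close> makes the coupling skew-symmetric,
  so only the damping survives in the inner product.\<close>

lemma AA_dissipative: "AA n x \<bullet> x \<le> 0"
proof -
  have "AA n x \<bullet> x = - (mul (trunc n dm) (snd x) \<bullet> snd x)"
    unfolding AA_def inner_prod_def fst_conv snd_conv inner_diff_left inner_minus_left inner_mul_trunc
    by (simp add: mult_ac)
  also have "\<dots> \<le> 0"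
    unfolding inner_mul_trunc using dm_nonneg by (simp add: sum_nonneg mult.assoc)
  finally show ?thesis .
qed

lemma PP_AA_approximation: "dissipative_approximation PP AA"
  by (rule dissipative_approximation.intro)
    (rule bounded_linear_PP bounded_linear_AA norm_PP_le PP_tendsto
      PP_AA_compose AA_dissipative | assumption)+

lemma PP_eq_AA_iff:
  "(\<forall>N. PP N Z = AA N X + PP N G) \<longleftrightarrow>
     (\<forall>n. ell2_nth (fst Z) n = sg n * ell2_nth (snd X) n + ell2_nth (fst G) n \<and>
        ell2_nth (snd Z) n = - sg n * ell2_nth (fst X) n - dm n * ell2_nth (snd X) n + ell2_nth (snd G) n)"
  (is "?L \<longleftrightarrow> ?R")
proof
  assume L: ?L
  show ?R
  proof
    fix n
    \<comment> \<open>Truncation at \<open>N\<close> keeps the indices below \<open>N\<close>, so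
      coordinate \<open>n\<close> is first visible at \<open>Suc n\<close>.\<close>
    have "PP (Suc n) Z = AA (Suc n) X + PP (Suc n) G" using L by blast
    then have "ell2_nth (fst (PP (Suc n) Z)) n = ell2_nth (fst (AA (Suc n) X + PP (Suc n) G)) n"
      "ell2_nth (snd (PP (Suc n) Z)) n = ell2_nth (snd (AA (Suc n) X + PP (Suc n) G)) n" by simp_all
    then show "ell2_nth (fst Z) n = sg n * ell2_nth (snd X) n + ell2_nth (fst G) n \<and>
        ell2_nth (snd Z) n = - sg n * ell2_nth (fst X) n - dm n * ell2_nth (snd X) n + ell2_nth (snd G) n"
      by (simp add: PP_def AA_def trunc_def)
  qed
next
  assume R: ?R
  show ?L
    by (intro allI prod_eqI ell2_eqI) (simp_all add: PP_def AA_def trunc_def R[rule_format])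
qed

section \<open>The cubic restoring force\<close>

definition ww :: "ell2 \<times> ell2 \<Rightarrow> real \<Rightarrow> real" where
  "ww X = sser l (to_H2 (fst X))"

text \<open>Bounds the sup norm of the displacement by the norm of the state; with it products of
  displacements stay square-integrable.\<close>

definition wwc :: real where
  "wwc = sser_bound l * sqrt (ra / EI)"

lemma sser_bound_nonneg: "0 \<le> sser_bound l"
  by (simp add: sser_bound_def)

lemma wwc_nonneg: "0 \<le> wwc"
  using sser_bound_nonneg pos by (simp add: wwc_def)

lemma abs_ww_le: "\<bar>ww X x\<bar> \<le> wwc * norm X"
proof -
  have "norm (to_H2 (fst X)) \<le> sqrt (ra / EI) * norm X"
  proof (rule order_trans[OF norm_to_H2_le])
    show "sqrt (ra / EI) * norm (fst X) \<le> sqrt (ra / EI) * norm X"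
      using norm_fst_le[of "fst X" "snd X"] pos by (intro mult_left_mono) auto
  qed
  then have "sser_bound l * norm (to_H2 (fst X)) \<le> sser_bound l * (sqrt (ra / EI) * norm X)"
    using sser_bound_nonneg by (rule mult_left_mono)
  then show ?thesis
    using abs_sser_le[OF pos(1), of "to_H2 (fst X)" x] by (simp add: ww_def wwc_def)
qed

lemma linear_to_H2: "linear to_H2"
  unfolding to_H2_def by (rule bounded_linear.linear[OF bounded_linear_mul[OF sg_ratio_bounds(1)]])

lemma ww_diff: "ww (X - Y) x = ww X x - ww Y x"
  and ww_add: "ww (X + Y) x = ww X x + ww Y x"
  and ww_scaleR: "ww (r *\<^sub>R X) x = r * ww X x"
  by (simp_all add: ww_def linear_diff[OF linear_to_H2] linear_add[OF linear_to_H2]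
      linear_scale[OF linear_to_H2] sser_diff sser_add sser_scaleR pos)

lemma continuous_ww [continuous_intros]: "continuous_on S (ww X)"
  unfolding ww_def by (rule continuous_sser[OF pos(1)])

lemma ell2_nth_sc_ww: "ell2_nth (sc l (ww X)) n = ell2_nth (fst X) n / sg n"
  using freq_p[of n] by (simp add: ww_def ell2_nth_sc_sser pos ell2_nth_to_H2)

lemma norm_sc_continuous_le:
  assumes "continuous_on {0..l} g" "\<And>x. \<bar>g x\<bar> \<le> K"
  shows "norm (sc l g) \<le> K * sqrt l"
proof -
  have g: "g \<in> L2 l" by (rule L2_continuous[OF assms(1)])
  have "0 \<le> K" using assms(2)[of 0] by linarith
  then have "L2norm l g \<le> K * sqrt l"
    using assms(2) pos by (intro L2_bounded(2) L2_measurable g) auto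
  then show ?thesis by (simp add: norm_sc[OF pos(1) g])
qed

definition "kap = talpha p / ra"

definition FF :: "ell2 \<times> ell2 \<Rightarrow> ell2 \<times> ell2" where
  "FF X = (0, - kap *\<^sub>R sc l (\<lambda>x. ww X x ^ 3))"

definition QQ :: "ell2 \<times> ell2 \<Rightarrow> ell2 \<times> ell2 \<Rightarrow> ell2 \<times> ell2" where
  "QQ X Y = (0, - (3 * kap) *\<^sub>R sc l (\<lambda>x. (ww X x)\<^sup>2 * ww Y x))"

text \<open>3 comes from differentiating a cube, \<open>wwc ^ 3\<close> from three factors in sup
  norm, \<open>sqrt l\<close> from passing to the norm of \<open>L2\<close>.\<close>

definition CC :: real where
  "CC = 3 * kap * (wwc ^ 3 * sqrt l)"

lemma sc_continuous_diff:
  assumes "continuous_on {0..l} f" "continuous_on {0..l} g"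
  shows "sc l f - sc l g = sc l (\<lambda>x. f x - g x)"
  using sc_diff[OF pos(1) L2_continuous[OF assms(1)] L2_continuous[OF assms(2)]]
  by (simp add: fun_diff_def)

lemma norm_zero_Pair: "norm (0 :: ell2, y :: ell2) = norm y"
  by (simp add: norm_prod_def)

text \<open>Each bound follows from a pointwise factorisation of a polynomial in displacements,
  estimated in sup norm.\<close>

lemma FF_QQ_semilinear: "semilinear PP AA FF QQ CC"
proof -
  interpret dissipative_approximation PP AA by (rule PP_AA_approximation)
  have kp: "0 < kap" using pos by (simp add: kap_def)
  have wX: "\<bar>ww X x\<bar> \<le> wwc * norm X" "0 \<le> wwc * norm X" for X x
    using abs_ww_le wwc_nonneg by auto
  have Q_le: "norm (QQ X Y) \<le> CC * (norm X)\<^sup>2 * norm Y" for X Y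
  proof -
    have "\<bar>(ww X x)\<^sup>2 * ww Y x\<bar> \<le> (wwc * norm X)\<^sup>2 * (wwc * norm Y)" for x
      unfolding abs_mult power_abs using wX by (intro mult_mono power_mono) auto
    then have "norm (sc l (\<lambda>x. (ww X x)\<^sup>2 * ww Y x)) \<le> (wwc * norm X)\<^sup>2 * (wwc * norm Y) * sqrt l"
      by (intro norm_sc_continuous_le continuous_intros)
    then have "3 * kap * norm (sc l (\<lambda>x. (ww X x)\<^sup>2 * ww Y x))
        \<le> 3 * kap * ((wwc * norm X)\<^sup>2 * (wwc * norm Y) * sqrt l)"
      using kp by (intro mult_left_mono) auto
    moreover have "norm (QQ X Y) = 3 * kap * norm (sc l (\<lambda>x. (ww X x)\<^sup>2 * ww Y x))"
      using kp by (simp add: QQ_def norm_zero_Pair)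
    moreover have "3 * kap * ((wwc * norm X)\<^sup>2 * (wwc * norm Y) * sqrt l) = CC * (norm X)\<^sup>2 * norm Y"
      by (simp add: CC_def power2_eq_square power3_eq_cube)
    ultimately show ?thesis by simp
  qed
  have Q_diff_le: "norm (QQ X Y - QQ X' Y) \<le> CC * (norm X + norm X') * norm (X - X') * norm Y" for X X' Y
  proof -
    let ?g = "\<lambda>x. ww (X - X') x * (ww X x + ww X' x) * ww Y x"
    have eq: "sc l (\<lambda>x. (ww X x)\<^sup>2 * ww Y x) - sc l (\<lambda>x. (ww X' x)\<^sup>2 * ww Y x) = sc l ?g"
      by (subst sc_continuous_diff)
        (auto intro!: continuous_intros simp: ww_diff power2_eq_square algebra_simps)
    have "\<bar>?g x\<bar> \<le> (wwc * norm (X - X')) * (wwc * norm X + wwc * norm X') * (wwc * norm Y)" for x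
    proof -
      have "\<bar>ww X x + ww X' x\<bar> \<le> wwc * norm X + wwc * norm X'"
        using wX(1)[of X x] wX(1)[of X' x] by linarith
      then show ?thesis
        unfolding abs_mult by (intro mult_mono wX mult_nonneg_nonneg add_nonneg_nonneg) auto
    qed
    then have "norm (sc l ?g) \<le> (wwc * norm (X - X')) * (wwc * norm X + wwc * norm X') * (wwc * norm Y) * sqrt l"
      by (intro norm_sc_continuous_le continuous_intros)
    then have "3 * kap * norm (sc l ?g)
        \<le> 3 * kap * ((wwc * norm (X - X')) * (wwc * norm X + wwc * norm X') * (wwc * norm Y) * sqrt l)"
      using kp by (intro mult_left_mono) auto
    also have "\<dots> = CC * (norm X + norm X') * norm (X - X') * norm Y"
      by (simp add: CC_def power3_eq_cube algebra_simps)
    finally have "3 * kap * norm (sc l ?g) \<le> CC * (norm X + norm X') * norm (X - X') * norm Y" .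
    moreover have "QQ X Y - QQ X' Y = (0, - (3 * kap) *\<^sub>R sc l ?g)"
      unfolding QQ_def diff_Pair eq[symmetric] by (simp only: scaleR_diff_right diff_0_right)
    ultimately show ?thesis using kp by (simp add: norm_Pair)
  qed
  have blQ: "bounded_linear (QQ X)" for X
  proof (rule bounded_linear_intro[of _ "CC * (norm X)\<^sup>2"])
    show "QQ X (Y + Z) = QQ X Y + QQ X Z" for Y Z
    proof -
      have "(\<lambda>x. (ww X x)\<^sup>2 * ww (Y + Z) x) = (\<lambda>x. (ww X x)\<^sup>2 * ww Y x) + (\<lambda>x. (ww X x)\<^sup>2 * ww Z x)"
        by (simp add: fun_eq_iff ww_add distrib_left)
      moreover have "(\<lambda>x. (ww X x)\<^sup>2 * ww Y x) \<in> L2 l" for Y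
        by (intro L2_continuous continuous_intros)
      ultimately show ?thesis
        by (simp only: QQ_def sc_add[OF pos(1)] scaleR_add_right add_Pair add_0_left)
    qed
    show "QQ X (r *\<^sub>R Y) = r *\<^sub>R QQ X Y" for r Y
    proof -
      have "(\<lambda>x. (ww X x)\<^sup>2 * ww (r *\<^sub>R Y) x) = r *\<^sub>R (\<lambda>x. (ww X x)\<^sup>2 * ww Y x)"
        by (simp add: fun_eq_iff ww_scaleR scaleR_fun_def)
      moreover have "(\<lambda>x. (ww X x)\<^sup>2 * ww Y x) \<in> L2 l"
        by (intro L2_continuous continuous_intros)
      ultimately show ?thesis
        by (simp add: QQ_def sc_scaleR[OF pos(1)] mult.commute)
    qed
    show "norm (QQ X Y) \<le> norm Y * (CC * (norm X)\<^sup>2)" for Y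
      using Q_le[of X Y] by (simp add: mult_ac)
  qed
  have rem: "norm (FF Y - FF X - QQ X (Y - X)) \<le> kap * (wwc ^ 3 * sqrt l) * (norm Y + 2 * norm X) * (norm (Y - X))\<^sup>2" for X Y
  proof -
    \<comment> \<open>The remainder \<open>y^3 - x^3 - 3 x^2 (y - x)\<close> factors as
      \<open>(y - x)^2 (y + 2 x)\<close>, which is quadratically small and gives
      differentiability.\<close>
    let ?g = "\<lambda>x. (ww (Y - X) x)\<^sup>2 * (ww Y x + 2 * ww X x)"
    have sc_q: "3 *\<^sub>R sc l (\<lambda>x. (ww X x)\<^sup>2 * ww (Y - X) x) = sc l (\<lambda>x. 3 * ((ww X x)\<^sup>2 * ww (Y - X) x))"
      by (subst sc_scaleR[OF pos(1), symmetric])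
        (auto intro!: L2_continuous continuous_intros simp: scaleR_fun_def)
    have eq: "sc l (\<lambda>x. ww Y x ^ 3) - sc l (\<lambda>x. ww X x ^ 3) - 3 *\<^sub>R sc l (\<lambda>x. (ww X x)\<^sup>2 * ww (Y - X) x) = sc l ?g"
    proof -
      have "ww Y x ^ 3 - ww X x ^ 3 - 3 * ((ww X x)\<^sup>2 * ww (Y - X) x) = ?g x" for x
        by (simp add: ww_diff power2_eq_square power3_eq_cube algebra_simps)
      then show ?thesis
      proof -
        assume point: "\<And>x. ww Y x ^ 3 - ww X x ^ 3 - 3 * ((ww X x)\<^sup>2 * ww (Y - X) x) = ?g x"
        have "sc l (\<lambda>x. ww Y x ^ 3) - sc l (\<lambda>x. ww X x ^ 3) = sc l (\<lambda>x. ww Y x ^ 3 - ww X x ^ 3)"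
          by (intro sc_continuous_diff continuous_intros)
        moreover have "sc l (\<lambda>x. ww Y x ^ 3 - ww X x ^ 3) - sc l (\<lambda>x. 3 * ((ww X x)\<^sup>2 * ww (Y - X) x))
            = sc l (\<lambda>x. ww Y x ^ 3 - ww X x ^ 3 - 3 * ((ww X x)\<^sup>2 * ww (Y - X) x))"
          by (intro sc_continuous_diff continuous_intros)
        ultimately show ?thesis unfolding sc_q by (simp only: point)
      qed
    qed
    have "\<bar>?g x\<bar> \<le> (wwc * norm (Y - X))\<^sup>2 * (wwc * norm Y + 2 * (wwc * norm X))" for x
    proof -
      have "\<bar>ww Y x + 2 * ww X x\<bar> \<le> wwc * norm Y + 2 * (wwc * norm X)"
        using wX(1)[of X x] wX(1)[of Y x] by linarith
      then show ?thesis
        unfolding abs_mult power_abs by (intro mult_mono power_mono wX) auto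
    qed
    then have "norm (sc l ?g) \<le> (wwc * norm (Y - X))\<^sup>2 * (wwc * norm Y + 2 * (wwc * norm X)) * sqrt l"
      by (intro norm_sc_continuous_le continuous_intros)
    then have "kap * norm (sc l ?g) \<le> kap * ((wwc * norm (Y - X))\<^sup>2 * (wwc * norm Y + 2 * (wwc * norm X)) * sqrt l)"
      using kp by (intro mult_left_mono) auto
    also have "\<dots> = kap * (wwc ^ 3 * sqrt l) * (norm Y + 2 * norm X) * (norm (Y - X))\<^sup>2"
      by (simp add: power2_eq_square power3_eq_cube algebra_simps)
    finally have "kap * norm (sc l ?g) \<le> kap * (wwc ^ 3 * sqrt l) * (norm Y + 2 * norm X) * (norm (Y - X))\<^sup>2" .
    moreover have "FF Y - FF X - QQ X (Y - X) = (0, - kap *\<^sub>R sc l ?g)"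
      unfolding FF_def QQ_def diff_Pair eq[symmetric] by (simp add: scaleR_diff_right mult.commute)
    ultimately show ?thesis using kp by (simp add: norm_Pair)
  qed
  show ?thesis
  proof
    show "0 \<le> CC" using kp wwc_nonneg pos by (simp add: CC_def)
    show "(FF has_derivative QQ X) (at X)" for X
      unfolding has_derivative_iff_norm
    proof (intro conjI blQ)
      let ?b = "\<lambda>Y. kap * (wwc ^ 3 * sqrt l) * (norm Y + 2 * norm X) * norm (Y - X)"
      have "(?b \<longlongrightarrow> kap * (wwc ^ 3 * sqrt l) * (norm X + 2 * norm X) * norm (X - X)) (at X)"
        by (intro tendsto_intros)
      then have b0: "(?b \<longlongrightarrow> 0) (at X)" by simp
      have "norm (norm (FF Y - FF X - QQ X (Y - X)) / norm (Y - X)) \<le> ?b Y" for Y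
      proof (cases "Y = X")
        case False
        then show ?thesis using rem[of Y X] by (simp add: divide_le_eq power2_eq_square mult.assoc)
      qed simp
      then show "((\<lambda>Y. norm (FF Y - FF X - QQ X (Y - X)) / norm (Y - X)) \<longlongrightarrow> 0) (at X)"
        using b0 by (intro Lim_null_comparison[OF always_eventually b0]) blast
    qed
  qed (rule Q_le Q_diff_le)+
qed

end

section \<open>Gronwall's inequality\<close>

text \<open>Integrating factor \<open>exp (om * t)\<close>. The forcing enters through an arbitrary
  antiderivative \<open>\<eta>\<close>, so that explicit formulas can be inserted without evaluating
  integrals.\<close>

lemma gronwall_exp:
  fixes V :: "real \<Rightarrow> real"
  assumes "0 \<le> T"
    and V: "\<And>t. t \<in> {0..T} \<Longrightarrow> \<exists>D. (V has_real_derivative D) (at t within {0..T}) \<and> D \<le> g t - om * V t"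
    and \<eta>: "continuous_on {0..T} \<eta>" "\<And>t. 0 < t \<Longrightarrow> t < T \<Longrightarrow> (\<eta> has_real_derivative exp (om * t) * g t) (at t)"
  shows "exp (om * T) * V T - V 0 \<le> \<eta> T - \<eta> 0"
proof -
  let ?f = "\<lambda>t. exp (om * t) * V t - \<eta> t"
  have Vc: "continuous_on {0..T} V"
    unfolding continuous_on_eq_continuous_within using V DERIV_continuous by blast
  have "?f T \<le> ?f 0"
  proof (rule DERIV_nonpos_imp_decreasing_open[OF \<open>0 \<le> T\<close>])
    fix t assume t: "0 < t" "t < T"
    then obtain D where D: "(V has_real_derivative D) (at t within {0..T})" "D \<le> g t - om * V t"
      using V[of t] by auto
    have "(V has_real_derivative D) (at t)"
      using D(1) t by (simp add: at_within_interior[of t "{0..T}"])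
    then have "(?f has_real_derivative exp (om * t) * (om * V t + D) - exp (om * t) * g t) (at t)"
      using \<eta>(2)[OF t] by (auto intro!: derivative_eq_intros simp: algebra_simps)
    moreover have "exp (om * t) * (om * V t + D) \<le> exp (om * t) * g t"
      using D(2) by (intro mult_left_mono) auto
    ultimately show "\<exists>D. (?f has_real_derivative D) (at t) \<and> D \<le> 0"
      by (intro exI[of _ "exp (om * t) * (om * V t + D) - exp (om * t) * g t"]) auto
  next
    show "continuous_on {0..T} ?f" by (intro continuous_intros Vc \<eta>(1))
  qed
  then show ?thesis by simp
qed

section \<open>State space and operators in coordinates\<close>

context track_model
begin

sublocale semilinear PP AA FF QQ CC by (rule FF_QQ_semilinear)

text \<open>The coordinates \<open>\<sigma>\<^sub>n w\<^sub>n\<close> are computed from \<open>w''\<close>, because \<open>\<sigma>\<^sub>n\<close> is unbounded and \<open>mul\<close> is junk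
  for unbounded multipliers.\<close>

definition cX :: "state \<Rightarrow> ell2 \<times> ell2" where
  "cX x = (mul (\<lambda>n. - (sg n / (freq l n)\<^sup>2)) (sc l (wd l (wd l (fst x)))), sc l (snd x))"

definition sX :: "ell2 \<times> ell2 \<Rightarrow> state" where
  "sX X = (ww X, syn l (snd X))"

lemma mem_XX_iff: "x \<in> XX p \<longleftrightarrow> fst x \<in> Hsob 2 l \<inter> H10 l \<and> snd x \<in> L2 l"
  by (cases x) (simp add: XX_def)

lemma XX_L2: "x \<in> XX p \<Longrightarrow> fst x \<in> L2 l" "x \<in> XX p \<Longrightarrow> snd x \<in> L2 l"
  by (auto simp only: mem_XX_iff Int_iff intro: Hsob_L2)

lemma ell2_nth_cX:
  assumes "x \<in> XX p"
  shows "ell2_nth (fst (cX x)) n = sg n * ell2_nth (sc l (fst x)) n"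
    and "snd (cX x) = sc l (snd x)"
proof -
  have b: "\<bar>- (sg n / (freq l n)\<^sup>2)\<bar> \<le> sqrt ((EI + tk p * (l / pi) ^ 4) / ra)" for n
    unfolding abs_minus_cancel by (rule sg_ratio_bounds(2))
  have "ell2_nth (sc l (wd l (wd l (fst x)))) n = - ((freq l n)\<^sup>2 * ell2_nth (sc l (fst x)) n)"
    using assms by (intro H2_H10_coeff(2)[OF pos(1)]) (auto simp only: mem_XX_iff Int_iff)
  then show "ell2_nth (fst (cX x)) n = sg n * ell2_nth (sc l (fst x)) n"
    using freq_p[of n] by (simp add: cX_def ell2_nth_mul[OF b])
  show "snd (cX x) = sc l (snd x)" by (simp add: cX_def)
qed

lemma ell2_nth_sc_fst:
  "x \<in> XX p \<Longrightarrow> ell2_nth (sc l (fst x)) n = ell2_nth (fst (cX x)) n / sg n"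
  using sg_pos[of n] by (simp add: ell2_nth_cX)

lemma H2_H10_I':
  assumes "w \<in> L2 l" "\<And>n. ell2_nth (sc l w) n = ell2_nth a n / sg n"
  shows "w \<in> Hsob 2 l \<inter> H10 l"
proof -
  have "ell2_nth (sc l w) n = ell2_nth (to_H2 a) n / (freq l n)\<^sup>2" for n
    using freq_p[of n] by (simp add: assms(2) ell2_nth_to_H2)
  then show ?thesis using assms(1) mem_H2_H10_iff[OF pos(1), of w] by blast
qed

lemma XX_diff: "x \<in> XX p \<Longrightarrow> y \<in> XX p \<Longrightarrow> x - y \<in> XX p"
  unfolding mem_XX_iff[of "x - y"]
  by (intro conjI H2_H10_I'[where a = "fst (cX x) - fst (cX y)"])
    (auto simp: L2_diff XX_L2 sc_diff pos ell2_nth_sc_fst diff_divide_distrib)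

lemma XX_add: "x \<in> XX p \<Longrightarrow> y \<in> XX p \<Longrightarrow> x + y \<in> XX p"
  unfolding mem_XX_iff[of "x + y"]
  by (intro conjI H2_H10_I'[where a = "fst (cX x) + fst (cX y)"])
    (auto simp: L2_add XX_L2 sc_add pos ell2_nth_sc_fst add_divide_distrib)

lemma XX_scaleR: "x \<in> XX p \<Longrightarrow> r *\<^sub>R x \<in> XX p"
  unfolding mem_XX_iff[of "r *\<^sub>R x"]
  by (intro conjI H2_H10_I'[where a = "r *\<^sub>R fst (cX x)"])
    (auto simp: L2_scaleR XX_L2 sc_scaleR pos ell2_nth_sc_fst)

lemma cX_diff: "x \<in> XX p \<Longrightarrow> y \<in> XX p \<Longrightarrow> cX (x - y) = cX x - cX y"
  by (intro prod_eqI ell2_eqI) (simp_all add: ell2_nth_cX XX_diff XX_L2 sc_diff pos algebra_simps)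

lemma cX_add: "x \<in> XX p \<Longrightarrow> y \<in> XX p \<Longrightarrow> cX (x + y) = cX x + cX y"
  by (intro prod_eqI ell2_eqI) (simp_all add: ell2_nth_cX XX_add XX_L2 sc_add pos algebra_simps)

lemma cX_scaleR: "x \<in> XX p \<Longrightarrow> cX (r *\<^sub>R x) = r *\<^sub>R cX x"
  by (intro prod_eqI ell2_eqI) (simp_all add: ell2_nth_cX XX_scaleR XX_L2 sc_scaleR pos algebra_simps)

lemma Xeq_iff:
  assumes "x \<in> XX p" "y \<in> XX p"
  shows "Xeq p x y \<longleftrightarrow> cX x = cX y"
proof
  assume "Xeq p x y"
  then have "sc l (fst x) = sc l (fst y)" "sc l (snd x) = sc l (snd y)"
    using assms by (auto simp: Xeq_def intro!: eq_ae_imp_sc_eq pos XX_L2)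
  then show "cX x = cX y"
    by (intro prod_eqI ell2_eqI) (simp_all add: ell2_nth_cX assms)
next
  assume eq: "cX x = cX y"
  have "sc l (fst x) = sc l (fst y)"
    by (rule ell2_eqI) (simp add: ell2_nth_sc_fst assms eq)
  moreover have "sc l (snd x) = sc l (snd y)"
    using ell2_nth_cX(2)[OF assms(1)] ell2_nth_cX(2)[OF assms(2)] eq by simp
  ultimately show "Xeq p x y"
    unfolding Xeq_def using assms by (auto intro!: sc_eq_imp_eq_ae pos XX_L2)
qed

text \<open>The stiffness and foundation terms of mode \<open>n\<close> add up to
  \<open>ra * (sg n)\<^sup>2\<close> times the squared coefficient; this is why \<open>sg\<close>
  has its form.\<close>

lemma Xnorm_eq:
  assumes x: "x \<in> XX p"
  shows "Xnorm p x = sqrt ra * norm (cX x)"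
proof -
  let ?w = "fst x" and ?v = "snd x" and ?w2 = "wd l (wd l (fst x))"
  let ?c = "\<lambda>n. ell2_nth (sc l (fst x)) n"
  have L2: "?w \<in> L2 l" "?v \<in> L2 l" "?w2 \<in> L2 l"
    and w2: "\<And>n. ell2_nth (sc l ?w2) n = - ((freq l n)\<^sup>2 * ?c n)"
    using x H2_H10_coeff[OF pos(1), of ?w] XX_L2[OF x] by (auto simp only: mem_XX_iff Int_iff)
  have N: "(LINT s|leb l. (f s)\<^sup>2) = (norm (sc l f))\<^sup>2" if "f \<in> L2 l" for f
    using that by (simp add: norm_sc pos L2norm_def)
  have "(LINT s|leb l. EI * (?w2 s)\<^sup>2 + tk p * (?w s)\<^sup>2 + ra * (?v s)\<^sup>2)
      = EI * (norm (sc l ?w2))\<^sup>2 + tk p * (norm (sc l ?w))\<^sup>2 + ra * (norm (sc l ?v))\<^sup>2"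
    using L2[THEN L2_square_integrable] by (simp add: N[OF L2(1)] N[OF L2(2)] N[OF L2(3)])
  also have "EI * (norm (sc l ?w2))\<^sup>2 + tk p * (norm (sc l ?w))\<^sup>2 = ra * (norm (fst (cX x)))\<^sup>2"
  proof -
    have s: "summable (\<lambda>n. EI * (ell2_nth (sc l ?w2) n)\<^sup>2)" "summable (\<lambda>n. tk p * (?c n)\<^sup>2)"
      by (intro summable_mult summable_ell2)+
    have "EI * (norm (sc l ?w2))\<^sup>2 + tk p * (norm (sc l ?w))\<^sup>2
        = (\<Sum>n. EI * (ell2_nth (sc l ?w2) n)\<^sup>2) + (\<Sum>n. tk p * (?c n)\<^sup>2)"
      unfolding norm_ell2_squared by (simp add: suminf_mult)
    also have "\<dots> = (\<Sum>n. EI * (ell2_nth (sc l ?w2) n)\<^sup>2 + tk p * (?c n)\<^sup>2)"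
      by (rule suminf_add[OF s])
    also have "\<dots> = (\<Sum>n. ra * (ell2_nth (fst (cX x)) n)\<^sup>2)"
    proof (rule suminf_cong)
      fix n
      have "((freq l n)\<^sup>2)\<^sup>2 = freq l n ^ 4" by (simp flip: power_mult)
      then have "EI * (ell2_nth (sc l ?w2) n)\<^sup>2 + tk p * (?c n)\<^sup>2 = (EI * freq l n ^ 4 + tk p) * (?c n)\<^sup>2"
        by (simp add: w2 power_mult_distrib algebra_simps)
      also have "\<dots> = ra * (ell2_nth (fst (cX x)) n)\<^sup>2"
        by (simp add: sg_squared[symmetric] ell2_nth_cX[OF x] power_mult_distrib)
      finally show "EI * (ell2_nth (sc l ?w2) n)\<^sup>2 + tk p * (?c n)\<^sup>2 = ra * (ell2_nth (fst (cX x)) n)\<^sup>2" .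
    qed
    also have "\<dots> = ra * (norm (fst (cX x)))\<^sup>2"
      unfolding norm_ell2_squared by (simp add: suminf_mult)
    finally show ?thesis .
  qed
  also have "ra * (norm (fst (cX x)))\<^sup>2 + ra * (norm (sc l ?v))\<^sup>2 = ra * (norm (cX x))\<^sup>2"
    by (simp add: norm_prod_def ell2_nth_cX(2)[OF x] distrib_left)
  finally show ?thesis
    by (simp add: Xnorm_def case_prod_beta real_sqrt_mult ra_def EI_def)
qed

lemma coordinates_X: "coordinates (XX p) (Xnorm p) cX (sqrt ra)"
  by unfold_locales (simp_all add: XX_diff XX_scaleR cX_diff cX_scaleR Xnorm_eq pos)

lemma sX_XX: "sX X \<in> XX p"
  unfolding mem_XX_iff sX_def fst_conv snd_conv
  by (intro conjI H2_H10_I'[where a = "fst X"] syn pos ell2_nth_sc_ww L2_continuous continuous_ww)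

lemma cX_sX: "cX (sX X) = X"
proof (intro prod_eqI ell2_eqI)
  show "ell2_nth (fst (cX (sX X))) n = ell2_nth (fst X) n" for n
    using sg_pos[of n] ell2_nth_cX(1)[OF sX_XX, of X n] by (simp add: sX_def ell2_nth_sc_ww)
  show "ell2_nth (snd (cX (sX X))) n = ell2_nth (snd X) n" for n
    using ell2_nth_cX(2)[OF sX_XX, of X] by (simp add: sX_def sc_syn pos)
qed

lemma zero_Pair_XX:
  assumes "v \<in> L2 l"
  shows "(0, v) \<in> XX p" "cX (0, v) = (0, sc l v)"
proof -
  show m: "(0, v) \<in> XX p"
    unfolding mem_XX_iff fst_conv snd_conv
    by (intro conjI H2_H10_I'[where a = 0] L2_zero assms) (simp add: sc_zero pos)
  show "cX (0, v) = (0, sc l v)"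
    by (intro prod_eqI ell2_eqI) (simp_all add: ell2_nth_cX[OF m] sc_zero pos)
qed

text \<open>The raw displacement equals its continuous representative only almost everywhere.
  Boundedness, and hence square-integrability of the cube, is inherited from the
  representative.\<close>

lemma opF_coeff:
  assumes x: "x \<in> XX p"
  shows "opF p x \<in> XX p" "cX (opF p x) = FF (cX x)"
proof -
  let ?w = "fst x" and ?W = "ww (cX x)"
  have wL: "?w \<in> L2 l" by (rule XX_L2[OF x])
  have WL: "?W \<in> L2 l" "(\<lambda>s. ?W s ^ 3) \<in> L2 l" by (intro L2_continuous continuous_intros)+
  have "sc l ?w = sc l ?W"
    by (rule ell2_eqI) (simp add: ell2_nth_sc_ww ell2_nth_sc_fst[OF x])
  then have ae: "eq_ae l ?w ?W" by (rule sc_eq_imp_eq_ae[OF pos(1) wL WL(1)])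
  have "AE s in leb l. \<bar>?w s ^ 3\<bar> \<le> (wwc * norm (cX x)) ^ 3"
    using ae unfolding eq_ae_def
  proof eventually_elim
    case (elim s)
    have "\<bar>?W s\<bar> ^ 3 \<le> (wwc * norm (cX x)) ^ 3" by (intro power_mono abs_ww_le) auto
    then show ?case by (simp add: elim power_abs)
  qed
  moreover have "(\<lambda>s. ?w s ^ 3) \<in> borel_measurable (leb l)"
    using L2_measurable[OF wL] by (rule borel_measurable_power)
  ultimately have w3: "(\<lambda>s. ?w s ^ 3) \<in> L2 l"
    using pos(1) by (intro L2_bounded(1)[where K = "(wwc * norm (cX x)) ^ 3"]) auto
  have "eq_ae l (\<lambda>s. ?w s ^ 3) (\<lambda>s. ?W s ^ 3)"
    using ae unfolding eq_ae_def by eventually_elim simp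
  then have sc3: "sc l (\<lambda>s. ?w s ^ 3) = sc l (\<lambda>s. ?W s ^ 3)"
    by (rule eq_ae_imp_sc_eq[OF pos(1) w3 WL(2)])
  have op: "opF p x = (0, - kap *\<^sub>R (\<lambda>s. ?w s ^ 3))"
    by (cases x) (simp add: opF_def scaleR_fun_def kap_def ra_def)
  show "opF p x \<in> XX p" "cX (opF p x) = FF (cX x)"
    unfolding op using zero_Pair_XX[OF L2_scaleR[OF w3, of "- kap"]]
    by (simp_all only: FF_def sc_scaleR[OF pos(1) w3] sc3)
qed

definition BB :: "(real \<Rightarrow> real) \<Rightarrow> ell2 \<times> ell2" where
  "BB u = (0, (1 / ra) *\<^sub>R sc l u)"

lemma opB_coeff:
  assumes "u \<in> L2 l"
  shows "opB p u \<in> XX p" "cX (opB p u) = BB u"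
  using zero_Pair_XX[OF L2_scaleR[OF assms, of "1 / ra"]]
  by (simp_all add: opB_def BB_def ra_def sc_scaleR[OF pos(1) assms])

lemma opA_coeff:
  assumes x: "x \<in> domA p"
  shows "x \<in> XX p" "opA p x \<in> XX p" "PP N (cX (opA p x)) = AA N (cX x)"
proof -
  obtain w v where wv: "x = (w, v)" by (cases x)
  let ?h = "EI *\<^sub>R w + tCd p *\<^sub>R v"
  have dom: "(w, v) \<in> XX p" "v \<in> Hsob 2 l \<inter> H10 l" "?h \<in> domA0 p"
    using x by (auto simp: domA_def wv EI_def)
  show xX: "x \<in> XX p" using dom(1) by (simp add: wv)
  note L2 = XX_L2[OF dom(1), unfolded fst_conv snd_conv]
  note A0 = domA0_coeff(2,3)[OF pos(1) dom(3)]
  let ?s = "- ((1 / ra) *\<^sub>R A0 p ?h) - (1 / ra) *\<^sub>R (tmu p *\<^sub>R v + tk p *\<^sub>R w)"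
  have op: "opA p x = (v, ?s)" by (simp add: opA_def wv ra_def EI_def)
  have sL: "?s \<in> L2 l" by (intro L2_diff L2_uminus L2_scaleR L2_add A0 L2)
  show opX: "opA p x \<in> XX p"
    using dom(2) sL by (simp add: mem_XX_iff op)
  have f: "ell2_nth (fst (cX (opA p x))) n = sg n * ell2_nth (snd (cX x)) n" for n
    using ell2_nth_cX(1)[OF opX, of n] ell2_nth_cX(2)[OF xX] by (simp add: op[unfolded wv] wv)
  have s: "ell2_nth (snd (cX (opA p x))) n
      = - sg n * ell2_nth (fst (cX x)) n - dm n * ell2_nth (snd (cX x)) n" for n
  proof -
    let ?a = "ell2_nth (sc l w) n" and ?b = "ell2_nth (sc l v) n"
    have "ell2_nth (snd (cX (opA p x))) n = ell2_nth (sc l ?s) n"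
      using ell2_nth_cX(2)[OF opX] by (simp add: op)
    also have "sc l ?s = - ((1 / ra) *\<^sub>R sc l (A0 p ?h)) - (1 / ra) *\<^sub>R (tmu p *\<^sub>R sc l v + tk p *\<^sub>R sc l w)"
      by (simp add: sc_diff sc_uminus sc_scaleR sc_add L2_diff L2_uminus L2_scaleR L2_add A0 L2 pos)
    also have "ell2_nth \<dots> n = - (1 / ra) * ell2_nth (sc l (A0 p ?h)) n - (1 / ra) * (tmu p * ?b + tk p * ?a)"
      by simp
    also have "ell2_nth (sc l (A0 p ?h)) n = freq l n ^ 4 * (EI * ?a + tCd p * ?b)"
      by (simp add: A0(2) sc_add sc_scaleR L2_scaleR L2 pos)
    also have "- (1 / ra) * (freq l n ^ 4 * (EI * ?a + tCd p * ?b)) - (1 / ra) * (tmu p * ?b + tk p * ?a)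
        = - (1 / ra) * ((EI * freq l n ^ 4 + tk p) * ?a + (tCd p * freq l n ^ 4 + tmu p) * ?b)"
      by (simp add: algebra_simps)
    also have "\<dots> = - sg n * (sg n * ?a) - dm n * ?b"
      unfolding sg_squared[symmetric] ra_dm[symmetric] using pos(2)
      by (simp add: power2_eq_square field_simps)
    finally show ?thesis
      using ell2_nth_cX[OF xX] by (simp add: wv)
  qed
  have "\<forall>N. PP N (cX (opA p x)) = AA N (cX x) + PP N 0"
    unfolding PP_eq_AA_iff using f s by simp
  then show "PP N (cX (opA p x)) = AA N (cX x)"
    by (simp add: P_zero)
qed

text \<open>\<open>Z\<close> plays the time derivative. Its first component says that
  \<open>sg n\<close> times the velocity coefficient is square-summable, so the velocity lies in
  \<open>H2\<close> with zero boundary values. Its second component gives the same for the fourth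
  power of the frequency times the coefficient of \<open>EI w + C_d v\<close>.\<close>

lemma domA_I:
  assumes eq: "\<And>N. PP N Z = AA N X + PP N (0, g)"
  shows "sX X \<in> domA p"
proof -
  let ?w = "ww X" and ?v = "syn l (snd X)"
  let ?h = "EI *\<^sub>R ?w + tCd p *\<^sub>R ?v"
  have n: "ell2_nth (fst Z) n = sg n * ell2_nth (snd X) n"
    "ell2_nth (snd Z) n = - sg n * ell2_nth (fst X) n - dm n * ell2_nth (snd X) n + ell2_nth g n" for n
    using eq PP_eq_AA_iff[of Z X "(0, g)"] by auto
  have wL: "?w \<in> L2 l" by (intro L2_continuous continuous_intros)
  have vL: "?v \<in> L2 l" by (intro syn pos)
  have v: "?v \<in> Hsob 2 l \<inter> H10 l"
    by (rule H2_H10_I'[OF vL, of "fst Z"]) (use n(1) sg_pos in \<open>simp add: sc_syn pos less_imp_neq[symmetric]\<close>)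
  \<comment> \<open>The second component of the equation, multiplied by \<open>ra\<close> and solved
    for the fourth-order term.\<close>
  let ?b = "ra *\<^sub>R (g - snd Z) - tk p *\<^sub>R sc l ?w - tmu p *\<^sub>R snd X"
  have "?h \<in> domA0 p"
  proof (rule domA0_I[OF pos(1)])
    show "?h \<in> L2 l" by (intro L2_add L2_scaleR wL vL)
    fix n
    let ?a = "ell2_nth (fst X) n / sg n" and ?V = "ell2_nth (snd X) n"
    have "ell2_nth ?b n = ra * (sg n * ell2_nth (fst X) n) + ra * dm n * ?V - tk p * ?a - tmu p * ?V"
      by (simp add: n(2) ell2_nth_sc_ww algebra_simps)
    also have "ra * (sg n * ell2_nth (fst X) n) = ra * (sg n)\<^sup>2 * ?a"
      using sg_pos[of n] by (simp add: power2_eq_square)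
    also have "ra * (sg n)\<^sup>2 * ?a + ra * dm n * ?V - tk p * ?a - tmu p * ?V
        = freq l n ^ 4 * (EI * ?a + tCd p * ?V)"
      unfolding sg_squared ra_dm by (simp add: algebra_simps)
    finally show "ell2_nth (sc l ?h) n = ell2_nth ?b n / freq l n ^ 4"
      using freq_p[of n] by (simp add: sc_add sc_scaleR L2_scaleR wL vL pos sc_syn ell2_nth_sc_ww)
  qed
  then show ?thesis
    using sX_XX[of X] v by (simp add: domA_def sX_def EI_def)
qed

section \<open>Translation between solution notions\<close>

lemma strong_imp_classical:
  assumes sol: "strong_solution (\<lambda>t. BB (u t)) J X Z" and u: "\<And>t. t \<in> J \<Longrightarrow> u t \<in> L2 l"
    and x0: "x0 \<in> XX p" "X 0 = cX x0"
  shows "classical_solution p u x0 J (\<lambda>t. sX (X t))"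
proof -
  interpret co: coordinates "XX p" "Xnorm p" cX "sqrt ra" by (rule coordinates_X)
  have eq: "PP N (Z t) = AA N (X t) + PP N (BB (u t) + FF (X t))" if "t \<in> J" for t N
    using sol that by (simp add: strong_solution_def)
  have dom: "sX (X t) \<in> domA p \<and> Xeq p (sX (Z t)) (opA p (sX (X t)) + opF p (sX (X t)) + opB p (u t))"
    if t: "t \<in> J" for t
  proof -
    \<comment> \<open>Input and restoring force act on the velocity component only, as
      \<open>domA_I\<close> demands.\<close>
    have "BB (u t) + FF (X t) = (0, snd (BB (u t)) + snd (FF (X t)))"
      by (simp add: BB_def FF_def)
    then have "PP N (Z t) = AA N (X t) + PP N (0, snd (BB (u t)) + snd (FF (X t)))" for N
      using eq[OF t, of N] by simp
    then have d: "sX (X t) \<in> domA p" by (rule domA_I)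
    note A = opA_coeff[OF d] and F = opF_coeff[OF sX_XX[of "X t"]] and B = opB_coeff[OF u[OF t]]
    have R: "opA p (sX (X t)) + opF p (sX (X t)) + opB p (u t) \<in> XX p"
      by (intro XX_add A F B)
    have "cX (opA p (sX (X t)) + opF p (sX (X t)) + opB p (u t)) = cX (opA p (sX (X t))) + FF (X t) + BB (u t)"
      using A F B by (simp add: cX_add XX_add cX_sX)
    also have "\<dots> = Z t"
    proof (rule P_eqI)
      show "PP N (cX (opA p (sX (X t))) + FF (X t) + BB (u t)) = PP N (Z t)" for N
        using A(3)[of N] eq[OF t, of N] by (simp add: P_add cX_sX add_ac)
    qed
    finally have "Xeq p (sX (Z t)) (opA p (sX (X t)) + opF p (sX (X t)) + opB p (u t))"
      using Xeq_iff[OF sX_XX R] by (simp add: cX_sX)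
    with d show ?thesis by blast
  qed
  have "C1_with (XX p) (Xnorm p) (J - {0}) (\<lambda>t. sX (X t)) (\<lambda>t. sX (Z t))"
    unfolding co.C1_with_iff cX_sX
    using sol unfolding strong_solution_def
    by (auto intro: sX_XX has_vector_derivative_within_subset continuous_on_subset)
  moreover have "norm_continuous_on (Xnorm p) J (\<lambda>t. sX (X t))"
    using strong_solution_continuous[OF sol] co.norm_continuous_on_iff[of J "\<lambda>t. sX (X t)"]
    by (simp add: sX_XX cX_sX)
  moreover have "Xeq p (sX (X 0)) x0"
    using Xeq_iff[OF sX_XX x0(1)] by (simp add: cX_sX x0(2))
  ultimately show ?thesis
    unfolding classical_solution_def using dom sX_XX by blast
qed

text \<open>Serves uniqueness: a competing classical solution need only be weak in coordinates to be
  compared. \<open>J\<close> is left open to cover bounded, half-open and infinite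
  intervals.\<close>

lemma classical_imp_weak:
  assumes sol: "classical_solution p u x0 J y" and u: "\<And>t. t \<in> J \<Longrightarrow> u t \<in> L2 l"
    and J: "{0..T} \<subseteq> J" "0 \<le> T" and x0: "x0 \<in> XX p"
  shows "weak_solution T (\<lambda>t. BB (u t) + FF (cX (y t))) (\<lambda>t. cX (y t))" "cX (y 0) = cX x0"
proof -
  interpret co: coordinates "XX p" "Xnorm p" cX "sqrt ra" by (rule coordinates_X)
  have yX: "y t \<in> XX p" if "t \<in> J" for t
    using sol that by (simp add: classical_solution_def)
  obtain y' where y': "C1_with (XX p) (Xnorm p) (J - {0}) y y'"
    and eq: "\<And>t. t \<in> J - {0} \<Longrightarrow> y t \<in> domA p \<and> Xeq p (y' t) (opA p (y t) + opF p (y t) + opB p (u t))"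
    using sol unfolding classical_solution_def by blast
  have "Xeq p (y 0) x0" using sol by (simp add: classical_solution_def)
  then show "cX (y 0) = cX x0"
    using Xeq_iff[OF yX x0, of 0] J by auto
  show "weak_solution T (\<lambda>t. BB (u t) + FF (cX (y t))) (\<lambda>t. cX (y t))"
    unfolding weak_solution_def
  proof (intro conjI allI impI)
    have "continuous_on J (\<lambda>t. cX (y t))"
      using sol co.norm_continuous_on_iff[OF yX] by (simp add: classical_solution_def)
    then show "continuous_on {0..T} (\<lambda>t. cX (y t))" using J(1) by (rule continuous_on_subset)
    fix n t assume t: "0 < t" "t < T"
    then have tJ: "t \<in> J - {0}" using J by auto
    have y'X: "y' t \<in> XX p"
      and D: "((\<lambda>s. cX (y s)) has_vector_derivative cX (y' t)) (at t within J - {0})"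
      using y' tJ unfolding co.C1_with_iff by blast+
    \<comment> \<open>Passing to an open subinterval turns the derivative within
      \<open>J - {0}\<close> into a two-sided one.\<close>
    have "{0<..<T} \<subseteq> J - {0}" using J(1) by auto
    then have "((\<lambda>s. cX (y s)) has_vector_derivative cX (y' t)) (at t within {0<..<T})"
      by (rule has_vector_derivative_within_subset[OF D])
    moreover have "at t within {0<..<T} = at t"
      using t by (intro at_within_open) auto
    ultimately have "((\<lambda>s. cX (y s)) has_vector_derivative cX (y' t)) (at t)" by simp
    then have PD: "((\<lambda>s. PP n (cX (y s))) has_vector_derivative PP n (cX (y' t))) (at t)"
      by (rule bounded_linear.has_vector_derivative[OF bounded_linear_PP])
    have d: "y t \<in> domA p" using eq[OF tJ] by blast
    note A = opA_coeff[OF d] and F = opF_coeff[OF opA_coeff(1)[OF d]] and B = opB_coeff[OF u, of t]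
    have tJ': "t \<in> J" using tJ by blast
    have R: "opA p (y t) + opF p (y t) + opB p (u t) \<in> XX p"
      using tJ' by (intro XX_add A F B)
    have "cX (y' t) = cX (opA p (y t) + opF p (y t) + opB p (u t))"
      using eq[OF tJ] Xeq_iff[OF y'X R] by blast
    also have "\<dots> = cX (opA p (y t)) + FF (cX (y t)) + BB (u t)"
      using A F B tJ' by (simp add: cX_add XX_add)
    finally have "PP n (cX (y' t)) = AA n (cX (y t)) + PP n (BB (u t) + FF (cX (y t)))"
      using A(3)[of n] by (simp add: P_add add_ac)
    with PD show "((\<lambda>s. PP n (cX (y s))) has_vector_derivative
        AA n (cX (y t)) + PP n (BB (u t) + FF (cX (y t)))) (at t)" by simp
  qed
qed

section \<open>Lyapunov estimates\<close>

text \<open>\<open>h\<close> dominates the squared input and \<open>\<eta>\<close> integrates it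
  against the weight. A constant \<open>h\<close> yields the bound with the supremum, an exponential
  one the decay.\<close>

lemma lyap_estimate:
  assumes decay: "lyap_decay p c eps3 om" and u: "C1_input p {0..t} u" and x0: "x0 \<in> domA p"
    and sol: "classical_solution p u x0 {0..t} x" and t: "0 \<le> t"
    and \<eta>: "continuous_on {0..t} \<eta>"
      "\<And>s. 0 < s \<Longrightarrow> s < t \<Longrightarrow> (\<eta> has_real_derivative exp (om * s) * (eps3 * h s)) (at s)"
    and h: "\<And>s. s \<in> {0..t} \<Longrightarrow> (L2norm l (u s))\<^sup>2 \<le> h s"
  shows "lyap p c (x t) \<le> exp (- om * t) * (lyap p c (x 0) + \<eta> t - \<eta> 0)"
\<comment> \<open>The decay hypothesis speaks of positive horizons only; for \<open>t = 0\<close>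
  both sides coincide.\<close>
proof (cases "t = 0")
  case False
  with t have "0 < t" by simp
  have "exp (om * t) * lyap p c (x t) - lyap p c (x 0) \<le> \<eta> t - \<eta> 0"
  proof (rule gronwall_exp[OF t _ \<eta>])
    fix s assume s: "s \<in> {0..t}"
    then obtain D where D: "((\<lambda>s. lyap p c (x s)) has_real_derivative D) (at s within {0..t})"
      "D \<le> eps3 * (L2norm l (u s))\<^sup>2 - om * lyap p c (x s)"
      using decay \<open>0 < t\<close> x0 u sol unfolding lyap_decay_def by blast
    moreover have "eps3 * (L2norm l (u s))\<^sup>2 \<le> eps3 * h s"
      using h[OF s] decay by (intro mult_left_mono) (auto simp: lyap_decay_def)
    ultimately show "\<exists>D. ((\<lambda>s. lyap p c (x s)) has_real_derivative D) (at s within {0..t}) \<and>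
        D \<le> eps3 * h s - om * lyap p c (x s)" by force
  qed
  then have "exp (- om * t) * (exp (om * t) * lyap p c (x t))
      \<le> exp (- om * t) * (lyap p c (x 0) + \<eta> t - \<eta> 0)"
    by (intro mult_left_mono) auto
  moreover have "exp (- om * t) * (exp (om * t) * lyap p c (x t)) = lyap p c (x t)"
    by (simp add: exp_minus)
  ultimately show ?thesis by (simp only:)
qed simp

lemma lyap_estimate_const:
  assumes decay: "lyap_decay p c eps3 om" and u: "C1_input p {0..t} u" and x0: "x0 \<in> domA p"
    and sol: "classical_solution p u x0 {0..t} x" and t: "0 \<le> t"
    and h: "\<And>s. s \<in> {0..t} \<Longrightarrow> (L2norm l (u s))\<^sup>2 \<le> U"
  shows "lyap p c (x t) \<le> exp (- om * t) * lyap p c (x 0) + eps3 / om * (1 - exp (- om * t)) * U"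
proof -
  have om: "0 < om" using decay by (simp add: lyap_decay_def)
  let ?\<eta> = "\<lambda>s. eps3 * U / om * exp (om * s)"
  have "lyap p c (x t) \<le> exp (- om * t) * (lyap p c (x 0) + ?\<eta> t - ?\<eta> 0)"
  proof (rule lyap_estimate[OF decay u x0 sol t _ _ h])
    show "continuous_on {0..t} ?\<eta>" by (intro continuous_intros)
    show "(?\<eta> has_real_derivative exp (om * s) * (eps3 * U)) (at s)" for s
      using om by (auto intro!: derivative_eq_intros)
  qed
  also have "\<dots> = exp (- om * t) * lyap p c (x 0) + eps3 * U / om * (exp (- om * t) * exp (om * t) - exp (- om * t))"
    by (simp add: algebra_simps)
  also have "exp (- om * t) * exp (om * t) = 1" by (simp add: exp_add[symmetric])
  finally show ?thesis by (simp add: mult_ac)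
qed

end

section \<open>Well-posedness and decay\<close>

theorem mainTheorem3:
  fixes p :: track and c cl cu ch om eps3 :: real
    and x0 :: state and u :: "real \<Rightarrow> real \<Rightarrow> real"
  assumes "track_params p"
    and "admissible_c p c"
    and "lyap_bounds p c cl cu ch"
    and "lyap_decay p c eps3 om"
    and "x0 \<in> domA p"
    and "C1_input p {0..} u"
  shows "\<exists>x. classical_solution p u x0 {0..} x \<and>
    (\<forall>T>(0::ereal). \<forall>y. classical_solution p u x0 {t. 0 \<le> t \<and> ereal t < T} y \<longrightarrow>
       (\<forall>t. 0 \<le> t \<and> ereal t < T \<longrightarrow> Xeq p (y t) (x t))) \<and>
    (\<forall>t\<ge>0. (Xnorm p (x t))\<^sup>2 \<le>
       exp (- om * t) * (cu / cl * (Xnorm p x0)\<^sup>2 + ch / cl * (Xnorm p x0) ^ 4)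
       + eps3 / (cl * om) * (1 - exp (- om * t)) * (SUP s\<in>{0..t}. (L2norm (tlen p) (u s))\<^sup>2)) \<and>
    ((\<exists>u0>0. \<exists>\<delta>>0. \<forall>t\<ge>0. L2norm (tlen p) (u t) \<le> u0 * exp (- \<delta> * t)) \<longrightarrow>
       (\<exists>M>0. \<exists>\<eta>>0. \<forall>t\<ge>0. Xnorm p (x t) \<le> M * exp (- \<eta> * t)))"
proof -
  interpret track_model p by unfold_locales (rule assms(1))
  interpret coL: coordinates "L2 l" "L2norm l" "sc l" 1 by (rule coordinates_L2[OF pos(1)])
  have cl: "0 < cl" "0 < cu" "0 < ch"
    and lyap_ge: "\<And>x. x \<in> XX p \<Longrightarrow> cl * (Xnorm p x)\<^sup>2 \<le> lyap p c x"
    and lyap_le: "\<And>x. x \<in> XX p \<Longrightarrow> lyap p c x \<le> cu * (Xnorm p x)\<^sup>2 + ch * (Xnorm p x) ^ 4"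
    using assms(3) by (auto simp: lyap_bounds_def)
  have om: "0 < om" "0 < eps3" using assms(4) by (auto simp: lyap_decay_def)
  obtain u' where u': "C1_with (L2 l) (L2norm l) {0..} u u'"
    using assms(6) by (auto simp: C1_input_def)
  have uL: "u t \<in> L2 l" if "0 \<le> t" for t
    using u' that unfolding coL.C1_with_iff by simp
  have uD: "((\<lambda>s. sc l (u s)) has_vector_derivative sc l (u' t)) (at t within {0..})" if "0 \<le> t" for t
    using u' that unfolding coL.C1_with_iff by simp
  have u'c: "continuous_on {0..} (\<lambda>t. sc l (u' t))"
    using u' unfolding coL.C1_with_iff by simp
  have uc: "continuous_on {0..} (\<lambda>t. sc l (u t))"
    unfolding continuous_on_eq_continuous_within
    using uD has_vector_derivative_continuous by fastforce
  have u_restrict: "C1_input p {0..T} u" for T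
  proof -
    have "C1_with (L2 l) (L2norm l) {0..T} u u'"
      using u' unfolding coL.C1_with_iff
      by (auto intro: has_vector_derivative_within_subset[of _ _ _ "{0..}"] continuous_on_subset)
    then show ?thesis unfolding C1_input_def by blast
  qed
  have u2: "continuous_on {0..T} (\<lambda>t. (L2norm l (u t))\<^sup>2)" for T
  proof -
    have "continuous_on {0..T} (\<lambda>t. (norm (sc l (u t)))\<^sup>2)"
      by (intro continuous_intros continuous_on_subset[OF uc]) auto
    then show ?thesis
      by (rule continuous_on_cong[THEN iffD1, OF refl, rotated]) (simp add: norm_sc pos uL)
  qed
  \<comment> \<open>Boundedness makes the real supremum an upper bound; it comes from continuity of
    the input on a compact interval.\<close>
  have u_bdd: "bdd_above ((\<lambda>s. (L2norm l (u s))\<^sup>2) ` {0..T})" for T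
    by (intro bounded_imp_bdd_above compact_imp_bounded compact_continuous_image u2) simp
  have u_SUP: "(L2norm l (u s))\<^sup>2 \<le> (SUP s\<in>{0..T}. (L2norm l (u s))\<^sup>2)" if "s \<in> {0..T}" for s T
    using that u_bdd by (rule cSUP_upper)
  define B where "B a = (0 :: ell2, (1 / ra) *\<^sub>R a)" for a :: ell2
  have B: "bounded_linear B"
    unfolding B_def[abs_def]
    by (intro bounded_linear_Pair bounded_linear_zero bounded_linear_scaleR_right)
  have BB: "BB f = B (sc l f)" for f by (simp add: BB_def B_def)
  have x0X: "x0 \<in> XX p" and a0: "\<And>n. PP n (cX (opA p x0)) = AA n (cX x0)"
    using opA_coeff[OF assms(5)] by blast+
  define W where "W = cu * (Xnorm p x0)\<^sup>2 + ch * (Xnorm p x0) ^ 4"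
  have W: "0 \<le> W" using cl by (simp add: W_def zero_le_even_power)
  have csol: "classical_solution p u x0 J (\<lambda>t. sX (X t))"
    if "strong_solution (\<lambda>t. BB (u t)) J X Z" "X 0 = cX x0" "J \<subseteq> {0..}" for J X Z
    using that uL by (intro strong_imp_classical[OF that(1) _ x0X that(2)]) auto
  \<comment> \<open>The solution starts at a representative of \<open>x0\<close> that is equal only
    almost everywhere, so the bound passes through the norms, which depend on the coordinates
    alone.\<close>
  have lyap_0: "lyap p c (sX Y) \<le> W" if "Y = cX x0" for Y
    using lyap_le[OF sX_XX[of Y]] Xnorm_eq[OF sX_XX[of Y]] Xnorm_eq[OF x0X] that
    by (simp add: cX_sX W_def)
  have apriori: "\<exists>R. \<forall>\<tau> X Z. 0 < \<tau> \<longrightarrow> \<tau> \<le> T \<longrightarrow> strong_solution (\<lambda>t. BB (u t)) {0..\<tau>} X Z \<longrightarrow>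
      X 0 = cX x0 \<longrightarrow> norm (X \<tau>) \<le> R" if T: "0 < T" for T
  proof -
    define U where "U = (SUP s\<in>{0..T}. (L2norm l (u s))\<^sup>2)"
    have U: "(L2norm l (u s))\<^sup>2 \<le> U" if "s \<in> {0..T}" for s
      unfolding U_def using that by (rule u_SUP)
    have U0: "0 \<le> U" using U[of 0] T by (auto intro: order_trans[OF zero_le_power2])
    \<comment> \<open>The divisor combines the lower Lyapunov constant \<open>cl\<close> with the
      factor \<open>ra\<close> between the squared norms; the numerator drops all decaying factors,
      so the bound depends on \<open>T\<close> alone.\<close>
    have "norm (X \<tau>) \<le> sqrt ((W + eps3 / om * U) / (cl * ra))"
      if \<tau>: "0 < \<tau>" "\<tau> \<le> T" and sol: "strong_solution (\<lambda>t. BB (u t)) {0..\<tau>} X Z"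
        and X0: "X 0 = cX x0" for \<tau> X Z
    proof (rule real_le_rsqrt)
      let ?e = "exp (- om * \<tau>)"
      have e: "0 < ?e" "?e \<le> 1" using om \<tau> by auto
      have "classical_solution p u x0 {0..\<tau>} (\<lambda>t. sX (X t))"
        using sol X0 by (rule csol) simp
      then have "lyap p c (sX (X \<tau>)) \<le> ?e * lyap p c (sX (X 0)) + eps3 / om * (1 - ?e) * U"
        using \<tau> U by (intro lyap_estimate_const[OF assms(4) u_restrict assms(5)]) auto
      also have "\<dots> \<le> 1 * W + eps3 / om * 1 * U"
      proof (rule add_mono)
        have "?e * lyap p c (sX (X 0)) \<le> ?e * W"
          using lyap_0[OF X0] e by (intro mult_left_mono) auto
        also have "\<dots> \<le> 1 * W" using W e by (intro mult_right_mono) auto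
        finally show "?e * lyap p c (sX (X 0)) \<le> 1 * W" .
        show "eps3 / om * (1 - ?e) * U \<le> eps3 / om * 1 * U"
          using om U0 e by (intro mult_right_mono mult_left_mono) auto
      qed
      finally have "cl * (Xnorm p (sX (X \<tau>)))\<^sup>2 \<le> W + eps3 / om * U"
        using lyap_ge[OF sX_XX[of "X \<tau>"]] by simp
      moreover have "(Xnorm p (sX (X \<tau>)))\<^sup>2 = ra * (norm (X \<tau>))\<^sup>2"
        using pos by (simp add: Xnorm_eq[OF sX_XX] cX_sX power_mult_distrib)
      ultimately show "(norm (X \<tau>))\<^sup>2 \<le> (W + eps3 / om * U) / (cl * ra)"
        using cl pos by (simp add: pos_le_divide_eq mult_ac)
    qed
    then show ?thesis by blast
  qed
  obtain X Z where X: "strong_solution (\<lambda>t. BB (u t)) {0..} X Z" "X 0 = cX x0"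
  \<comment> \<open>That \<open>x0\<close> lies in the domain supplies \<open>cX (opA p x0)\<close>
    as the vector standing for the generator applied to the initial state.\<close>
  proof (rule global_strong_solution[of "\<lambda>t. BB (u t)" "\<lambda>t. BB (u' t)" "cX (opA p x0)" "cX x0"])
    show "continuous_on {0..} (\<lambda>t. BB (u t))" "continuous_on {0..} (\<lambda>t. BB (u' t))"
      unfolding BB by (intro bounded_linear.continuous_on[OF B] uc u'c)+
    show "((\<lambda>t. BB (u t)) has_vector_derivative BB (u' t)) (at t)" if "0 < t" for t
    proof -
      have "((\<lambda>s. B (sc l (u s))) has_vector_derivative B (sc l (u' t))) (at t within {0..})"
        using that by (intro bounded_linear.has_vector_derivative[OF B] uD) simp
      moreover have "at t within {0..} = at t"
        using that by (intro at_within_interior) simp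
      ultimately show ?thesis by (simp add: BB)
    qed
    show "PP n (cX (opA p x0)) = AA n (cX x0)" for n by (rule a0)
    show "\<exists>R. \<forall>\<tau> X Z. 0 < \<tau> \<longrightarrow> \<tau> \<le> T \<longrightarrow> strong_solution (\<lambda>t. BB (u t)) {0..\<tau>} X Z \<longrightarrow>
      X 0 = cX x0 \<longrightarrow> norm (X \<tau>) \<le> R" if "0 < T" for T
      using that by (rule apriori)
  qed
  have sol: "classical_solution p u x0 {0..} (\<lambda>t. sX (X t))"
    by (rule csol[OF X]) simp
  have solT: "classical_solution p u x0 {0..t} (\<lambda>t. sX (X t))" for t
    by (rule csol[OF strong_solution_subset[OF X(1)] X(2)]) auto
  have unique: "Xeq p (y t) (sX (X t))"
    if y: "classical_solution p u x0 {t. 0 \<le> t \<and> ereal t < T} y" and t: "0 \<le> t" "ereal t < T" for T y t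
  proof -
    let ?J = "{t. 0 \<le> t \<and> ereal t < T}"
    \<comment> \<open>A competitor may exist on a half-open interval only, so the comparison takes
      place on \<open>{0..t}\<close> for each admissible \<open>t\<close>.\<close>
    have J: "{0..t} \<subseteq> ?J"
      using t(2) by (auto intro: le_less_trans[of "ereal _" "ereal t"])
    have "y t \<in> XX p" using y t by (simp add: classical_solution_def)
    note wy = classical_imp_weak[OF y uL J t(1) x0X]
    have wX: "weak_solution t (\<lambda>t. BB (u t) + FF (X t)) X"
      by (rule strong_solution_imp_weak[OF strong_solution_subset[OF X(1)]]) auto
    have "cX (y t) = X t"
      by (rule weak_solution_unique[OF wy(1) wX]) (use wy(2) X(2) t in auto)
    then show ?thesis
      using Xeq_iff[OF \<open>y t \<in> XX p\<close> sX_XX] by (simp add: cX_sX)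
  qed
  have bound: "(Xnorm p (sX (X t)))\<^sup>2 \<le>
       exp (- om * t) * (cu / cl * (Xnorm p x0)\<^sup>2 + ch / cl * (Xnorm p x0) ^ 4)
       + eps3 / (cl * om) * (1 - exp (- om * t)) * (SUP s\<in>{0..t}. (L2norm l (u s))\<^sup>2)" if t: "0 \<le> t" for t
  proof -
    let ?U = "SUP s\<in>{0..t}. (L2norm l (u s))\<^sup>2" and ?e = "exp (- om * t)"
    have "cl * (Xnorm p (sX (X t)))\<^sup>2 \<le> lyap p c (sX (X t))" by (rule lyap_ge[OF sX_XX])
    also have "\<dots> \<le> ?e * lyap p c (sX (X 0)) + eps3 / om * (1 - ?e) * ?U"
      by (rule lyap_estimate_const[OF assms(4) u_restrict assms(5) solT t u_SUP])
    also have "\<dots> \<le> ?e * W + eps3 / om * (1 - ?e) * ?U"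
      using lyap_0[OF X(2)] by (intro add_right_mono mult_left_mono) auto
    finally have "(Xnorm p (sX (X t)))\<^sup>2 \<le> (?e * W + eps3 / om * (1 - ?e) * ?U) / cl"
      using cl by (simp add: pos_le_divide_eq mult.commute)
    also have "\<dots> = ?e * (cu / cl * (Xnorm p x0)\<^sup>2 + ch / cl * (Xnorm p x0) ^ 4)
        + eps3 / (cl * om) * (1 - ?e) * ?U"
      by (simp add: W_def add_divide_distrib distrib_left mult_ac)
    finally show ?thesis .
  qed
  have decay: "\<exists>M>0. \<exists>\<eta>>0. \<forall>t\<ge>0. Xnorm p (sX (X t)) \<le> M * exp (- \<eta> * t)"
    if u0: "0 < u0" "0 < \<delta>" "\<And>t. 0 \<le> t \<Longrightarrow> L2norm l (u t) \<le> u0 * exp (- \<delta> * t)" for u0 \<delta>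
  proof -
    \<comment> \<open>The squared input decays at rate \<open>2 * \<delta>\<close>. Staying strictly
      below \<open>om\<close> avoids resonance, that is, a zero divisor in \<open>K\<close>.\<close>
    define \<beta> where "\<beta> = min (om / 2) (2 * \<delta>)"
    have \<beta>: "0 < \<beta>" "\<beta> < om" "\<beta> \<le> 2 * \<delta>" using om u0 by (auto simp: \<beta>_def)
    \<comment> \<open>The coefficient obtained by integrating
      \<open>eps3 * u0\<^sup>2 * exp ((om - \<beta>) * s)\<close>.\<close>
    define K where "K = eps3 * u0\<^sup>2 / (om - \<beta>)"
    have K: "0 < K" using \<beta> om u0 by (simp add: K_def)
    let ?h = "\<lambda>s. u0\<^sup>2 * exp (- \<beta> * s)" and ?\<eta> = "\<lambda>s. K * exp ((om - \<beta>) * s)"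
    have h: "(L2norm l (u s))\<^sup>2 \<le> ?h s" if "0 \<le> s" for s
    proof -
      have "(L2norm l (u s))\<^sup>2 \<le> (u0 * exp (- \<delta> * s))\<^sup>2"
        using u0(3)[OF that] L2norm_nonneg by (intro power_mono)
      also have "\<dots> = u0\<^sup>2 * exp (- (2 * \<delta>) * s)"
        by (simp add: power_mult_distrib power2_eq_square exp_add[symmetric])
      also have "\<dots> \<le> ?h s"
        using \<beta>(3) that by (intro mult_left_mono) (auto intro: mult_right_mono)
      finally show ?thesis .
    qed
    have main: "(Xnorm p (sX (X t)))\<^sup>2 \<le> ((W + K) / cl) * exp (- \<beta> * t)" if t: "0 \<le> t" for t
    proof -
      have "cl * (Xnorm p (sX (X t)))\<^sup>2 \<le> lyap p c (sX (X t))" by (rule lyap_ge[OF sX_XX])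
      also have "\<dots> \<le> exp (- om * t) * (lyap p c (sX (X 0)) + ?\<eta> t - ?\<eta> 0)"
      proof (rule lyap_estimate[OF assms(4) u_restrict assms(5) solT t, where h = ?h])
        show "continuous_on {0..t} ?\<eta>" by (intro continuous_intros)
        show "(?\<eta> has_real_derivative exp (om * s) * (eps3 * ?h s)) (at s)" for s
        proof -
          have "(?\<eta> has_real_derivative K * (exp ((om - \<beta>) * s) * (om - \<beta>))) (at s)"
            by (auto intro!: derivative_eq_intros)
          moreover have "exp ((om - \<beta>) * s) = exp (om * s) * exp (- \<beta> * s)"
            by (simp add: exp_add[symmetric] algebra_simps)
          ultimately show ?thesis using \<beta> by (simp add: K_def mult_ac)
        qed
      qed (use h in auto)
      also have "\<dots> \<le> exp (- om * t) * (W + ?\<eta> t)"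
        using lyap_0[OF X(2)] K by (intro mult_left_mono) auto
      also have "\<dots> = exp (- om * t) * W + K * (exp (- om * t) * exp ((om - \<beta>) * t))"
        by (simp add: algebra_simps)
      also have "exp (- om * t) * exp ((om - \<beta>) * t) = exp (- \<beta> * t)"
        by (simp add: exp_add[symmetric] algebra_simps)
      also have "exp (- om * t) * W + K * exp (- \<beta> * t) \<le> exp (- \<beta> * t) * W + K * exp (- \<beta> * t)"
        using \<beta> t W by (intro add_right_mono mult_right_mono) (auto intro: mult_right_mono)
      finally show ?thesis
        using cl by (simp add: pos_le_divide_eq algebra_simps)
    qed
    have WK: "0 < (W + K) / cl" using W K cl by simp
    \<comment> \<open>Taking square roots halves the rate, so \<open>\<eta>\<close> becomes
      \<open>\<beta> / 2\<close>.\<close>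
    have "Xnorm p (sX (X t)) \<le> sqrt ((W + K) / cl) * exp (- (\<beta> / 2) * t)" if t: "0 \<le> t" for t
    proof (rule power2_le_imp_le)
      have "(exp (- (\<beta> / 2) * t))\<^sup>2 = exp (- \<beta> * t)"
        by (simp add: power2_eq_square exp_add[symmetric])
      then have "(sqrt ((W + K) / cl) * exp (- (\<beta> / 2) * t))\<^sup>2 = ((W + K) / cl) * exp (- \<beta> * t)"
        unfolding power_mult_distrib using WK by (simp only: real_sqrt_pow2 less_imp_le)
      then show "(Xnorm p (sX (X t)))\<^sup>2 \<le> (sqrt ((W + K) / cl) * exp (- (\<beta> / 2) * t))\<^sup>2"
        using main[OF t] by simp
      show "0 \<le> sqrt ((W + K) / cl) * exp (- (\<beta> / 2) * t)" using WK by simp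
    qed
    moreover have "0 < sqrt ((W + K) / cl)" "0 < \<beta> / 2" using WK \<beta> by simp_all
    ultimately show ?thesis by blast
  qed
  show ?thesis
    using sol unique bound decay by (intro exI[of _ "\<lambda>t. sX (X t)"]) blast
qed

end
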